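(* Consider the stochastic gradient-tracking iterates $\{x_k^i\},\{y_k^i\}$ with constant step-size $\alpha$ over time-varying directed graphs, as described in the context, with all the assumptions, constants, the vectors $V_k$, the matrix $M(\alpha)$ and the vector $\mathbf b(\alpha)$ as given there. Suppose the step-size $\alpha>0$ is chosen such that $$\alpha\le\min\Big\{\tfrac{2}{n\eta(L+\mu)},\ \tfrac{\mu\eta(1-c^2)(1-\tau^2)}{4L\varphi\sqrt{(n\mu^2\eta^2+24L^2\varphi^2)(\eta+16\kappa^2)}},\ \tfrac{\mu\eta(1-\tau^2)}{\kappa L\sqrt{2n\mu^2\eta^2(n+4)+6L^2\varphi^2(n\eta+32)}}\Big\}.$$ Then the spectral radius $\rho_M$ of $M(\alpha)$ satisfies $\rho_M<1$, the vector $(\mathbb I-M(\alpha))^{-1}\mathbf b(\alpha)$ has non-negative components, and, componentwise, $$\limsup_{k\to\infty}V_k\le(\mathbb I-M(\alpha))^{-1}\mathbf b(\alpha),$$ with a linear convergence rate of the order of $\mathcal O(\rho_M^k)$.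
   Context: **Problem.** $n$ agents, $[n]=\{1,\dots,n\}$; $f_i:\mathbb R^p\to\mathbb R$ is agent $i$'s cost, and $f=\frac1n\sum_{i=1}^n f_i$. Each $f_i$ is continuously differentiable with $L$-Lipschitz gradient ($L>0$): $\|\nabla f_i(x)-\nabla f_i(y)\|\le L\|x-y\|$ for all $x,y$. The function $f$ is $\mu$-strongly convex ($\mu>0$): $\langle\nabla f(x)-\nabla f(y),x-y\rangle\ge\mu\|x-y\|^2$ for all $x,y$. $x^*$ is the unique minimizer of $f$ on $\mathbb R^p$. **Graphs.** For each $k\ge0$, $\mathbb G_k=([n],\mathcal E_k)$ is a strongly connected directed graph with a self-loop at every node; $(j,i)\in\mathcal E_k$ means that $i$ receives information from $j$. For a strongly connected digraph $\mathbb G$, $\mathsf D(\mathbb G)$ is its diameter (largest length of a shortest directed path between an ordered pair of distinct nodes), and $\mathsf K(\mathbb G)$ is its maximal edge-utility: for a collection $\mathcal P$ consisting of one shortest directed path for each ordered pair of distinct nodes, let $\mathsf K(\mathcal P)$ be the maximum over edges of the number of paths in $\mathcal P$ using that edge; $\mathsf K(\mathbb G)$ is the maximum of $\mathsf K(\mathcal P)$ over all such $\mathcal P$. **Weights.** $A_k,B_k\in\mathbb R^{n\times n}$ are nonnegative, with $[A_k]_{ij}>0$ if $(j,i)\in\mathcal E_k$ or $j=i$ and $[A_k]_{ij}=0$ otherwise; likewise $[B_k]_{ij}>0$ if $(j,i)\in\mathcal E_k$ or $j=i$ and $[B_k]_{ij}=0$ otherwise. $A_k$ is row-stochastic ($A_k\mathbf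 1=\mathbf 1$) and $B_k$ is column-stochastic ($\mathbf 1^{\mathsf T}B_k=\mathbf 1^{\mathsf T}$), where $\mathbf 1$ is the all-ones vector. There are scalars $a,b>0$ such that for all $k\ge0$ every positive entry of $A_k$ is at least $a$ and every positive entry of $B_k$ is at least $b$. **Stochastic oracle.** Agent $i$ can query $g_i(x,\xi_i)$, $\xi_i\in\mathbb R^m$ random. The random vectors $\xi_k^i$ ($i\in[n]$, $k\ge0$) are independent, and for all $i$ and $x\in\mathbb R^p$: $\mathbb E[g_i(x,\xi_i)\mid x]=\nabla f_i(x)$ and $\mathbb E[\|g_i(x,\xi_i)-\nabla f_i(x)\|^2\mid x]\le\sigma^2$ for some $\sigma>0$. **Algorithm.** $x_0^i\in\mathbb R^p$ arbitrary, $y_0^i=g_i(x_0^i,\xi_0^i)$, and for $k\ge0$ $$x_{k+1}^i=\sum_{j=1}^n[A_k]_{ij}x_k^j-\alpha y_k^i,\qquad y_{k+1}^i=\sum_{j=1}^n[B_k]_{ij}y_k^j+g_i(x_{k+1}^i,\xi_{k+1}^i)-g_i(x_k^i,\xi_k^i).$$ Write $\mathbf x_k=[x_k^1,\dots,x_k^n]^{\mathsf T}$, $\mathbf y_k=[y_k^1,\dots,y_k^n]^{\mathsf T}\in\mathbb R^{n\times p}$. **Weighted quantities.** $\{\phi_k\}$ is a sequence of positive stochastic vectors (entries summing to 1) with $\phi_{k+1}^{\mathsf T}A_k=\phi_k^{\mathsf T}$ for all $k\ge 0$; $\{\pi_k\}$ is defined by $\pi_0=\frac1n\mathbf 1$,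 $\pi_{k+1}=B_k\pi_k$. $\hat x_k=\sum_i[\phi_k]_ix_k^i$ and $\hat{\mathbf x}_k=\mathbf 1\hat x_k^{\mathsf T}$ (all rows equal to $\hat x_k$). For a positive vector $\mathbf a$ and $\mathbf u=[u_1,\dots,u_n]^{\mathsf T}\in\mathbb R^{n\times p}$, $\|\mathbf u\|_{\mathbf a}=\sqrt{\sum_ia_i\|u_i\|^2}$. Also $$S(\mathbf y_k,\pi_k)=\sqrt{\sum_{i=1}^n[\pi_k]_i\Big\|\tfrac{y_k^i}{[\pi_k]_i}-\sum_{j=1}^ny_k^j\Big\|^2},$$ $$V_k=\big(\mathbb E[\|\hat x_k-x^*\|^2],\ \mathbb E[\|\mathbf x_k-\hat{\mathbf x}_k\|_{\phi_k}^2],\ \mathbb E[S^2(\mathbf y_k,\pi_k)]\big)^{\mathsf T}.$$ **Constants.** $\min(u),\max(u)$ denote the smallest and largest entries of a vector $u$. Let $$\kappa_k=\sqrt{\tfrac1{\min(\pi_k)}},\quad\varphi_k=\sqrt{\tfrac1{\min(\phi_k)}},\quad\psi_k=n(\kappa_{k+1}^2-1),$$ $$\tau_k=\sqrt{1-\tfrac{\min^2(\pi_k)\,b^2}{\max^2(\pi_k)\max(\pi_{k+1})\mathsf D(\mathbb G_k)\mathsf K(\mathbb G_k)}},\quad c_k=\sqrt{1-\tfrac{\min(\phi_{k+1})\,a^2}{\max^2(\phi_k)\mathsf D(\mathbb G_k)\mathsf K(\mathbb G_k)}}.$$ $c,\tau\in(0,1)$ are upper bounds for all $c_k$, $\tau_k$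 respectively; $\psi>0$, $\kappa>1$, $\varphi>1$ are upper bounds for all $\psi_k$, $\kappa_k$, $\varphi_k$ respectively; $\eta\in(0,1)$ is a lower bound for all $\phi_{k+1}^{\mathsf T}\pi_k$, $k\ge0$. Let $\nu=\frac{4L^2\kappa^2\tau^2}{1-\tau^2}+2\psi L^2$ and $\zeta=4\varphi^2\nu$. **Matrix and vector.** $$M(\alpha)=\begin{bmatrix}1-m_1\alpha&m_2\alpha&m_3\alpha\\ m_4\alpha^2&\frac{1+c^2}2+m_4\alpha^2&m_5\alpha^2\\ m_6\alpha^2&m_7+m_6\alpha^2&\frac{1+\tau^2}2+m_8\alpha^2\end{bmatrix},\qquad\mathbf b(\alpha)=\begin{bmatrix}b_1\alpha^2\\ b_2\alpha^2\\ b_3+b_4\alpha+b_5\alpha^2\end{bmatrix},$$ where $m_1=\frac{n\mu\eta}2$, $m_2=\frac{3L^2\varphi^2}\mu$, $m_3=\frac3{n\mu\eta}$, $m_4=\frac{2nL^2\varphi^2(1+c^2)}{1-c^2}$, $m_5=\frac{1+c^2}{1-c^2}$, $m_6=2nL^2\varphi^2\nu$, $m_7=\zeta$, $m_8=\nu$, $b_1=\frac{3n\sigma^2}2$, $b_2=\frac{2(1+c^2)\sigma^2}{1-c^2}$, $b_3=4n\psi\sigma^2$, $b_4=2Ln\psi\sigma^2$, $b_5=2\nu\sigma^2$. $\mathbb I$ is the identity matrix.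
   Formalization: The formal theorem also assumes ψ ≤ n(κ²−1), the bound that κ induces on ψ_k; with an arbitrary upper bound ψ the claim fails, since the step-size condition ignores ψ while the (3,3) entry of M(α) grows with ψ and exceeds 1. *)

theory Defs
  imports
    "HOL-Probability.Probability"
    "HOL-Library.Landau_Symbols"
    "Graph_Theory.Digraph_Component"
    "Graph_Theory.Pair_Digraph"
    "Jordan_Normal_Form.Gauss_Jordan_Elimination"
    "Jordan_Normal_Form.Spectral_Radius"
begin

text \<open>
  Per-agent and per-coordinate vectors and matrices, whose size is arbitrary but fixed, have types
  \<open>real^'n\<close>, \<open>real^'p\<close>, \<open>real^'n^'n\<close> and \<open>real^'p^'n\<close> (row \<open>i\<close> belongs to agent \<open>i\<close>). The
  three-dimensional recursion matrix uses the matrices of \<open>Jordan_Normal_Form\<close>, which provides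
  the spectral radius. The infix \<open>$\<close> is reserved for the former.
\<close>

no_notation Matrix.vec_index (infixl \<open>$\<close> 100)

text \<open>An arc \<open>(j, i)\<close> means that \<open>i\<close> receives information from \<open>j\<close>.\<close>

definition net :: "('n \<times> 'n) set \<Rightarrow> ('n, 'n \<times> 'n) pre_digraph" where
  "net E = with_proj \<lparr>pverts = UNIV, parcs = E\<rparr>"

definition shortest_path :: "('v, 'e) pre_digraph \<Rightarrow> 'v \<Rightarrow> 'e list \<Rightarrow> 'v \<Rightarrow> bool" where
  "shortest_path G u p v \<longleftrightarrow> pre_digraph.apath G u p v \<and>
     (\<forall>q. pre_digraph.apath G u q v \<longrightarrow> length p \<le> length q)"

definition diam :: "('v, 'e) pre_digraph \<Rightarrow> nat" where
  "diam G = Max {length p | u p v. u \<in> verts G \<and> v \<in> verts G \<and> u \<noteq> v \<and> shortest_path G u p v}"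

text \<open>A collection of shortest paths is a function \<open>P\<close> of the ordered pair of end points; its
  values on the diagonal are never used.\<close>

definition shortest_path_collection ::
    "('v, 'e) pre_digraph \<Rightarrow> ('v \<Rightarrow> 'v \<Rightarrow> 'e list) \<Rightarrow> bool" where
  "shortest_path_collection G P \<longleftrightarrow>
     (\<forall>u\<in>verts G. \<forall>v\<in>verts G. u \<noteq> v \<longrightarrow> shortest_path G u (P u v) v)"

definition collection_utility ::
    "('v, 'e) pre_digraph \<Rightarrow> ('v \<Rightarrow> 'v \<Rightarrow> 'e list) \<Rightarrow> nat" where
  "collection_utility G P = Max ((\<lambda>e. card {(u, v). u \<in> verts G \<and> v \<in> verts G \<and> u \<noteq> v \<and>
     e \<in> set (P u v)}) ` arcs G)"

text \<open>For a single node with a self-loop this is \<open>0\<close>; the value of \<open>diam\<close>, a maximum over the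
  empty set, is then irrelevant, because only the product of the two is used.\<close>

definition max_edge_utility :: "('v, 'e) pre_digraph \<Rightarrow> nat" where
  "max_edge_utility G = Max {collection_utility G P | P. shortest_path_collection G P}"

definition vmin :: "real^'n \<Rightarrow> real" where
  "vmin u = Min (range (\<lambda>i. u $ i))"

definition vmax :: "real^'n \<Rightarrow> real" where
  "vmax u = Max (range (\<lambda>i. u $ i))"

definition wavg :: "real^'n \<Rightarrow> real^'p^'n \<Rightarrow> real^'p" where
  "wavg w u = (\<Sum>i\<in>UNIV. w $ i *\<^sub>R u $ i)"

definition wnorm :: "real^'n \<Rightarrow> real^'p^'n \<Rightarrow> real" where
  "wnorm w u = sqrt (\<Sum>i\<in>UNIV. w $ i * (norm (u $ i))\<^sup>2)"

definition S_disp :: "real^'p^'n \<Rightarrow> real^'n \<Rightarrow> real" where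
  "S_disp y w = sqrt (\<Sum>i\<in>UNIV. w $ i * (norm ((1 / w $ i) *\<^sub>R y $ i - (\<Sum>j\<in>UNIV. y $ j)))\<^sup>2)"

text \<open>The random variables whose expectations are the components of \<open>V\<^sub>k\<close>, at
  \<open>w = \<phi>\<^sub>k\<close>, \<open>w' = \<pi>\<^sub>k\<close> and realisations \<open>x\<close>, \<open>y\<close> of the iterates.\<close>

definition sq_errors ::
    "real^'n \<Rightarrow> real^'n \<Rightarrow> real^'p \<Rightarrow> real^'p^'n \<Rightarrow> real^'p^'n \<Rightarrow> real list" where
  "sq_errors w w' xstar x y =
     [(norm (wavg w x - xstar))\<^sup>2,
      (wnorm w (x - (\<chi> i. wavg w x)))\<^sup>2,
      (S_disp y w')\<^sup>2]"

definition inv_min_sqrt :: "real^'n \<Rightarrow> real" where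
  "inv_min_sqrt u = sqrt (1 / vmin u)"

text \<open>\<open>c\<^sub>k\<close> is \<open>c_factor a G\<^sub>k \<phi>\<^sub>k \<phi>\<^sub>k\<^sub>+\<^sub>1\<close> and \<open>\<tau>\<^sub>k\<close> is \<open>tau_factor b G\<^sub>k \<pi>\<^sub>k \<pi>\<^sub>k\<^sub>+\<^sub>1\<close>.\<close>

definition c_factor :: "real \<Rightarrow> ('n, 'e) pre_digraph \<Rightarrow> real^'n \<Rightarrow> real^'n \<Rightarrow> real" where
  "c_factor a G w w' = sqrt (1 - (vmin w' * a\<^sup>2) /
     ((vmax w)\<^sup>2 * real (diam G) * real (max_edge_utility G)))"

definition tau_factor :: "real \<Rightarrow> ('n, 'e) pre_digraph \<Rightarrow> real^'n \<Rightarrow> real^'n \<Rightarrow> real" where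
  "tau_factor b G w w' = sqrt (1 - ((vmin w)\<^sup>2 * b\<^sup>2) /
     ((vmax w)\<^sup>2 * vmax w' * real (diam G) * real (max_edge_utility G)))"

definition nu_const :: "real \<Rightarrow> real \<Rightarrow> real \<Rightarrow> real \<Rightarrow> real" where
  "nu_const L \<kappa> \<psi> \<tau> = 4 * L\<^sup>2 * \<kappa>\<^sup>2 * \<tau>\<^sup>2 / (1 - \<tau>\<^sup>2) + 2 * \<psi> * L\<^sup>2"

text \<open>\<open>vphi\<close> is the uniform bound on \<open>sqrt (1 / min \<phi>\<^sub>k)\<close>.\<close>

definition M_mat ::
    "nat \<Rightarrow> real \<Rightarrow> real \<Rightarrow> real \<Rightarrow> real \<Rightarrow> real \<Rightarrow> real \<Rightarrow> real \<Rightarrow> real \<Rightarrow> real \<Rightarrow> real mat" where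
  "M_mat n L \<mu> \<eta> \<kappa> vphi \<psi> c \<tau> \<alpha> =
    (let \<nu> = nu_const L \<kappa> \<psi> \<tau>;
         \<zeta> = 4 * vphi\<^sup>2 * \<nu>;
         m1 = real n * \<mu> * \<eta> / 2;
         m2 = 3 * L\<^sup>2 * vphi\<^sup>2 / \<mu>;
         m3 = 3 / (real n * \<mu> * \<eta>);
         m4 = 2 * real n * L\<^sup>2 * vphi\<^sup>2 * (1 + c\<^sup>2) / (1 - c\<^sup>2);
         m5 = (1 + c\<^sup>2) / (1 - c\<^sup>2);
         m6 = 2 * real n * L\<^sup>2 * vphi\<^sup>2 * \<nu>;
         m7 = \<zeta>;
         m8 = \<nu>
     in mat_of_rows_list 3
       [[1 - m1 * \<alpha>, m2 * \<alpha>, m3 * \<alpha>],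
        [m4 * \<alpha>\<^sup>2, (1 + c\<^sup>2) / 2 + m4 * \<alpha>\<^sup>2, m5 * \<alpha>\<^sup>2],
        [m6 * \<alpha>\<^sup>2, m7 + m6 * \<alpha>\<^sup>2, (1 + \<tau>\<^sup>2) / 2 + m8 * \<alpha>\<^sup>2]])"

definition b_vec ::
    "nat \<Rightarrow> real \<Rightarrow> real \<Rightarrow> real \<Rightarrow> real \<Rightarrow> real \<Rightarrow> real \<Rightarrow> real \<Rightarrow> real Matrix.vec" where
  "b_vec n L \<kappa> \<psi> c \<tau> \<sigma> \<alpha> =
    (let \<nu> = nu_const L \<kappa> \<psi> \<tau>;
         b1 = 3 * real n * \<sigma>\<^sup>2 / 2;
         b2 = 2 * (1 + c\<^sup>2) * \<sigma>\<^sup>2 / (1 - c\<^sup>2);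
         b3 = 4 * real n * \<psi> * \<sigma>\<^sup>2;
         b4 = 2 * L * real n * \<psi> * \<sigma>\<^sup>2;
         b5 = 2 * \<nu> * \<sigma>\<^sup>2
     in vec_of_list [b1 * \<alpha>\<^sup>2, b2 * \<alpha>\<^sup>2, b3 + b4 * \<alpha> + b5 * \<alpha>\<^sup>2])"

end

theory Submission
  imports Defs
begin

text \<open>
  Summing over shortest paths turns the connectivity of the graphs into a Poincare inequality,
  which makes every mixing step contract the weighted variance of the iterates (for \<open>A\<^sub>k\<close>) and the
  dispersion of the scaled trackers (for \<open>B\<^sub>k\<close>). The noise of step \<open>k\<close> is orthogonal to everything
  that depends only on earlier samples, and this bounds the expected errors after one step linearly in
  those before it. The resulting rows match \<open>M\<close> and \<open>b\<close> except that the noise of the summed trackers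
  has variance \<open>n \<sigma>\<^sup>2\<close>; the surplus is absorbed only when the third error is replaced by its maximum
  with the limiting bound \<open>w = (1 - M)\<^sup>-\<^sup>1 b\<close>. Hence the positive part \<open>e\<^sub>k\<close> of \<open>V\<^sub>k - w\<close> satisfies
  \<open>e\<^sub>k\<^sub>+\<^sub>1 \<le> M e\<^sub>k\<close>. As \<open>M\<close> is positive it has a positive Perron vector for \<open>\<rho>\<close>, so
  \<open>e\<^sub>k = O(\<rho>\<^sup>k)\<close>, and an explicit positive vector \<open>z\<close> with \<open>M z < z\<close> gives \<open>\<rho> < 1\<close> and \<open>w \<ge> 0\<close>.
\<close>

section \<open>Contraction by mixing over a graph\<close>

text \<open>The inequality \<open>V (Suc k) \<le> M * V k + b\<close> is not what the estimates
  yield: the term \<open>2 * \<sigma>\<^sup>2\<close> that accompanies the squared trackers in rows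
  two and three is too small for noise of size \<open>n * \<sigma>\<^sup>2\<close>. What helps is
  that the total squared norm of the trackers is at most the largest entry of
  \<open>\<pi>\<^sub>k\<close> times (dispersion + squared sum). That entry stays below 1 by a
  definite gap, so a dispersion bound of at least \<open>8 * n * \<psi> * \<sigma>\<^sup>2\<close>
  saves as much as the noise costs. The limit has such a third component because the last diagonal
  entry of M is at least 1/2 and the last entry of b at least
  \<open>4 * n * \<psi> * \<sigma>\<^sup>2\<close>. The three step-size bounds have separate tasks:
  the first keeps the top left entry of M positive, the second provides the vector z, the third
  makes the averaged gradient step contract. Domination by a multiple of the Perron vector is passed
  on at each step with the factor \<rho> exactly, so the rate has neither a polynomial factor nor an
  enlarged base.\<close>

lemma (in wf_digraph) norm_diff_le_sum_path:
  fixes x :: "'a \<Rightarrow> 'c::real_normed_vector"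
  assumes "awalk u p v" "distinct p"
  shows "norm (x u - x v) \<le> (\<Sum>e\<in>set p. norm (x (tail G e) - x (head G e)))"
  using assms
proof (induction p arbitrary: u)
  case Nil
  then show ?case by (simp add: awalk_Nil_iff)
next
  case (Cons e es)
  then have *: "tail G e = u" "awalk (head G e) es v" "distinct es" "e \<notin> set es"
    by (auto simp: awalk_Cons_iff)
  have "norm (x u - x v) \<le> norm (x u - x (head G e)) + norm (x (head G e) - x v)"
    using norm_triangle_ineq[of "x u - x (head G e)" "x (head G e) - x v"] by simp
  with Cons.IH[OF *(2,3)] * show ?case by simp
qed

lemma (in wf_digraph) norm_diff_sq_le_sum_path:
  fixes x :: "'a \<Rightarrow> 'c::real_normed_vector"
  assumes "awalk u p v" "distinct p"
  shows "(norm (x u - x v))\<^sup>2 \<le>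
    real (length p) * (\<Sum>e\<in>set p. (norm (x (tail G e) - x (head G e)))\<^sup>2)"
proof -
  have "(norm (x u - x v))\<^sup>2 \<le> (\<Sum>e\<in>set p. norm (x (tail G e) - x (head G e)))\<^sup>2"
    using norm_diff_le_sum_path[OF assms, of x] by (intro power_mono) auto
  also have "\<dots> \<le> (\<Sum>e\<in>set p. (norm (x (tail G e) - x (head G e)))\<^sup>2) * card (set p)"
    by (rule sum_squared_le_sum_of_squares)
  finally show ?thesis using assms(2) by (simp add: distinct_card mult.commute)
qed

text \<open>\<open>diam\<close> is a \<open>Max\<close> and bounds its members only if they form a
  finite set; the lengths come from the finitely many simple paths.\<close>

lemma (in fin_digraph) length_shortest_path_le_diam:
  assumes "u \<in> verts G" "v \<in> verts G" "u \<noteq> v" "shortest_path G u p v"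
  shows "length p \<le> diam G"
proof -
  let ?S = "{length p | u p v. u \<in> verts G \<and> v \<in> verts G \<and> u \<noteq> v \<and> shortest_path G u p v}"
  have "?S \<subseteq> (\<lambda>(u, p, v). length p) ` {(u, p, v). apath u p v}"
    by (force simp: shortest_path_def)
  then have "finite ?S"
    using apaths_finite_triple by (rule finite_surj[rotated])
  then show ?thesis
    unfolding diam_def using assms by (intro Max_ge) auto
qed

lemma (in fin_digraph) exists_shortest_path_collection:
  assumes "strongly_connected G"
  obtains P where "shortest_path_collection G P"
proof -
  have "\<exists>p. shortest_path G u p v" if "u \<in> verts G" "v \<in> verts G" for u v
  proof -
    have "\<exists>p. apath u p v"
      using assms that reachable_apath by (auto simp: strongly_connected_def)
    then have "apath u (ARG_MIN length p. apath u p v) v \<and>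
        (\<forall>q. apath u q v \<longrightarrow> length (ARG_MIN length p. apath u p v) \<le> length q)"
      using arg_min_nat_lemma[of "\<lambda>p. apath u p v"] by blast
    then show ?thesis unfolding shortest_path_def by blast
  qed
  then have "shortest_path_collection G (\<lambda>u v. SOME p. shortest_path G u p v)"
    unfolding shortest_path_collection_def by (auto intro: someI_ex)
  then show thesis by (rule that)
qed

text \<open>There are infinitely many collections, as their values on the diagonal are arbitrary
  lists. The outer \<open>Max\<close> is still over a finite set, because every utility is at most
  the number of ordered pairs of nodes.\<close>

lemma (in fin_digraph) card_pairs_le_max_edge_utility:
  assumes P: "shortest_path_collection G P" and e: "e \<in> arcs G"
  shows "card {(u, v). u \<in> verts G \<and> v \<in> verts G \<and> u \<noteq> v \<and> e \<in> set (P u v)} \<le> max_edge_utility G"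
proof -
  let ?c = "\<lambda>P e. card {(u, v). u \<in> verts G \<and> v \<in> verts G \<and> u \<noteq> v \<and> e \<in> set (P u v)}"
  have "?c Q e' \<le> card (verts G \<times> verts G)" for Q :: "'a \<Rightarrow> 'a \<Rightarrow> 'b list" and e'
    by (intro card_mono) auto
  then have "collection_utility G Q \<le> card (verts G \<times> verts G)" for Q
    unfolding collection_utility_def using e by (intro Max.boundedI) auto
  then have "{collection_utility G P | P. shortest_path_collection G P} \<subseteq> {..card (verts G \<times> verts G)}"
    by auto
  then have fin: "finite {collection_utility G P | P. shortest_path_collection G P}"
    by (rule finite_subset) simp
  have "?c P e \<le> collection_utility G P"
    unfolding collection_utility_def using e by (intro Max_ge) auto
  also have "\<dots> \<le> max_edge_utility G"
    unfolding max_edge_utility_def using P by (intro Max_ge[OF fin]) auto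
  finally show ?thesis .
qed

text \<open>Each ordered pair is joined by a path of length at most the diameter, and each arc lies on
  at most \<open>max_edge_utility G\<close> of these paths.\<close>

lemma (in fin_digraph) sum_pairs_le_sum_arcs:
  fixes x :: "'a \<Rightarrow> 'c::real_normed_vector"
  assumes sc: "strongly_connected G"
  shows "(\<Sum>u\<in>verts G. \<Sum>v\<in>verts G. (norm (x u - x v))\<^sup>2) \<le>
    real (diam G) * real (max_edge_utility G) *
      (\<Sum>e\<in>arcs G. (norm (x (tail G e) - x (head G e)))\<^sup>2)"
proof -
  obtain P where P: "shortest_path_collection G P"
    using exists_shortest_path_collection[OF sc] .
  define h where "h e = (norm (x (tail G e) - x (head G e)))\<^sup>2" for e
  define N where "N = {(u, v). u \<in> verts G \<and> v \<in> verts G \<and> u \<noteq> v}"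
  have finN: "finite N"
    by (rule finite_subset[of _ "verts G \<times> verts G"]) (auto simp: N_def)
  \<comment> \<open>The path sum is written as a sum over all arcs with an indicator, so that the
    sums over pairs and arcs can be exchanged; each arc is then counted once per path through
    it.\<close>
  have pair: "(norm (x u - x v))\<^sup>2 \<le> real (diam G) * (\<Sum>e\<in>arcs G. if e \<in> set (P u v) then h e else 0)"
    if "(u, v) \<in> N" for u v
  proof -
    have uv: "u \<in> verts G" "v \<in> verts G" "u \<noteq> v" using that by (auto simp: N_def)
    then have sp: "shortest_path G u (P u v) v"
      using P by (auto simp: shortest_path_collection_def)
    then have aw: "awalk u (P u v) v" and d: "distinct (P u v)"
      using distinct_verts_imp_distinct by (auto simp: shortest_path_def apath_def)
    have sub: "set (P u v) \<subseteq> arcs G" using aw by (auto simp: awalk_def)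
    have "(norm (x u - x v))\<^sup>2 \<le> real (length (P u v)) * (\<Sum>e\<in>set (P u v). h e)"
      unfolding h_def by (rule norm_diff_sq_le_sum_path[OF aw d])
    also have "\<dots> \<le> real (diam G) * (\<Sum>e\<in>set (P u v). h e)"
      using length_shortest_path_le_diam[OF uv sp]
      by (intro mult_right_mono) (auto intro!: sum_nonneg simp: h_def)
    also have "(\<Sum>e\<in>set (P u v). h e) = (\<Sum>e\<in>arcs G. if e \<in> set (P u v) then h e else 0)"
      using sub by (simp add: sum.If_cases Int_absorb1)
    finally show ?thesis .
  qed
  have "(\<Sum>u\<in>verts G. \<Sum>v\<in>verts G. (norm (x u - x v))\<^sup>2) = (\<Sum>(u, v)\<in>verts G \<times> verts G. (norm (x u - x v))\<^sup>2)"
    by (simp add: sum.cartesian_product)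
  also have "\<dots> = (\<Sum>(u, v)\<in>N. (norm (x u - x v))\<^sup>2)"
    by (rule sum.mono_neutral_right) (auto simp: N_def)
  also have "\<dots> \<le> (\<Sum>(u, v)\<in>N. real (diam G) * (\<Sum>e\<in>arcs G. if e \<in> set (P u v) then h e else 0))"
    using pair by (intro sum_mono) auto
  also have "\<dots> = real (diam G) * (\<Sum>e\<in>arcs G. \<Sum>(u, v)\<in>N. if e \<in> set (P u v) then h e else 0)"
    unfolding case_prod_beta by (simp add: sum_distrib_left[symmetric] sum.swap[of _ N])
  also have "\<dots> = real (diam G) * (\<Sum>e\<in>arcs G. real (card {(u, v). u \<in> verts G \<and> v \<in> verts G \<and> u \<noteq> v \<and> e \<in> set (P u v)}) * h e)"
  proof -
    have "(\<Sum>(u, v)\<in>N. if e \<in> set (P u v) then h e else 0) =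
      real (card {(u, v). u \<in> verts G \<and> v \<in> verts G \<and> u \<noteq> v \<and> e \<in> set (P u v)}) * h e" for e
    proof -
      have "N \<inter> {z. e \<in> set (P (fst z) (snd z))} =
        {(u, v). u \<in> verts G \<and> v \<in> verts G \<and> u \<noteq> v \<and> e \<in> set (P u v)}"
        by (auto simp: N_def)
      then show ?thesis
        unfolding case_prod_beta using finN by (simp add: sum.If_cases)
    qed
    then show ?thesis by simp
  qed
  also have "\<dots> \<le> real (diam G) * (\<Sum>e\<in>arcs G. real (max_edge_utility G) * h e)"
    using card_pairs_le_max_edge_utility[OF P]
    by (intro mult_left_mono sum_mono mult_right_mono) (auto simp: h_def)
  finally show ?thesis
    by (simp add: h_def sum_distrib_left[symmetric] mult.assoc)
qed

section \<open>Network graphs, weighted variance, and averaging by stochastic weights\<close>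

lemma net_simps [simp]:
  "verts (net E) = UNIV" "arcs (net E) = E" "tail (net E) = fst" "head (net E) = snd"
  by (simp_all add: net_def)

lemma fin_digraph_net: "fin_digraph (net (E :: ('n::finite \<times> 'n) set))"
  by unfold_locales simp_all

text \<open>Serves to exclude a single agent: without pairs of distinct nodes every count is 0. The
  presence of an arc keeps the inner \<open>Max\<close> from ranging over the empty set.\<close>

lemma max_edge_utility_net_singleton:
  assumes "strongly_connected (net (E :: ('n::finite \<times> 'n) set))" "E \<noteq> {}" "CARD('n) = 1"
  shows "max_edge_utility (net E) = 0"
proof -
  interpret fin_digraph "net E" by (rule fin_digraph_net)
  have "u = v" for u v :: 'n
    using assms(3) by (metis UNIV_I card_1_singletonE singletonD)
  then have "collection_utility (net E) P = 0" for P
    using assms(2) by (simp add: collection_utility_def)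
  moreover obtain P where "shortest_path_collection (net E) P"
    using exists_shortest_path_collection[OF assms(1)] .
  ultimately have "{collection_utility (net E) P | P. shortest_path_collection (net E) P} = {0}"
    by auto
  then show ?thesis by (simp add: max_edge_utility_def)
qed

text \<open>The parallel axis identity. The cross term vanishes because weighted deviations from the
  weighted mean add up to 0.\<close>

lemma sum_weighted_norm_diff_sq:
  fixes x :: "'n::finite \<Rightarrow> 'a::real_inner"
  assumes w: "(\<Sum>i\<in>UNIV. w i) = 1"
  shows "(\<Sum>i\<in>UNIV. w i * (norm (x i - z))\<^sup>2) =
    (\<Sum>i\<in>UNIV. w i * (norm (x i - (\<Sum>i\<in>UNIV. w i *\<^sub>R x i)))\<^sup>2) + (norm ((\<Sum>i\<in>UNIV. w i *\<^sub>R x i) - z))\<^sup>2"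
proof -
  define m where "m = (\<Sum>i\<in>UNIV. w i *\<^sub>R x i)"
  have "(norm (x i - z))\<^sup>2 = (norm (x i - m))\<^sup>2 + 2 * inner (x i - m) (m - z) + (norm (m - z))\<^sup>2" for i
    by (simp add: power2_norm_eq_inner inner_diff_left inner_diff_right inner_commute)
  then have "w i * (norm (x i - z))\<^sup>2 = w i * (norm (x i - m))\<^sup>2 + 2 * (w i * inner (x i - m) (m - z))
      + w i * (norm (m - z))\<^sup>2" for i
    by (simp only: distrib_left mult.left_commute[of 2])
  then have "(\<Sum>i\<in>UNIV. w i * (norm (x i - z))\<^sup>2) = (\<Sum>i\<in>UNIV. w i * (norm (x i - m))\<^sup>2)
      + 2 * (\<Sum>i\<in>UNIV. w i * inner (x i - m) (m - z)) + (\<Sum>i\<in>UNIV. w i) * (norm (m - z))\<^sup>2"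
    by (simp add: sum.distrib sum_distrib_left sum_distrib_right)
  also have "(\<Sum>i\<in>UNIV. w i * inner (x i - m) (m - z)) = inner (\<Sum>i\<in>UNIV. w i *\<^sub>R (x i - m)) (m - z)"
    by (simp add: inner_sum_left)
  also have "(\<Sum>i\<in>UNIV. w i *\<^sub>R (x i - m)) = 0"
    using w by (simp add: scaleR_diff_right sum_subtractf m_def scaleR_left.sum[symmetric])
  finally show ?thesis using w by (simp add: m_def)
qed

text \<open>The parallel axis identity with reference point \<open>x j\<close>, averaged over
  \<open>j\<close>: this writes the variance through pairwise differences, the form that arcs and
  paths can see.\<close>

lemma sum_sum_weighted_norm_diff_sq:
  fixes x :: "'n::finite \<Rightarrow> 'a::real_inner"
  assumes w: "(\<Sum>i\<in>UNIV. w i) = 1"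
  shows "(\<Sum>j\<in>UNIV. \<Sum>l\<in>UNIV. w j * w l * (norm (x j - x l))\<^sup>2) =
    2 * (\<Sum>i\<in>UNIV. w i * (norm (x i - (\<Sum>i\<in>UNIV. w i *\<^sub>R x i)))\<^sup>2)"
proof -
  define m where "m = (\<Sum>i\<in>UNIV. w i *\<^sub>R x i)"
  define Q where "Q = (\<Sum>i\<in>UNIV. w i * (norm (x i - m))\<^sup>2)"
  have "(\<Sum>l\<in>UNIV. w j * w l * (norm (x j - x l))\<^sup>2) = w j * Q + w j * (norm (x j - m))\<^sup>2" for j
  proof -
    have "(\<Sum>l\<in>UNIV. w j * w l * (norm (x j - x l))\<^sup>2) = w j * (\<Sum>l\<in>UNIV. w l * (norm (x l - x j))\<^sup>2)"
      unfolding sum_distrib_left by (intro sum.cong) (simp_all add: norm_minus_commute)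
    also have "(\<Sum>l\<in>UNIV. w l * (norm (x l - x j))\<^sup>2) = Q + (norm (x j - m))\<^sup>2"
      by (simp only: sum_weighted_norm_diff_sq[OF w, of x "x j"] m_def Q_def norm_minus_commute)
    finally show ?thesis by (simp add: distrib_left)
  qed
  then show ?thesis
    using w by (simp add: sum.distrib sum_distrib_right[symmetric] Q_def m_def)
qed

text \<open>Averaging by \<open>W\<close> removes from the weighted variance exactly the
  \<open>w'\<close>-average of the variances inside the rows of \<open>W\<close>. A row variance
  controls the differences along the arcs into its node, and by the path inequality the arcs control
  all pairs, hence the variance itself. The lower bound \<beta> on the arc weights is left open
  because the two kinds of mixing supply different ones.\<close>

lemma weighted_consensus_contraction:
  fixes x :: "'n::finite \<Rightarrow> 'a::real_inner" and E :: "('n \<times> 'n) set"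
  assumes sc: "strongly_connected (net E)"
    and W_nonneg: "\<And>i j. 0 \<le> W i j" and W_row: "\<And>i. (\<Sum>j\<in>UNIV. W i j) = 1"
    and w'_nonneg: "\<And>i. 0 \<le> w' i" and w'_w: "\<And>j. (\<Sum>i\<in>UNIV. w' i * W i j) = w j"
    and w_pos: "\<And>j. 0 < w j" and w_le: "\<And>j. w j \<le> mx" and w_sum: "(\<Sum>j\<in>UNIV. w j) = 1"
    and \<beta>: "0 \<le> \<beta>" "\<And>i j. (j, i) \<in> E \<Longrightarrow> \<beta> \<le> w' i * W i i * W i j"
  defines "m \<equiv> (\<Sum>j\<in>UNIV. w j *\<^sub>R x j)"
  shows "(\<Sum>i\<in>UNIV. w' i * (norm ((\<Sum>j\<in>UNIV. W i j *\<^sub>R x j) - m))\<^sup>2) \<le>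
    (1 - \<beta> / (mx\<^sup>2 * real (diam (net E)) * real (max_edge_utility (net E)))) *
      (\<Sum>j\<in>UNIV. w j * (norm (x j - m))\<^sup>2)"
proof -
  interpret fin_digraph "net E" by (rule fin_digraph_net)
  define Q where "Q = (\<Sum>j\<in>UNIV. w j * (norm (x j - m))\<^sup>2)"
  define H where "H = (\<Sum>(j, i)\<in>E. (norm (x j - x i))\<^sup>2)"
  define DK where "DK = real (diam (net E)) * real (max_edge_utility (net E))"
  define V where "V i = (\<Sum>j\<in>UNIV. W i j * (norm (x j - (\<Sum>j\<in>UNIV. W i j *\<^sub>R x j)))\<^sup>2)" for i
  have mx: "0 < mx" using w_pos w_le less_le_trans by blast
  \<comment> \<open>Of the double sum that equals twice the row variance, only the terms with first
    index \<open>i\<close> are kept.\<close>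
  have V: "(\<Sum>j\<in>UNIV. W i i * W i j * (norm (x j - x i))\<^sup>2) \<le> 2 * V i" for i
  proof -
    have "(\<Sum>j\<in>UNIV. W i i * W i j * (norm (x j - x i))\<^sup>2) \<le>
        (\<Sum>l\<in>UNIV. \<Sum>j\<in>UNIV. W i l * W i j * (norm (x l - x j))\<^sup>2)"
      by (rule order_trans[OF _ member_le_sum[of i]])
         (auto intro!: sum_nonneg mult_nonneg_nonneg W_nonneg simp: norm_minus_commute)
    then show ?thesis by (simp add: sum_sum_weighted_norm_diff_sq[OF W_row] V_def)
  qed
  have "\<beta> * H \<le> (\<Sum>(j, i)\<in>E. w' i * W i i * W i j * (norm (x j - x i))\<^sup>2)"
    unfolding H_def sum_distrib_left by (intro sum_mono) (auto intro!: mult_right_mono \<beta>)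
  also have "\<dots> \<le> (\<Sum>(j, i)\<in>UNIV. w' i * W i i * W i j * (norm (x j - x i))\<^sup>2)"
    by (rule sum_mono2) (auto intro!: mult_nonneg_nonneg W_nonneg w'_nonneg)
  also have "\<dots> = (\<Sum>i\<in>UNIV. \<Sum>j\<in>UNIV. w' i * W i i * W i j * (norm (x j - x i))\<^sup>2)"
    unfolding UNIV_Times_UNIV[symmetric] by (subst sum.cartesian_product[symmetric]) (rule sum.swap)
  also have "\<dots> = (\<Sum>i\<in>UNIV. w' i * (\<Sum>j\<in>UNIV. W i i * W i j * (norm (x j - x i))\<^sup>2))"
    by (simp add: sum_distrib_left mult.assoc)
  also have "\<dots> \<le> (\<Sum>i\<in>UNIV. w' i * (2 * V i))"
    by (intro sum_mono mult_left_mono V w'_nonneg)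
  finally have H: "\<beta> * H \<le> 2 * (\<Sum>i\<in>UNIV. w' i * V i)"
    by (simp add: sum_distrib_left mult.left_commute)
  \<comment> \<open>The parallel axis identity in each row, averaged with \<open>w'\<close>. Since
    \<open>w'\<close> is carried to \<open>w\<close> by \<open>W\<close>, the right-hand side is the
    variance before mixing.\<close>
  have "(\<Sum>i\<in>UNIV. w' i * (norm ((\<Sum>j\<in>UNIV. W i j *\<^sub>R x j) - m))\<^sup>2) + (\<Sum>i\<in>UNIV. w' i * V i) =
      (\<Sum>i\<in>UNIV. w' i * (\<Sum>j\<in>UNIV. W i j * (norm (x j - m))\<^sup>2))"
    unfolding sum.distrib[symmetric] distrib_left[symmetric]
    using sum_weighted_norm_diff_sq[OF W_row, of _ x m] by (simp add: V_def add.commute)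
  also have "\<dots> = (\<Sum>j\<in>UNIV. \<Sum>i\<in>UNIV. w' i * W i j * (norm (x j - m))\<^sup>2)"
    unfolding sum_distrib_left mult.assoc by (rule sum.swap)
  also have "\<dots> = Q"
    by (simp add: w'_w sum_distrib_right[symmetric] Q_def)
  finally have id: "(\<Sum>i\<in>UNIV. w' i * (norm ((\<Sum>j\<in>UNIV. W i j *\<^sub>R x j) - m))\<^sup>2) =
      Q - (\<Sum>i\<in>UNIV. w' i * V i)" by simp
  have "2 * Q = (\<Sum>j\<in>UNIV. \<Sum>l\<in>UNIV. w j * w l * (norm (x j - x l))\<^sup>2)"
    by (simp add: sum_sum_weighted_norm_diff_sq[OF w_sum] Q_def m_def)
  also have "\<dots> \<le> (\<Sum>j\<in>UNIV. \<Sum>l\<in>UNIV. mx\<^sup>2 * (norm (x j - x l))\<^sup>2)"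
    using w_pos w_le mx unfolding power2_eq_square[of mx]
    by (intro sum_mono mult_right_mono mult_mono) (auto intro: less_imp_le)
  also have "\<dots> = mx\<^sup>2 * (\<Sum>j\<in>UNIV. \<Sum>l\<in>UNIV. (norm (x j - x l))\<^sup>2)"
    by (simp add: sum_distrib_left)
  also have "\<dots> \<le> mx\<^sup>2 * (DK * H)"
    using sum_pairs_le_sum_arcs[OF sc, of x]
    by (intro mult_left_mono) (simp_all add: DK_def H_def case_prod_beta)
  finally have Q: "2 * Q \<le> mx\<^sup>2 * DK * H" by simp
  have H0: "0 \<le> H" by (auto simp: H_def intro!: sum_nonneg)
  have "\<beta> / (mx\<^sup>2 * DK) * Q \<le> (\<Sum>i\<in>UNIV. w' i * V i)"
  proof (cases "DK = 0")
    \<comment> \<open>With denominator 0 the quotient is 0, and only nonnegativity of the removed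
      variance remains to be shown.\<close>
    case True
    have "0 \<le> \<beta> * H" using H0 \<beta> by simp
    with H True show ?thesis by simp
  next
    case False
    then have DK: "0 < mx\<^sup>2 * DK" using mx by (simp add: DK_def)
    have "\<beta> * (2 * Q) \<le> \<beta> * (mx\<^sup>2 * DK * H)" using Q \<beta>(1) by (rule mult_left_mono)
    also have "\<dots> \<le> mx\<^sup>2 * DK * (2 * (\<Sum>i\<in>UNIV. w' i * V i))"
      using mult_left_mono[OF H, of "mx\<^sup>2 * DK"] DK by (simp add: mult_ac)
    finally show ?thesis using DK by (simp add: field_simps)
  qed
  then show ?thesis
    unfolding id Q_def[symmetric] by (simp add: DK_def algebra_simps)
qed

section \<open>Positive matrices\<close>

notation Matrix.vec_index (infixl "$v" 100)

text \<open>Brouwer's theorem for the map that sends v to A v divided by the sum of its entries, on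
  the probability simplex. Positive entries keep the divisor away from 0 and make every coordinate
  of the fixed point positive.\<close>

lemma perron_vector_exists:
  fixes A :: "real^'n^'n"
  assumes pos: "\<And>i j. 0 < A $ i $ j"
  obtains r v where "0 < r" "\<And>i. 0 < v $ i" "A *v v = r *\<^sub>R v"
proof -
  define S :: "(real^'n) set" where "S = {v. (\<forall>i. 0 \<le> v $ i) \<and> (\<Sum>i\<in>UNIV. v $ i) = 1}"
  define s where "s v = (\<Sum>i\<in>UNIV. (A *v v) $ i)" for v
  define f where "f v = (1 / s v) *\<^sub>R (A *v v)" for v
  have Av_pos: "0 < (A *v v) $ i" if "v \<in> S" for v i
  proof -
    obtain j where "0 < v $ j"
    proof (rule ccontr)
      assume "\<not> thesis"
      with that have "v $ j \<le> 0" for j using not_less by blast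
      then have "(\<Sum>i\<in>UNIV. v $ i) \<le> 0" by (rule sum_nonpos)
      with \<open>v \<in> S\<close> show False by (simp add: S_def)
    qed
    then show ?thesis
      using \<open>v \<in> S\<close> pos unfolding matrix_vector_mult_def S_def
      by (auto intro!: sum_pos2[of _ j] mult_pos_pos mult_nonneg_nonneg less_imp_le[OF pos])
  qed
  then have s_pos: "0 < s v" if "v \<in> S" for v
    using that unfolding s_def by (intro sum_pos) auto
  have "closed S"
    unfolding S_def
    by (intro closed_Collect_conj closed_Collect_all closed_Collect_le closed_Collect_eq continuous_intros)
  moreover have "norm v \<le> 1" if "v \<in> S" for v
    using norm_le_l1_cart[of v] that by (simp add: S_def)
  then have "bounded S" unfolding bounded_iff by blast
  ultimately have "compact S" by (simp add: compact_eq_bounded_closed)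
  moreover have "convex S"
    by (rule convexI) (auto simp: S_def sum.distrib sum_distrib_left[symmetric])
  moreover have "S \<noteq> {}"
  proof -
    have "axis i 1 \<in> S" for i :: 'n
      by (auto simp: S_def axis_def)
    then show ?thesis by blast
  qed
  moreover have "continuous_on S f"
    unfolding f_def s_def
    by (intro continuous_intros matrix_vector_mult_linear_continuous_on)
       (metis s_def s_pos less_irrefl)
  moreover have "f \<in> S \<rightarrow> S"
  proof
    fix v assume v: "v \<in> S"
    have "(\<Sum>i\<in>UNIV. f v $ i) = (1 / s v) * s v"
      by (simp add: f_def s_def sum_divide_distrib[symmetric])
    then show "f v \<in> S"
      using s_pos[OF v] Av_pos[OF v] by (auto simp: S_def f_def intro!: less_imp_le)
  qed
  ultimately obtain v where v: "v \<in> S" "f v = v" by (rule brouwer)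
  have "s v *\<^sub>R f v = A *v v" using s_pos[OF v(1)] by (simp add: f_def)
  then have Av: "A *v v = s v *\<^sub>R v" by (simp add: v(2))
  have "0 < v $ i" for i
    using Av_pos[OF v(1), of i] s_pos[OF v(1)] unfolding Av by (simp add: zero_less_mult_iff)
  then show thesis using that s_pos[OF v(1)] Av by blast
qed

text \<open>The Brouwer argument lives in a type of fixed dimension, so it is transported for one
  dimension at a time.\<close>

lemma perron_vector_exists_mat3:
  fixes M :: "real mat"
  assumes pos: "\<And>i j. i < 3 \<Longrightarrow> j < 3 \<Longrightarrow> 0 < M $$ (i, j)"
  obtains r v where "0 < r" "\<And>i. i < 3 \<Longrightarrow> 0 < v i"
    "\<And>i. i < 3 \<Longrightarrow> (\<Sum>j<3. M $$ (i, j) * v j) = r * v i"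
proof -
  have "finite (UNIV :: 3 set)" by simp
  from ex_bij_betw_finite_nat[OF this] obtain h where h: "bij_betw h (UNIV :: 3 set) {..<3::nat}"
    by (auto simp: lessThan_atLeast0)
  define k where "k = inv_into UNIV h"
  have hk: "h (k i) = i" if "i < 3" for i
    using that h unfolding k_def by (intro bij_betw_inv_into_right[OF h]) auto
  have kh: "k (h i) = i" for i
    using h unfolding k_def by (simp add: bij_betw_def)
  have h3: "h i < 3" for i using h by (auto simp: bij_betw_def)
  obtain r and v :: "real^3" where rv: "0 < r" "\<And>i. 0 < v $ i"
      "(\<chi> i j. M $$ (h i, h j)) *v v = r *\<^sub>R v"
    using perron_vector_exists[of "\<chi> i j. M $$ (h i, h j)"] pos h3 by auto
  have "(\<Sum>j<3. M $$ (i, j) * v $ k j) = r * v $ k i" if "i < 3" for i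
  proof -
    have "(\<Sum>j<3. M $$ (i, j) * v $ k j) = (\<Sum>j\<in>UNIV. M $$ (h (k i), h j) * v $ k (h j))"
      using sum.reindex_bij_betw[OF h, of "\<lambda>j. M $$ (i, j) * v $ k j"] hk[OF that] by simp
    also have "\<dots> = ((\<chi> i j. M $$ (h i, h j)) *v v) $ k i"
      by (simp add: matrix_vector_mult_def kh)
    finally show ?thesis by (simp add: rv)
  qed
  then show thesis using that[of r "\<lambda>i. v $ k i"] rv by blast
qed

text \<open>The least multiple of \<open>z\<close> that dominates \<open>f\<close> touches it at
  some index \<open>i\<close>. Evaluating row \<open>i\<close> of a matrix there is the device of
  all comparison arguments below.\<close>

lemma exists_max_ratio:
  fixes f z :: "nat \<Rightarrow> real"
  assumes "0 < m" "\<And>i. i < m \<Longrightarrow> 0 < z i"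
  shows "\<exists>i<m. \<forall>j<m. f j \<le> f i / z i * z j"
proof -
  have "Max ((\<lambda>i. f i / z i) ` {..<m}) \<in> (\<lambda>i. f i / z i) ` {..<m}"
    using assms(1) by (intro Max_in) auto
  then obtain i where i: "i < m" "f i / z i = Max ((\<lambda>i. f i / z i) ` {..<m})" by auto
  have "f j \<le> f i / z i * z j" if "j < m" for j
  proof -
    have "f j / z j \<le> f i / z i" unfolding i(2) using that by (intro Max_ge) auto
    then show ?thesis using assms(2)[OF that] by (simp add: pos_divide_le_eq)
  qed
  with i(1) show ?thesis by blast
qed

text \<open>The positive vector makes \<open>r\<close> an eigenvalue. For any other eigenvector, its
  moduli are dominated by a multiple of \<open>v\<close> that touches at \<open>i\<close>, and the
  triangle inequality in row \<open>i\<close> bounds the modulus of the eigenvalue by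
  \<open>r\<close>.\<close>

lemma spectral_radius_eq_perron:
  fixes M :: "real mat"
  assumes M: "M \<in> carrier_mat m m" and m: "0 < m"
    and nonneg: "\<And>i j. i < m \<Longrightarrow> j < m \<Longrightarrow> 0 \<le> M $$ (i, j)"
    and r: "0 < r" and v: "\<And>i. i < m \<Longrightarrow> 0 < v i"
    and Mv: "\<And>i. i < m \<Longrightarrow> (\<Sum>j<m. M $$ (i, j) * v j) = r * v i"
  shows "spectral_radius (map_mat complex_of_real M) = r"
proof -
  define A where "A = map_mat complex_of_real M"
  have A: "A \<in> carrier_mat m m" using M by (simp add: A_def)
  have Au: "(A *\<^sub>v u) $v i = (\<Sum>j<m. complex_of_real (M $$ (i, j)) * u $v j)"
    if "u \<in> carrier_vec m" "i < m" for u i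
    using that M by (simp add: A_def scalar_prod_def lessThan_atLeast0)
  have "A *\<^sub>v Matrix.vec m (\<lambda>i. complex_of_real (v i)) = complex_of_real r \<cdot>\<^sub>v Matrix.vec m (\<lambda>i. complex_of_real (v i))"
  proof (rule eq_vecI)
    fix i assume "i < dim_vec (complex_of_real r \<cdot>\<^sub>v Matrix.vec m (\<lambda>i. complex_of_real (v i)))"
    then have i: "i < m" by simp
    have "(\<Sum>j<m. complex_of_real (M $$ (i, j)) * complex_of_real (v j)) = complex_of_real (\<Sum>j<m. M $$ (i, j) * v j)"
      by simp
    then show "(A *\<^sub>v Matrix.vec m (\<lambda>i. complex_of_real (v i))) $v i = (complex_of_real r \<cdot>\<^sub>v Matrix.vec m (\<lambda>i. complex_of_real (v i))) $v i"
      using i by (simp add: Au Mv)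
  qed (use A in simp)
  moreover have "Matrix.vec m (\<lambda>i. complex_of_real (v i)) \<noteq> 0\<^sub>v m"
    using v[OF m] m by (metis index_vec index_zero_vec(1) of_real_eq_0_iff less_irrefl)
  ultimately have "eigenvalue A (complex_of_real r)"
    unfolding eigenvalue_def eigenvector_def using A by (auto intro!: exI[of _ "Matrix.vec m (\<lambda>i. complex_of_real (v i))"])
  then have "r \<in> norm ` spectrum A"
    using r by (force simp: spectrum_def)
  then have "r \<le> spectral_radius A" by (rule spectral_radius_mem_max(2)[OF A m])
  moreover have "norm ev \<le> r" if ev: "eigenvalue A ev" for ev
  proof -
    obtain u where u: "u \<in> carrier_vec m" "u \<noteq> 0\<^sub>v m" "A *\<^sub>v u = ev \<cdot>\<^sub>v u"
      using ev A by (auto simp: eigenvalue_def eigenvector_def)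
    obtain i where i: "i < m" "\<forall>j<m. norm (u $v j) \<le> norm (u $v i) / v i * v j"
      using exists_max_ratio[of m v "\<lambda>i. norm (u $v i)", OF m v] by blast
    have "norm (u $v i) \<noteq> 0"
    proof
      assume "norm (u $v i) = 0"
      with i(2) have "u $v j = 0" if "j < m" for j using that by fastforce
      with u show False by (metis eq_vecI carrier_vecD index_zero_vec)
    qed
    have "norm ev * norm (u $v i) = norm ((A *\<^sub>v u) $v i)"
      using u i(1) by (simp add: norm_mult)
    also have "\<dots> \<le> (\<Sum>j<m. norm (complex_of_real (M $$ (i, j)) * u $v j))"
      unfolding Au[OF u(1) i(1)] by (rule norm_sum)
    also have "\<dots> \<le> (\<Sum>j<m. M $$ (i, j) * (norm (u $v i) / v i * v j))"
    proof (rule sum_mono)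
      fix j assume "j \<in> {..<m}"
      then show "norm (complex_of_real (M $$ (i, j)) * u $v j) \<le> M $$ (i, j) * (norm (u $v i) / v i * v j)"
        using i nonneg[of i j] mult_left_mono[of "norm (u $v j)" "norm (u $v i) / v i * v j" "M $$ (i, j)"]
        by (simp add: norm_mult)
    qed
    also have "\<dots> = norm (u $v i) / v i * (\<Sum>j<m. M $$ (i, j) * v j)"
      by (simp add: sum_distrib_left mult_ac)
    also have "\<dots> = r * norm (u $v i)"
      using v[OF i(1)] by (simp add: Mv[OF i(1)])
    finally show ?thesis using \<open>norm (u $v i) \<noteq> 0\<close> by simp
  qed
  then have "spectral_radius A \<le> r"
    using spectral_radius_mem_max(1)[OF A m] by (auto simp: spectrum_def)
  ultimately show ?thesis by (simp add: A_def)
qed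

section \<open>Nonnegative matrices that strictly decrease a positive vector\<close>

context
  fixes M :: "real mat" and m :: nat and z :: "nat \<Rightarrow> real"
  assumes M: "M \<in> carrier_mat m m" and m: "0 < m"
    and nonneg: "\<And>i j. i < m \<Longrightarrow> j < m \<Longrightarrow> 0 \<le> M $$ (i, j)"
    and z: "\<And>i. i < m \<Longrightarrow> 0 < z i"
    and Mz: "\<And>i. i < m \<Longrightarrow> (\<Sum>j<m. M $$ (i, j) * z j) < z i"
begin

text \<open>At the index where a multiple of \<open>z\<close> touches \<open>v\<close>, the strict
  inequality for \<open>z\<close> becomes one for \<open>v\<close>.\<close>

lemma perron_value_less_1:
  assumes v: "\<And>i. i < m \<Longrightarrow> 0 < v i"
    and Mv: "\<And>i. i < m \<Longrightarrow> (\<Sum>j<m. M $$ (i, j) * v j) = r * v i"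
  shows "r < 1"
proof -
  obtain i where i: "i < m" "\<forall>j<m. v j \<le> v i / z i * z j"
    using exists_max_ratio[of m z v, OF m z] by blast
  have "r * v i = (\<Sum>j<m. M $$ (i, j) * v j)" by (simp add: Mv[OF i(1)])
  also have "\<dots> \<le> (\<Sum>j<m. M $$ (i, j) * (v i / z i * z j))"
    using i by (intro sum_mono mult_left_mono nonneg) simp_all
  also have "\<dots> = v i / z i * (\<Sum>j<m. M $$ (i, j) * z j)"
    by (simp add: sum_distrib_left mult_ac)
  also have "\<dots> < v i / z i * z i"
    by (rule mult_strict_left_mono[OF Mz[OF i(1)] divide_pos_pos[OF v[OF i(1)] z[OF i(1)]]])
  also have "\<dots> = v i" using z[OF i(1)] by simp
  finally show ?thesis using v[OF i(1)] by simp
qed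

text \<open>A maximum principle: a positive touching value would be strictly smaller than itself. It
  yields both the invertibility of \<open>1 - M\<close> and the sign of the solution.\<close>

lemma sub_fixed_point_nonpos:
  assumes f: "\<And>i. i < m \<Longrightarrow> f i \<le> (\<Sum>j<m. M $$ (i, j) * f j)" and k: "k < m"
  shows "f k \<le> 0"
proof -
  obtain i where i: "i < m" "\<forall>j<m. f j \<le> f i / z i * z j"
    using exists_max_ratio[of m z f, OF m z] by blast
  have "\<not> 0 < f i"
  proof
    assume "0 < f i"
    have "f i \<le> (\<Sum>j<m. M $$ (i, j) * f j)" by (rule f[OF i(1)])
    also have "\<dots> \<le> (\<Sum>j<m. M $$ (i, j) * (f i / z i * z j))"
      using i by (intro sum_mono mult_left_mono nonneg) simp_all
    also have "\<dots> = f i / z i * (\<Sum>j<m. M $$ (i, j) * z j)"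
      by (simp add: sum_distrib_left mult_ac)
    also have "\<dots> < f i / z i * z i"
      by (rule mult_strict_left_mono[OF Mz[OF i(1)] divide_pos_pos[OF \<open>0 < f i\<close> z[OF i(1)]]])
    also have "\<dots> = f i" using z[OF i(1)] by simp
    finally show False by simp
  qed
  then have "f i / z i \<le> 0"
    using z[OF i(1)] by (simp add: divide_nonpos_pos)
  then have "f i / z i * z k \<le> 0"
    by (rule mult_nonpos_nonneg) (rule less_imp_le[OF z[OF k]])
  moreover have "f k \<le> f i / z i * z k" using i(2) k by blast
  ultimately show ?thesis by linarith
qed

text \<open>\<open>mat_inverse\<close> is partial, so \<open>the\<close> has a meaning only once
  \<open>1 - M\<close> is known to be invertible. A kernel vector is a fixed point of
  \<open>M\<close>; the maximum principle for it and for its negative makes it 0.\<close>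

lemma mat_inverse_solves:
  assumes b: "b \<in> carrier_vec m"
  defines "w \<equiv> the (mat_inverse (1\<^sub>m m - M)) *\<^sub>v b"
  shows "w \<in> carrier_vec m"
    and "\<And>i. i < m \<Longrightarrow> w $v i = (\<Sum>j<m. M $$ (i, j) * w $v j) + b $v i"
proof -
  define N where "N = 1\<^sub>m m - M"
  have N: "N \<in> carrier_mat m m" unfolding N_def using M by (rule minus_carrier_mat)
  have Nu: "(N *\<^sub>v u) $v i = u $v i - (\<Sum>j<m. M $$ (i, j) * u $v j)"
    if "u \<in> carrier_vec m" "i < m" for u i
  proof -
    have "N *\<^sub>v u = 1\<^sub>m m *\<^sub>v u - M *\<^sub>v u"
      unfolding N_def using M that by (intro minus_mult_distrib_mat_vec) auto
    moreover have "(M *\<^sub>v u) $v i = (\<Sum>j<m. M $$ (i, j) * u $v j)"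
      using that M by (simp add: scalar_prod_def lessThan_atLeast0)
    ultimately show ?thesis using that M by simp
  qed
  have "det N \<noteq> 0"
  proof
    assume "det N = 0"
    then obtain u where u: "u \<in> carrier_vec m" "u \<noteq> 0\<^sub>v m" "N *\<^sub>v u = 0\<^sub>v m"
      using det_0_iff_vec_prod_zero[OF N] by auto
    have fix_pt: "(\<Sum>j<m. M $$ (i, j) * u $v j) = u $v i" if "i < m" for i
      using Nu[OF u(1) that] u(3) that by simp
    have "u $v i \<le> 0" if "i < m" for i
      by (rule sub_fixed_point_nonpos[OF _ that]) (simp add: fix_pt)
    moreover have "- u $v i \<le> 0" if "i < m" for i
      by (rule sub_fixed_point_nonpos[OF _ that]) (simp add: fix_pt sum_negf)
    ultimately have "u $v i = 0" if "i < m" for i using that by (simp add: order_antisym)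
    then have "u = 0\<^sub>v m" using u(1) by (intro eq_vecI) simp_all
    with u(2) show False by contradiction
  qed
  then have "N \<in> Units (ring_mat TYPE(real) m ())" by (rule det_non_zero_imp_unit[OF N])
  then obtain N' where "mat_inverse N = Some N'"
    using mat_inverse(1)[OF N, where b="()"] by (cases "mat_inverse N") auto
  with mat_inverse(2)[OF N this] have N': "N * N' = 1\<^sub>m m" "N' \<in> carrier_mat m m" "w = N' *\<^sub>v b"
    by (auto simp: w_def N_def)
  show w: "w \<in> carrier_vec m" using N' b by simp
  have "N *\<^sub>v w = b"
    unfolding N'(3) using N N' b by (simp add: assoc_mult_mat_vec[symmetric])
  then show "w $v i = (\<Sum>j<m. M $$ (i, j) * w $v j) + b $v i" if "i < m" for i
    using Nu[OF w that] by simp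
qed

end

section \<open>The recursion matrix\<close>

text \<open>Clears the denominators of the second and third step-size bounds, whose common shape is
  \<open>p / (q * sqrt X)\<close>.\<close>

lemma sq_bound_of_le_divide_sqrt:
  fixes s :: real
  assumes "0 \<le> s" "s \<le> p / (q * sqrt X)" "0 < q" "0 < X"
  shows "s\<^sup>2 * (q\<^sup>2 * X) \<le> p\<^sup>2"
proof -
  have "s * (q * sqrt X) \<le> p"
    using assms by (simp add: pos_le_divide_eq)
  then have "(s * (q * sqrt X))\<^sup>2 \<le> p\<^sup>2"
    using assms by (intro power_mono) auto
  then show ?thesis using assms by (simp add: power_mult_distrib)
qed

lemma mat_of_rows_list_3_index:
  fixes x0 x1 x2 y0 y1 y2 z0 z1 z2 :: 'a
  defines "M \<equiv> mat_of_rows_list 3 [[x0, x1, x2], [y0, y1, y2], [z0, z1, z2]]"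
  shows "M $$ (0, 0) = x0" "M $$ (0, 1) = x1" "M $$ (0, 2) = x2"
    "M $$ (1, 0) = y0" "M $$ (1, 1) = y1" "M $$ (1, 2) = y2"
    "M $$ (2, 0) = z0" "M $$ (2, 1) = z1" "M $$ (2, 2) = z2"
  unfolding M_def by (simp_all add: mat_of_rows_list_def)

lemma mat_of_rows_list_3_carrier: "mat_of_rows_list 3 [xs, ys, zs] \<in> carrier_mat 3 3"
  by (rule carrier_matI) (simp_all add: mat_of_rows_list_def)

lemma vec_of_list_3_index:
  "vec_of_list [x, y, z] $v 0 = x" "vec_of_list [x, y, z] $v 1 = y" "vec_of_list [x, y, z] $v 2 = z"
  by (simp_all add: vec_of_list_index del: vec_of_list_Cons)

lemma M_mat_carrier: "M_mat n L \<mu> \<eta> \<kappa> vphi \<psi> c \<tau> \<alpha> \<in> carrier_mat 3 3"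
  unfolding M_mat_def Let_def by (rule mat_of_rows_list_3_carrier)

lemma M_mat_index:
  fixes n \<mu> \<eta> vphi \<psi> c \<tau> \<alpha> L \<kappa>
  defines "M \<equiv> M_mat n L \<mu> \<eta> \<kappa> vphi \<psi> c \<tau> \<alpha>" and "\<nu> \<equiv> nu_const L \<kappa> \<psi> \<tau>"
  shows "M $$ (0, 0) = 1 - real n * \<mu> * \<eta> / 2 * \<alpha>"
    "M $$ (0, 1) = 3 * L\<^sup>2 * vphi\<^sup>2 / \<mu> * \<alpha>"
    "M $$ (0, 2) = 3 / (real n * \<mu> * \<eta>) * \<alpha>"
    "M $$ (1, 0) = 2 * real n * L\<^sup>2 * vphi\<^sup>2 * (1 + c\<^sup>2) / (1 - c\<^sup>2) * \<alpha>\<^sup>2"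
    "M $$ (1, 1) = (1 + c\<^sup>2) / 2 + 2 * real n * L\<^sup>2 * vphi\<^sup>2 * (1 + c\<^sup>2) / (1 - c\<^sup>2) * \<alpha>\<^sup>2"
    "M $$ (1, 2) = (1 + c\<^sup>2) / (1 - c\<^sup>2) * \<alpha>\<^sup>2"
    "M $$ (2, 0) = 2 * real n * L\<^sup>2 * vphi\<^sup>2 * \<nu> * \<alpha>\<^sup>2"
    "M $$ (2, 1) = 4 * vphi\<^sup>2 * \<nu> + 2 * real n * L\<^sup>2 * vphi\<^sup>2 * \<nu> * \<alpha>\<^sup>2"
    "M $$ (2, 2) = (1 + \<tau>\<^sup>2) / 2 + \<nu> * \<alpha>\<^sup>2"
  unfolding M_def \<nu>_def M_mat_def Let_def by (rule mat_of_rows_list_3_index)+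

lemma b_vec_carrier: "b_vec n L \<kappa> \<psi> c \<tau> \<sigma> \<alpha> \<in> carrier_vec 3"
  unfolding b_vec_def Let_def by (rule carrier_vecI) simp

lemma b_vec_index:
  "b_vec n L \<kappa> \<psi> c \<tau> \<sigma> \<alpha> $v 0 = 3 * real n * \<sigma>\<^sup>2 / 2 * \<alpha>\<^sup>2"
  "b_vec n L \<kappa> \<psi> c \<tau> \<sigma> \<alpha> $v 1 = 2 * (1 + c\<^sup>2) * \<sigma>\<^sup>2 / (1 - c\<^sup>2) * \<alpha>\<^sup>2"
  "b_vec n L \<kappa> \<psi> c \<tau> \<sigma> \<alpha> $v 2 = 4 * real n * \<psi> * \<sigma>\<^sup>2 + 2 * L * real n * \<psi> * \<sigma>\<^sup>2 * \<alpha>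
     + 2 * nu_const L \<kappa> \<psi> \<tau> * \<sigma>\<^sup>2 * \<alpha>\<^sup>2"
  unfolding b_vec_def Let_def by (rule vec_of_list_3_index)+

lemma less_3_cases: "i < (3::nat) \<Longrightarrow> (i = 0 \<Longrightarrow> P) \<Longrightarrow> (i = 1 \<Longrightarrow> P) \<Longrightarrow> (i = 2 \<Longrightarrow> P) \<Longrightarrow> P"
  by linarith

lemma sum_lessThan_3: "(\<Sum>j<3. h j) = h 0 + h 1 + h (2::nat)"
  by (simp add: eval_nat_numeral)

text \<open>Only the numerical conditions, so that the matrix is studied without probability. The
  relations \<open>n_ge_2\<close>, \<open>mu_le_L\<close>, \<open>kappa_ge\<close> and
  \<open>vphi_ge\<close> are derived from the setting before this locale is instantiated.\<close>

locale step_size =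
  fixes n :: nat and L \<mu> \<eta> \<kappa> vphi \<psi> c \<tau> \<alpha> :: real
  assumes n_ge_2: "2 \<le> n" and L_pos: "0 < L" and mu_pos: "0 < \<mu>" and mu_le_L: "\<mu> \<le> L"
    and eta_range: "0 < \<eta>" "\<eta> < 1"
    and kappa_gt_1: "1 < \<kappa>" and vphi_gt_1: "1 < vphi"
    and kappa_ge: "real n \<le> \<kappa>\<^sup>2" and vphi_ge: "real n \<le> vphi\<^sup>2"
    and c_range: "0 < c" "c < 1" and tau_range: "0 < \<tau>" "\<tau> < 1"
    and psi_pos: "0 < \<psi>" and psi_le: "\<psi> \<le> real n * (\<kappa>\<^sup>2 - 1)"
    and alpha_pos: "0 < \<alpha>"
    and alpha_le_1: "\<alpha> \<le> 2 / (real n * \<eta> * (L + \<mu>))"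
    and alpha_le_2: "\<alpha> \<le> \<mu> * \<eta> * (1 - c\<^sup>2) * (1 - \<tau>\<^sup>2) /
       (4 * L * vphi * sqrt ((real n * \<mu>\<^sup>2 * \<eta>\<^sup>2 + 24 * L\<^sup>2 * vphi\<^sup>2) * (\<eta> + 16 * \<kappa>\<^sup>2)))"
    and alpha_le_3: "\<alpha> \<le> \<mu> * \<eta> * (1 - \<tau>\<^sup>2) /
       (\<kappa> * L * sqrt (2 * real n * \<mu>\<^sup>2 * \<eta>\<^sup>2 * (real n + 4)
          + 6 * L\<^sup>2 * vphi\<^sup>2 * (real n * \<eta> + 32)))"
begin

abbreviation M where "M \<equiv> M_mat n L \<mu> \<eta> \<kappa> vphi \<psi> c \<tau> \<alpha>"
abbreviation \<nu> where "\<nu> \<equiv> nu_const L \<kappa> \<psi> \<tau>"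

lemma c_sq: "0 < c\<^sup>2" "c\<^sup>2 < 1" and tau_sq: "0 < \<tau>\<^sup>2" "\<tau>\<^sup>2 < 1"
  using c_range tau_range by (simp_all add: power_less_one_iff)

lemma nu_pos: "0 < \<nu>"
proof -
  have "0 < 4 * L\<^sup>2 * \<kappa>\<^sup>2 * \<tau>\<^sup>2 / (1 - \<tau>\<^sup>2)" "0 < 2 * \<psi> * L\<^sup>2"
    using tau_sq L_pos kappa_gt_1 psi_pos by simp_all
  then show ?thesis by (simp add: nu_const_def)
qed

text \<open>From the third bound. Of its radicand only the part
  \<open>6 * 32 * L\<^sup>2 * vphi\<^sup>2\<close> is kept, and n is a lower bound for both
  \<open>vphi\<^sup>2\<close> and \<open>\<kappa>\<^sup>2\<close>. The constant 13 is the largest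
  integer whose square stays below 192.\<close>

lemma alpha_n_L_le: "13 * \<alpha> * real n * L\<^sup>2 \<le> \<mu> * \<eta>"
proof -
  define X where "X = 2 * real n * \<mu>\<^sup>2 * \<eta>\<^sup>2 * (real n + 4) + 6 * L\<^sup>2 * vphi\<^sup>2 * (real n * \<eta> + 32)"
  have "6 * L\<^sup>2 * real n * 32 \<le> 6 * L\<^sup>2 * vphi\<^sup>2 * (real n * \<eta> + 32)"
    using vphi_ge eta_range by (intro mult_mono) auto
  moreover have "0 \<le> 2 * real n * \<mu>\<^sup>2 * \<eta>\<^sup>2 * (real n + 4)" by simp
  ultimately have X: "192 * L\<^sup>2 * real n \<le> X" unfolding X_def by linarith
  have "0 < 192 * L\<^sup>2 * real n" using L_pos n_ge_2 by simp
  with X have X_pos: "0 < X" by linarith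
  have "(13 * \<alpha> * real n * L\<^sup>2)\<^sup>2 = 169 * (\<alpha>\<^sup>2 * (real n * L\<^sup>2 * (L\<^sup>2 * real n)))"
    by (simp add: power2_eq_square)
  also have "\<dots> \<le> 192 * (\<alpha>\<^sup>2 * (real n * L\<^sup>2 * (L\<^sup>2 * real n)))"
    by (intro mult_right_mono) auto
  also have "\<dots> = \<alpha>\<^sup>2 * (real n * L\<^sup>2 * (192 * L\<^sup>2 * real n))" by simp
  also have "\<dots> \<le> \<alpha>\<^sup>2 * (\<kappa>\<^sup>2 * L\<^sup>2 * X)"
    using X kappa_ge by (intro mult_left_mono mult_mono) auto
  also have "\<dots> \<le> (\<mu> * \<eta> * (1 - \<tau>\<^sup>2))\<^sup>2"
    using sq_bound_of_le_divide_sqrt[OF _ alpha_le_3[folded X_def] _ X_pos] alpha_pos kappa_gt_1 L_pos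
    by (simp only: power_mult_distrib[of \<kappa> L]) simp
  also have "\<dots> \<le> (\<mu> * \<eta>)\<^sup>2"
    using mu_pos eta_range tau_sq by (intro power_mono mult_left_le) auto
  finally show ?thesis
    using mu_pos eta_range by (intro power2_le_imp_le[of "13 * \<alpha> * real n * L\<^sup>2"]) auto
qed

text \<open>From the second bound, squared. The constant is 16 * 24 * 16, from the prefactor 4 and
  the summands with 24 and 16 in the radicand.\<close>

lemma alpha_sq_le: "\<alpha>\<^sup>2 * (6144 * L^4 * (vphi\<^sup>2)\<^sup>2 * \<kappa>\<^sup>2) \<le> \<mu>\<^sup>2 * \<eta>\<^sup>2 * (1 - c\<^sup>2)\<^sup>2 * (1 - \<tau>\<^sup>2)\<^sup>2"
proof -
  define X where "X = (real n * \<mu>\<^sup>2 * \<eta>\<^sup>2 + 24 * L\<^sup>2 * vphi\<^sup>2) * (\<eta> + 16 * \<kappa>\<^sup>2)"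
  have X: "24 * L\<^sup>2 * vphi\<^sup>2 * (16 * \<kappa>\<^sup>2) \<le> X"
    unfolding X_def using eta_range by (intro mult_mono) auto
  moreover have "0 < 24 * L\<^sup>2 * vphi\<^sup>2 * (16 * \<kappa>\<^sup>2)"
    using L_pos kappa_gt_1 vphi_gt_1 by (intro mult_pos_pos) auto
  ultimately have X_pos: "0 < X" by linarith
  have "\<alpha>\<^sup>2 * (6144 * L^4 * (vphi\<^sup>2)\<^sup>2 * \<kappa>\<^sup>2) = \<alpha>\<^sup>2 * ((4 * L * vphi)\<^sup>2 * (24 * L\<^sup>2 * vphi\<^sup>2 * (16 * \<kappa>\<^sup>2)))"
    using power_add[of L 2 2] by (simp add: power_mult_distrib power2_eq_square[of "vphi\<^sup>2"] mult_ac)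
  also have "\<dots> \<le> \<alpha>\<^sup>2 * ((4 * L * vphi)\<^sup>2 * X)"
    using X by (intro mult_left_mono) auto
  also have "\<dots> \<le> (\<mu> * \<eta> * (1 - c\<^sup>2) * (1 - \<tau>\<^sup>2))\<^sup>2"
    using sq_bound_of_le_divide_sqrt[OF _ alpha_le_2[folded X_def] _ X_pos] alpha_pos vphi_gt_1 L_pos
    by simp
  finally show ?thesis by (simp add: power_mult_distrib)
qed

text \<open>Only the entry with a minus sign needs an argument: the first step-size bound makes the
  subtracted term at most \<open>\<mu> / (L + \<mu>)\<close>.\<close>

lemma M_pos:
  assumes "i < 3" "j < 3"
  shows "0 < M $$ (i, j)"
proof -
  have "real n * \<mu> * \<eta> / 2 * \<alpha> \<le> real n * \<mu> * \<eta> / 2 * (2 / (real n * \<eta> * (L + \<mu>)))"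
    using alpha_le_1 mu_pos eta_range by (intro mult_left_mono) auto
  also have "\<dots> = (real n * \<eta>) * \<mu> / ((real n * \<eta>) * (L + \<mu>))" by (simp add: mult_ac)
  also have "\<dots> = \<mu> / (L + \<mu>)" using n_ge_2 eta_range by simp
  also have "\<dots> < 1" using L_pos mu_pos by simp
  finally have "real n * \<mu> * \<eta> / 2 * \<alpha> < 1" .
  moreover have "0 < L\<^sup>2" "0 < vphi\<^sup>2" "0 < \<alpha>\<^sup>2" "0 < real n" "0 < 1 + c\<^sup>2" "0 < 1 - c\<^sup>2" "0 < 1 + \<tau>\<^sup>2"
    using L_pos vphi_gt_1 alpha_pos n_ge_2 c_sq tau_sq by (simp_all add: add_pos_nonneg)
  ultimately have "0 < M $$ (0, 0)" "0 < M $$ (0, 1)" "0 < M $$ (0, 2)"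
    "0 < M $$ (1, 0)" "0 < M $$ (1, 1)" "0 < M $$ (1, 2)"
    "0 < M $$ (2, 0)" "0 < M $$ (2, 1)" "0 < M $$ (2, 2)"
    unfolding M_mat_index using mu_pos eta_range alpha_pos nu_pos by (simp_all add: add_pos_pos)
  then show ?thesis
    by (rule_tac less_3_cases[OF assms(1)]; rule_tac less_3_cases[OF assms(2)]; simp only:)
qed

text \<open>Here \<open>psi_le\<close> replaces \<psi> by \<open>n * \<kappa>\<^sup>2\<close>; the
  two summands of \<nu> then merge because 4 + 2 n \<le> 4 n for n at least 2.\<close>

lemma nu_le: "\<nu> * (1 - \<tau>\<^sup>2) \<le> 4 * real n * \<kappa>\<^sup>2 * L\<^sup>2"
proof -
  have "\<nu> * (1 - \<tau>\<^sup>2) = 4 * L\<^sup>2 * \<kappa>\<^sup>2 * \<tau>\<^sup>2 + 2 * \<psi> * L\<^sup>2 * (1 - \<tau>\<^sup>2)"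
    using tau_sq by (simp add: nu_const_def field_simps)
  also have "\<dots> \<le> 4 * L\<^sup>2 * \<kappa>\<^sup>2 * 1 + 2 * (real n * \<kappa>\<^sup>2) * L\<^sup>2 * 1"
    using tau_sq psi_le psi_pos by (intro add_mono mult_mono) (auto simp: algebra_simps)
  also have "\<dots> \<le> 4 * real n * \<kappa>\<^sup>2 * L\<^sup>2"
    using mult_right_mono[of 2 "real n" "2 * L\<^sup>2 * \<kappa>\<^sup>2"] n_ge_2 by (simp add: algebra_simps)
  finally show ?thesis .
qed

text \<open>The second weight is normalised to one, the third one makes the coupling of the third row to
  the second cost half of its diagonal gap, and the first one exceeds what the first row requires by
  the factor \<open>6 / 5\<close>.\<close>

lemma M_supersolution:
  obtains z :: "nat \<Rightarrow> real"
  where "\<And>i. i < 3 \<Longrightarrow> 0 < z i" "\<And>i. i < 3 \<Longrightarrow> (\<Sum>j<3. M $$ (i, j) * z j) < z i"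
proof -
  define u where "u = 1 - c\<^sup>2"
  define t where "t = 1 - \<tau>\<^sup>2"
  define F where "F = vphi\<^sup>2"
  define K where "K = \<kappa>\<^sup>2"
  define N where "N = real n"
  define Q where "Q = \<alpha>\<^sup>2 * L\<^sup>2"
  have u: "0 < u" "u \<le> 1" and t: "0 < t" "t \<le> 1" using c_sq tau_sq by (auto simp: u_def t_def)
  have N: "2 \<le> N" "N \<le> K" "N \<le> F" using n_ge_2 kappa_ge vphi_ge by (auto simp: N_def K_def F_def)
  have Q0: "0 \<le> Q" by (simp add: Q_def)
  have main: "6144 * (Q * L\<^sup>2 * F\<^sup>2 * K) \<le> \<mu>\<^sup>2 * \<eta>\<^sup>2 * u\<^sup>2 * t\<^sup>2"
  proof -
    have "6144 * (Q * L\<^sup>2 * F\<^sup>2 * K) = \<alpha>\<^sup>2 * (6144 * L^4 * (vphi\<^sup>2)\<^sup>2 * \<kappa>\<^sup>2)"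
      using power_add[of L 2 2] by (simp add: Q_def F_def K_def mult_ac)
    then show ?thesis using alpha_sq_le by (simp only: u_def t_def)
  qed
  have QF: "6144 * (Q * F\<^sup>2 * K) \<le> u\<^sup>2 * t\<^sup>2"
  proof -
    have "6144 * (Q * F\<^sup>2 * K) * L\<^sup>2 = 6144 * (Q * L\<^sup>2 * F\<^sup>2 * K)" by (simp only: mult_ac)
    also have "\<dots> \<le> \<mu>\<^sup>2 * \<eta>\<^sup>2 * u\<^sup>2 * t\<^sup>2" by (rule main)
    also have "\<dots> \<le> L\<^sup>2 * 1 * u\<^sup>2 * t\<^sup>2"
      using mu_le_L mu_pos eta_range by (intro mult_right_mono mult_mono power_mono power_le_one) auto
    finally have "6144 * (Q * F\<^sup>2 * K) * L\<^sup>2 \<le> u\<^sup>2 * t\<^sup>2 * L\<^sup>2" by (simp only: mult_ac mult_1_left mult_1_right)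
    then show ?thesis using L_pos by (simp only: mult_le_cancel_right_pos zero_less_power)
  qed
  have nu_t: "\<nu> / t \<le> 4 * N * K * L\<^sup>2 / t\<^sup>2"
  proof -
    have "\<nu> / t = \<nu> * t / t\<^sup>2" using t by (simp add: power2_eq_square)
    also have "\<dots> \<le> 4 * N * K * L\<^sup>2 / t\<^sup>2"
      using nu_le unfolding t_def N_def K_def by (rule divide_right_mono) simp
    finally show ?thesis .
  qed
  define v3 where "v3 = 16 * F * (\<nu> / t)"
  define v1 where "v1 = 6 / 5 * (3 * L\<^sup>2 * F / \<mu> + 3 / (N * \<mu> * \<eta>) * v3) / (N * \<mu> * \<eta> / 2)"
  have v3_pos: "0 < v3" using N nu_pos t by (simp add: v3_def)
  have pre_pos: "0 < 3 * L\<^sup>2 * F / \<mu> + 3 / (N * \<mu> * \<eta>) * v3"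
    using L_pos N mu_pos eta_range v3_pos by (intro add_pos_pos mult_pos_pos divide_pos_pos) auto
  then have v1_pos: "0 < v1"
    using N mu_pos eta_range unfolding v1_def by (intro divide_pos_pos mult_pos_pos) auto
  have eta_t: "0 < \<eta> * t\<^sup>2" "\<eta> * t\<^sup>2 \<le> 1"
    using eta_range t by (auto intro!: mult_le_one power_le_one)
  \<comment> \<open>468 = 36/5 * (1 + 64): 36/5 collects 6/5, the coefficient 3 and the division by
    1/2, while 64 is 16 from \<open>v3\<close> times 4 from the bound on \<nu>.\<close>
  have v1_le: "v1 * (N * \<mu>\<^sup>2 * \<eta>\<^sup>2 * t\<^sup>2) \<le> 468 * F * K * L\<^sup>2"
  proof -
    have "v1 * (N * \<mu>\<^sup>2 * \<eta>\<^sup>2 * t\<^sup>2) = 36 / 5 * F * (L\<^sup>2 * (\<eta> * t\<^sup>2) + 16 / N * (\<nu> / t) * t\<^sup>2)"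
    proof -
      define q where "q = \<nu> / t"
      define r where "r = 1 / N"
      have v3q: "v3 = 16 * F * q" by (simp add: v3_def q_def)
      have "v1 * (N * \<mu> * \<eta> / 2) = 6 / 5 * (3 * L\<^sup>2 * F / \<mu> + 3 / (N * \<mu> * \<eta>) * v3)"
        using N mu_pos eta_range by (simp add: v1_def)
      then have h: "v1 * (N * \<mu> * \<eta> / 2) * (\<mu> * \<eta>) = 6 / 5 * (3 * L\<^sup>2 * F * \<eta> + 3 * r * v3)"
        using N mu_pos eta_range by (simp add: r_def field_simps)
      have "v1 * (N * \<mu>\<^sup>2 * \<eta>\<^sup>2 * t\<^sup>2) = v1 * (N * \<mu> * \<eta> / 2) * (\<mu> * \<eta>) * (2 * t\<^sup>2)"
        by (simp add: power2_eq_square mult_ac)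
      also have "\<dots> = 36 / 5 * F * (L\<^sup>2 * (\<eta> * t\<^sup>2) + 16 * r * q * t\<^sup>2)"
        unfolding h v3q by (simp add: algebra_simps)
      finally show ?thesis by (simp add: q_def r_def)
    qed
    also have "\<dots> \<le> 36 / 5 * F * (L\<^sup>2 * K + 16 / N * (4 * N * K * L\<^sup>2 / t\<^sup>2) * t\<^sup>2)"
      using N eta_t nu_t by (intro mult_left_mono add_mono mult_right_mono) auto
    also have "\<dots> = 468 * F * K * L\<^sup>2"
      using N t by (simp add: field_simps)
    finally show ?thesis .
  qed
  have NQ: "N * F * Q \<le> u\<^sup>2 / 6144"
  proof -
    have "N * F * Q \<le> K * F\<^sup>2 * Q"
      using N Q0 by (intro mult_right_mono mult_mono) (auto simp: power2_eq_square)
    moreover have "u\<^sup>2 * t\<^sup>2 \<le> u\<^sup>2 * 1" using t by (intro mult_left_mono power_le_one) auto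
    moreover have "K * F\<^sup>2 * Q = Q * F\<^sup>2 * K" by simp
    ultimately show ?thesis using QF by linarith
  qed
  have NQv1: "N * F * Q * v1 \<le> 468 / 6144 * u\<^sup>2"
  proof -
    have P: "0 < \<mu>\<^sup>2 * \<eta>\<^sup>2 * t\<^sup>2" using mu_pos eta_range t by simp
    have "N * F * Q * v1 * (\<mu>\<^sup>2 * \<eta>\<^sup>2 * t\<^sup>2) = F * Q * (v1 * (N * \<mu>\<^sup>2 * \<eta>\<^sup>2 * t\<^sup>2))" by (simp only: mult_ac)
    also have "\<dots> \<le> F * Q * (468 * F * K * L\<^sup>2)" using N Q0 v1_le by (intro mult_left_mono) auto
    also have "\<dots> = 468 * (Q * L\<^sup>2 * F\<^sup>2 * K)" by (simp add: power2_eq_square mult_ac)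
    also have "\<dots> \<le> 468 / 6144 * (\<mu>\<^sup>2 * \<eta>\<^sup>2 * u\<^sup>2 * t\<^sup>2)" using main by linarith
    also have "\<dots> = 468 / 6144 * u\<^sup>2 * (\<mu>\<^sup>2 * \<eta>\<^sup>2 * t\<^sup>2)" by (simp only: mult_ac)
    finally show ?thesis using P by (simp only: mult_le_cancel_right_pos)
  qed
  have av3: "\<alpha>\<^sup>2 * v3 \<le> 64 / 6144 * u\<^sup>2"
  proof -
    have "\<alpha>\<^sup>2 * v3 \<le> \<alpha>\<^sup>2 * (16 * F * (4 * N * K * L\<^sup>2 / t\<^sup>2))"
      unfolding v3_def using N nu_t by (intro mult_left_mono) auto
    also have "\<dots> = 64 * (Q * (F * N) * K) / t\<^sup>2" by (simp add: Q_def)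
    also have "\<dots> \<le> 64 * (Q * F\<^sup>2 * K) / t\<^sup>2"
      using N Q0 by (intro divide_right_mono mult_left_mono mult_right_mono) (auto simp: power2_eq_square)
    also have "\<dots> \<le> 64 * (u\<^sup>2 * t\<^sup>2 / 6144) / t\<^sup>2"
      using QF by (intro divide_right_mono mult_left_mono) auto
    also have "\<dots> = 64 / 6144 * u\<^sup>2" using t by simp
    finally show ?thesis .
  qed
  have row0: "(1 - N * \<mu> * \<eta> / 2 * \<alpha>) * v1 + 3 * L\<^sup>2 * F / \<mu> * \<alpha> * 1 + 3 / (N * \<mu> * \<eta>) * \<alpha> * v3 < v1"
  proof -
    define P where "P = 3 * L\<^sup>2 * F / \<mu> + 3 / (N * \<mu> * \<eta>) * v3"
    have "N * \<mu> * \<eta> / 2 * \<alpha> * v1 = 6 / 5 * (\<alpha> * P)"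
      using N mu_pos eta_range by (simp add: v1_def P_def)
    moreover have "0 < \<alpha> * P" using pre_pos alpha_pos by (simp add: P_def)
    moreover have "3 * L\<^sup>2 * F / \<mu> * \<alpha> + 3 / (N * \<mu> * \<eta>) * \<alpha> * v3 = \<alpha> * P"
      by (simp add: P_def distrib_left mult_ac)
    moreover have "(1 - N * \<mu> * \<eta> / 2 * \<alpha>) * v1 = v1 - N * \<mu> * \<eta> / 2 * \<alpha> * v1"
      by (simp only: left_diff_distrib mult_1_left)
    ultimately show ?thesis by (simp only: mult_1_right add.assoc)
  qed
  have row1: "2 * N * L\<^sup>2 * F * (1 + c\<^sup>2) / u * \<alpha>\<^sup>2 * v1
      + ((1 + c\<^sup>2) / 2 + 2 * N * L\<^sup>2 * F * (1 + c\<^sup>2) / u * \<alpha>\<^sup>2) * 1 + (1 + c\<^sup>2) / u * \<alpha>\<^sup>2 * v3 < 1"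
  proof -
    have c2: "0 \<le> 1 + c\<^sup>2" "1 + c\<^sup>2 \<le> 2" using c_sq by auto
    have "2 * N * L\<^sup>2 * F * (1 + c\<^sup>2) / u * \<alpha>\<^sup>2 * v1 + 2 * N * L\<^sup>2 * F * (1 + c\<^sup>2) / u * \<alpha>\<^sup>2 + (1 + c\<^sup>2) / u * \<alpha>\<^sup>2 * v3
      = (1 + c\<^sup>2) / u * (2 * (N * F * Q * v1) + 2 * (N * F * Q) + \<alpha>\<^sup>2 * v3)"
      by (simp add: Q_def algebra_simps)
    also have "\<dots> \<le> (1 + c\<^sup>2) / u * (2 * (468 / 6144 * u\<^sup>2) + 2 * (u\<^sup>2 / 6144) + 64 / 6144 * u\<^sup>2)"
      using c2 u NQ NQv1 av3 by (intro mult_left_mono add_mono) auto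
    \<comment> \<open>1002 = 2 * 468 + 2 + 64. Twice this is below half of 6144, so the off-diagonal
      load stays under the gap \<open>u / 2\<close> of the second row.\<close>
    also have "\<dots> = (1 + c\<^sup>2) * u * (1002 / 6144)" using u by (simp add: field_simps power2_eq_square)
    also have "\<dots> \<le> 2 * u * (1002 / 6144)" using c2 u by (intro mult_right_mono) auto
    finally have "2 * N * L\<^sup>2 * F * (1 + c\<^sup>2) / u * \<alpha>\<^sup>2 * v1 + 2 * N * L\<^sup>2 * F * (1 + c\<^sup>2) / u * \<alpha>\<^sup>2
        + (1 + c\<^sup>2) / u * \<alpha>\<^sup>2 * v3 < u / 2" using u by linarith
    moreover have "A + ((1 + c\<^sup>2) / 2 + B) * 1 + C < 1" if "A + B + C < u / 2" for A B C
      using that by (simp add: u_def field_simps)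
    ultimately show ?thesis by blast
  qed
  have row2: "2 * N * L\<^sup>2 * F * \<nu> * \<alpha>\<^sup>2 * v1 + (4 * F * \<nu> + 2 * N * L\<^sup>2 * F * \<nu> * \<alpha>\<^sup>2) * 1
      + ((1 + \<tau>\<^sup>2) / 2 + \<nu> * \<alpha>\<^sup>2) * v3 < v3"
  proof -
    have u2: "u\<^sup>2 \<le> 1" using u by (simp add: power_le_one)
    have "2 * N * L\<^sup>2 * F * \<nu> * \<alpha>\<^sup>2 * v1 + 2 * N * L\<^sup>2 * F * \<nu> * \<alpha>\<^sup>2 + \<nu> * \<alpha>\<^sup>2 * v3
        = \<nu> * (2 * (N * F * Q * v1) + 2 * (N * F * Q) + \<alpha>\<^sup>2 * v3)"
      by (simp add: Q_def algebra_simps)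
    also have "\<dots> \<le> \<nu> * (2 * (468 / 6144 * u\<^sup>2) + 2 * (u\<^sup>2 / 6144) + 64 / 6144 * u\<^sup>2)"
      using nu_pos NQ NQv1 av3 by (intro mult_left_mono add_mono) auto
    also have "\<dots> = \<nu> * (u\<^sup>2 * (1002 / 6144))" by simp
    \<comment> \<open>The gap \<open>t / 2 * v3\<close> equals \<open>8 * F * \<nu>\<close>. One
      half pays for the coupling to the second row, and the remaining terms fit easily into the
      other, as \<open>F\<close> is at least 2.\<close>
    also have "\<dots> < \<nu> * (4 * F)" using u2 N nu_pos by (intro mult_strict_left_mono) auto
    finally have "2 * N * L\<^sup>2 * F * \<nu> * \<alpha>\<^sup>2 * v1 + 2 * N * L\<^sup>2 * F * \<nu> * \<alpha>\<^sup>2 + \<nu> * \<alpha>\<^sup>2 * v3 < 4 * F * \<nu>"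
      by (simp add: mult_ac)
    moreover have "8 * F * \<nu> = t / 2 * v3" using t by (simp add: v3_def)
    moreover have "((1 + \<tau>\<^sup>2) / 2 + \<nu> * \<alpha>\<^sup>2) * v3 = v3 - t / 2 * v3 + \<nu> * \<alpha>\<^sup>2 * v3"
      by (simp add: t_def field_simps)
    moreover have "0 < F * \<nu>" using N nu_pos by simp
    ultimately show ?thesis by (simp only: mult_1_right)
  qed
  define z where "z i = (if i = 0 then v1 else if i = 1 then 1 else v3)" for i :: nat
  have zs: "z 0 = v1" "z 1 = 1" "z 2 = v3" by (simp_all add: z_def)
  show thesis
  proof (rule that[of z])
    show "0 < z i" for i using v1_pos v3_pos by (simp add: z_def)
    show "(\<Sum>j<3. M $$ (i, j) * z j) < z i" if "i < 3" for i
      unfolding sum_lessThan_3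
      using row0 row1 row2 unfolding N_def F_def u_def
      by (rule_tac less_3_cases[OF that]; simp only: M_mat_index zs)
  qed
qed

end

section \<open>Weighted variance and dispersion\<close>

lemma norm_weighted_sum_sq_le:
  fixes v :: "'n::finite \<Rightarrow> 'a::real_normed_vector"
  assumes "\<And>i. 0 \<le> w i"
  shows "(norm (\<Sum>i\<in>UNIV. w i *\<^sub>R v i))\<^sup>2 \<le> (\<Sum>i\<in>UNIV. w i) * (\<Sum>i\<in>UNIV. w i * (norm (v i))\<^sup>2)"
proof -
  have "norm (\<Sum>i\<in>UNIV. w i *\<^sub>R v i) \<le> (\<Sum>i\<in>UNIV. norm (w i *\<^sub>R v i))" by (rule norm_sum)
  also have "\<dots> = (\<Sum>i\<in>UNIV. sqrt (w i) * (sqrt (w i) * norm (v i)))"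
    using assms by (simp add: mult.assoc[symmetric])
  finally have "(norm (\<Sum>i\<in>UNIV. w i *\<^sub>R v i))\<^sup>2 \<le> (\<Sum>i\<in>UNIV. sqrt (w i) * (sqrt (w i) * norm (v i)))\<^sup>2"
    by (rule power_mono) simp
  also have "\<dots> \<le> (\<Sum>i\<in>UNIV. (sqrt (w i))\<^sup>2) * (\<Sum>i\<in>UNIV. (sqrt (w i) * norm (v i))\<^sup>2)"
    by (rule Cauchy_Schwarz_ineq_sum)
  finally show ?thesis using assms by (simp add: power_mult_distrib)
qed

lemma norm_add_sq_le:
  fixes u v :: "'a::real_inner"
  assumes "0 < \<theta>"
  shows "(norm (u + v))\<^sup>2 \<le> (1 + \<theta>) * (norm u)\<^sup>2 + (1 + 1 / \<theta>) * (norm v)\<^sup>2"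
proof -
  have "0 \<le> (norm (sqrt \<theta> *\<^sub>R u - (1 / sqrt \<theta>) *\<^sub>R v))\<^sup>2" by simp
  also have "\<dots> = \<theta> * (norm u)\<^sup>2 - 2 * inner u v + (1 / \<theta>) * (norm v)\<^sup>2"
    using assms by (simp add: power2_norm_eq_inner inner_diff_left inner_diff_right inner_commute)
  finally have "2 * inner u v \<le> \<theta> * (norm u)\<^sup>2 + (1 / \<theta>) * (norm v)\<^sup>2" by simp
  then show ?thesis
    by (simp add: power2_norm_eq_inner inner_add_left inner_add_right inner_commute distrib_right)
qed

lemma norm_add_sq_le_2: "(norm (u + v))\<^sup>2 \<le> 2 * (norm u)\<^sup>2 + 2 * (norm (v :: 'a::real_inner))\<^sup>2"
  using norm_add_sq_le[of 1 u v] by simp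

lemma norm_diff_sq_le_2: "(norm (u - v))\<^sup>2 \<le> 2 * (norm u)\<^sup>2 + 2 * (norm (v :: 'a::real_inner))\<^sup>2"
  using norm_add_sq_le_2[of u "- v"] by simp

lemma norm_sum_sq_le:
  fixes x :: "'n::finite \<Rightarrow> 'a::real_normed_vector"
  shows "(norm (\<Sum>i\<in>UNIV. x i))\<^sup>2 \<le> real CARD('n) * (\<Sum>i\<in>UNIV. (norm (x i))\<^sup>2)"
proof -
  have "(norm (\<Sum>i\<in>UNIV. x i))\<^sup>2 \<le> (\<Sum>i\<in>UNIV. norm (x i))\<^sup>2"
    by (intro power_mono norm_sum) simp
  also have "\<dots> \<le> (\<Sum>i\<in>UNIV. (norm (x i))\<^sup>2) * CARD('n)"
    by (rule sum_squared_le_sum_of_squares)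
  finally show ?thesis by (simp add: mult.commute)
qed

text \<open>This and the next definitions are counterparts of \<open>wavg\<close>,
  \<open>wnorm\<close> and \<open>S_disp\<close>, squared where those take roots, for functions of
  the agent. Families such as the ratios of trackers to weights can thus be inserted directly;
  \<open>err_eq\<close> makes the link.\<close>

definition wmean :: "('n::finite \<Rightarrow> real) \<Rightarrow> ('n \<Rightarrow> 'a::real_inner) \<Rightarrow> 'a" where
  "wmean w x = (\<Sum>i\<in>UNIV. w i *\<^sub>R x i)"

definition wvar :: "('n::finite \<Rightarrow> real) \<Rightarrow> ('n \<Rightarrow> 'a::real_inner) \<Rightarrow> real" where
  "wvar w x = (\<Sum>i\<in>UNIV. w i * (norm (x i - wmean w x))\<^sup>2)"

definition disp :: "('n::finite \<Rightarrow> real) \<Rightarrow> ('n \<Rightarrow> 'a::real_inner) \<Rightarrow> real" where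
  "disp p y = (\<Sum>i\<in>UNIV. p i * (norm ((1 / p i) *\<^sub>R y i - (\<Sum>j\<in>UNIV. y j)))\<^sup>2)"

text \<open>The symmetric bilinear form belonging to the quadratic form \<open>disp\<close> for
  positive weights of sum one. It isolates products with the noise, whose expectations are treated
  separately.\<close>

definition disp_form :: "('n::finite \<Rightarrow> real) \<Rightarrow> ('n \<Rightarrow> 'a::real_inner) \<Rightarrow> ('n \<Rightarrow> 'a) \<Rightarrow> real" where
  "disp_form p u v = (\<Sum>i\<in>UNIV. 1 / p i * inner (u i) (v i)) - inner (\<Sum>i\<in>UNIV. u i) (\<Sum>i\<in>UNIV. v i)"

lemma disp_form_commute: "disp_form p u v = disp_form p v u"
  by (simp add: disp_form_def inner_commute)

lemma disp_form_add_left: "disp_form p (\<lambda>i. u i + u' i) v = disp_form p u v + disp_form p u' v"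
  by (simp add: disp_form_def inner_add_left distrib_left add_divide_distrib sum.distrib)

lemma disp_form_diff_left: "disp_form p (\<lambda>i. u i - u' i) v = disp_form p u v - disp_form p u' v"
  by (simp add: disp_form_def inner_diff_left right_diff_distrib diff_divide_distrib sum_subtractf)

lemma disp_form_scale_left: "disp_form p (\<lambda>i. s *\<^sub>R u i) v = s * disp_form p u v"
  by (simp add: disp_form_def sum_distrib_left right_diff_distrib scaleR_right.sum[symmetric])

lemma wvar_nonneg: "(\<And>i. 0 \<le> w i) \<Longrightarrow> 0 \<le> wvar w x"
  unfolding wvar_def by (intro sum_nonneg mult_nonneg_nonneg) auto

lemma disp_nonneg: "(\<And>i. 0 \<le> p i) \<Longrightarrow> 0 \<le> disp p y"
  unfolding disp_def by (intro sum_nonneg mult_nonneg_nonneg) auto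

lemma wvar_decomp:
  assumes "(\<Sum>i\<in>UNIV. w i) = 1"
  shows "(\<Sum>i\<in>UNIV. w i * (norm (x i - z))\<^sup>2) = wvar w x + (norm (wmean w x - z))\<^sup>2"
  unfolding wvar_def wmean_def by (rule sum_weighted_norm_diff_sq[OF assms])

lemma wvar_le:
  assumes "(\<Sum>i\<in>UNIV. w i) = 1"
  shows "wvar w x \<le> (\<Sum>i\<in>UNIV. w i * (norm (x i))\<^sup>2)"
  using wvar_decomp[OF assms, of x 0] by simp

context
  fixes p :: "'n::finite \<Rightarrow> real"
  assumes p_pos: "\<And>i. 0 < p i" and p_sum: "(\<Sum>i\<in>UNIV. p i) = 1"
begin

text \<open>The weighted mean of the ratios \<open>y i / p i\<close> is the sum of the
  \<open>y i\<close>, so the dispersion is an ordinary weighted variance of the ratios.\<close>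

lemma disp_eq_wvar: "disp p y = wvar p (\<lambda>i. (1 / p i) *\<^sub>R y i)"
proof -
  have "p i \<noteq> 0" for i using p_pos[of i] by simp
  then show ?thesis by (simp add: disp_def wvar_def wmean_def)
qed

text \<open>The parallel axis identity for the ratios with reference point 0. Every comparison of
  the dispersion with plain squared norms rests on it.\<close>

lemma sum_norm_sq_div_weight: "(\<Sum>i\<in>UNIV. 1 / p i * (norm (y i))\<^sup>2) = disp p y + (norm (\<Sum>i\<in>UNIV. y i))\<^sup>2"
proof -
  have nz: "p i \<noteq> 0" for i using p_pos[of i] by simp
  have "p i * (norm ((1 / p i) *\<^sub>R y i))\<^sup>2 = 1 / p i * (norm (y i))\<^sup>2" for i
    using p_pos[of i] by (simp add: power_mult_distrib power2_eq_square[of "p i"] power_divide)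
  moreover have "wmean p (\<lambda>i. (1 / p i) *\<^sub>R y i) = (\<Sum>i\<in>UNIV. y i)"
    using nz by (simp add: wmean_def)
  ultimately show ?thesis
    using wvar_decomp[OF p_sum, of "\<lambda>i. (1 / p i) *\<^sub>R y i" 0] by (simp add: disp_eq_wvar)
qed

lemma disp_form_self: "disp_form p y y = disp p y"
  using sum_norm_sq_div_weight[of y] by (simp add: disp_form_def power2_norm_eq_inner)

text \<open>The factor \<open>q\<close> stands in front of the dispersion as well as of the squared
  sum; with \<open>q\<close> the largest weight this is the source of the room for the
  noise.\<close>

lemma sum_norm_sq_le_disp:
  assumes "\<And>i. p i \<le> q"
  shows "(\<Sum>i\<in>UNIV. (norm (y i))\<^sup>2) \<le> q * (disp p y + (norm (\<Sum>i\<in>UNIV. y i))\<^sup>2)"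
proof -
  have "(norm (y i))\<^sup>2 \<le> q * (1 / p i * (norm (y i))\<^sup>2)" for i
    using p_pos[of i] assms[of i] mult_right_mono[of 1 "q / p i" "(norm (y i))\<^sup>2"] by simp
  then show ?thesis
    unfolding sum_norm_sq_div_weight[symmetric] sum_distrib_left by (rule sum_mono)
qed

lemma disp_le_sum_norm_sq:
  assumes "\<And>i. 1 / p i \<le> q"
  shows "disp p y \<le> q * (\<Sum>i\<in>UNIV. (norm (y i))\<^sup>2)"
proof -
  have "disp p y \<le> (\<Sum>i\<in>UNIV. 1 / p i * (norm (y i))\<^sup>2)"
    unfolding sum_norm_sq_div_weight by simp
  also have "\<dots> \<le> (\<Sum>i\<in>UNIV. q * (norm (y i))\<^sup>2)"
    by (intro sum_mono mult_right_mono assms) simp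
  finally show ?thesis by (simp add: sum_distrib_left)
qed

lemma disp_add: "disp p (\<lambda>i. u i + v i) = disp p u + 2 * disp_form p u v + disp p v"
  unfolding disp_form_self[symmetric] disp_form_add_left
  by (simp add: disp_form_commute[of _ _ "\<lambda>i. u i + v i"] disp_form_add_left disp_form_commute[of _ v u])

lemma disp_diff: "disp p (\<lambda>i. u i - v i) = disp p u - 2 * disp_form p u v + disp p v"
  unfolding disp_form_self[symmetric] disp_form_diff_left
  by (simp add: disp_form_commute[of _ _ "\<lambda>i. u i - v i"] disp_form_diff_left disp_form_commute[of _ v u])

lemma disp_scale: "disp p (\<lambda>i. s *\<^sub>R u i) = s\<^sup>2 * disp p u"
  unfolding disp_form_self[symmetric] disp_form_scale_left
  by (simp add: disp_form_commute[of _ _ "\<lambda>i. s *\<^sub>R u i"] disp_form_scale_left power2_eq_square)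

text \<open>The dispersion is nonnegative at sqrt \<theta> u - v / sqrt \<theta> and at sqrt
  \<theta> u + v / sqrt \<theta>.\<close>

lemma disp_form_young:
  assumes "0 < \<theta>"
  shows "2 * \<bar>disp_form p u v\<bar> \<le> \<theta> * disp p u + disp p v / \<theta>"
proof -
  let ?s = "sqrt \<theta>"
  have "0 \<le> disp p (\<lambda>i. ?s *\<^sub>R u i - (1 / ?s) *\<^sub>R v i)" "0 \<le> disp p (\<lambda>i. ?s *\<^sub>R u i + (1 / ?s) *\<^sub>R v i)"
    by (intro disp_nonneg less_imp_le[OF p_pos])+
  moreover have "disp_form p (\<lambda>i. ?s *\<^sub>R u i) (\<lambda>i. (1 / ?s) *\<^sub>R v i) = disp_form p u v"
    using assms by (simp only: disp_form_scale_left disp_form_commute[of _ _ "\<lambda>i. (1 / ?s) *\<^sub>R v i"])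
      (simp add: disp_form_commute)
  moreover have "disp p (\<lambda>i. ?s *\<^sub>R u i) = \<theta> * disp p u" "disp p (\<lambda>i. (1 / ?s) *\<^sub>R v i) = disp p v / \<theta>"
    using assms by (simp_all only: disp_scale) (simp_all add: power_divide)
  ultimately show ?thesis unfolding disp_add disp_diff by simp
qed

end

text \<open>In terms of the ratios \<open>y i / p i\<close> the column-stochastic \<open>B\<close>
  acts as the row-stochastic matrix \<open>B i j * p j / p' i\<close>, which carries
  \<open>p'\<close> to \<open>p\<close>. The consensus estimate therefore applies, with \<beta>
  equal to \<open>mn\<^sup>2 * b\<^sup>2 / mx'\<close>.\<close>

lemma disp_contraction:
  fixes y :: "'n::finite \<Rightarrow> 'a::real_inner"
  assumes sc: "strongly_connected (net E)"
    and B_nonneg: "\<And>i j. 0 \<le> B i j" and B_col: "\<And>j. (\<Sum>i\<in>UNIV. B i j) = 1"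
    and p'_eq: "\<And>i. p' i = (\<Sum>j\<in>UNIV. B i j * p j)"
    and p_pos: "\<And>i. 0 < p i" and p'_pos: "\<And>i. 0 < p' i" and p_sum: "(\<Sum>i\<in>UNIV. p i) = 1"
    and p_ge: "0 \<le> mn" "\<And>i. mn \<le> p i" and p_le: "\<And>i. p i \<le> mx" and p'_le: "\<And>i. p' i \<le> mx'"
    and b: "0 \<le> b" "\<And>i. b \<le> B i i" "\<And>i j. (j, i) \<in> E \<Longrightarrow> b \<le> B i j"
  shows "disp p' (\<lambda>i. \<Sum>j\<in>UNIV. B i j *\<^sub>R y j) \<le>
    (1 - mn\<^sup>2 * b\<^sup>2 / (mx\<^sup>2 * mx' * real (diam (net E)) * real (max_edge_utility (net E)))) * disp p y"
proof -
  define W where "W i j = B i j * p j / p' i" for i j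
  define z where "z i = (1 / p i) *\<^sub>R y i" for i
  have nz: "p i \<noteq> 0" "p' i \<noteq> 0" for i using p_pos[of i] p'_pos[of i] by auto
  have mx': "0 < mx'" using p'_pos p'_le less_le_trans by blast
  have Wz: "(\<Sum>j\<in>UNIV. W i j *\<^sub>R z j) = (1 / p' i) *\<^sub>R (\<Sum>j\<in>UNIV. B i j *\<^sub>R y j)" for i
    using nz by (simp add: W_def z_def scaleR_sum_right)
  have m: "(\<Sum>j\<in>UNIV. p j *\<^sub>R z j) = (\<Sum>j\<in>UNIV. y j)" using nz by (simp add: z_def)
  have By: "(\<Sum>i\<in>UNIV. \<Sum>j\<in>UNIV. B i j *\<^sub>R y j) = (\<Sum>j\<in>UNIV. y j)"
    by (subst sum.swap) (simp add: scaleR_left.sum[symmetric] B_col)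
  have "(\<Sum>i\<in>UNIV. p' i * (norm ((\<Sum>j\<in>UNIV. W i j *\<^sub>R z j) - (\<Sum>j\<in>UNIV. p j *\<^sub>R z j)))\<^sup>2) \<le>
    (1 - mn\<^sup>2 * b\<^sup>2 / mx' / (mx\<^sup>2 * real (diam (net E)) * real (max_edge_utility (net E)))) *
      (\<Sum>j\<in>UNIV. p j * (norm (z j - (\<Sum>j\<in>UNIV. p j *\<^sub>R z j)))\<^sup>2)"
  proof (rule weighted_consensus_contraction[OF sc])
    show "0 \<le> W i j" for i j
      using B_nonneg p_pos[of j] p'_pos[of i] by (simp add: W_def)
    show "(\<Sum>j\<in>UNIV. W i j) = 1" for i
      using nz by (simp add: W_def sum_divide_distrib[symmetric] p'_eq[symmetric])
    show "(\<Sum>i\<in>UNIV. p' i * W i j) = p j" for j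
      using nz by (simp add: W_def sum_distrib_right[symmetric] B_col)
    show "mn\<^sup>2 * b\<^sup>2 / mx' \<le> p' i * W i i * W i j" if "(j, i) \<in> E" for i j
    proof -
      have "mn * mn * (b * b) / mx' \<le> (p i * p j) * (B i i * B i j) / p' i"
        using that b p_ge p_pos p'_pos[of i] p'_le[of i] B_nonneg mx'
        by (intro frac_le mult_mono mult_nonneg_nonneg) (auto intro: less_imp_le order_trans)
      also have "\<dots> = p' i * W i i * W i j" using nz[of i] by (simp add: W_def)
      finally show ?thesis by (simp add: power2_eq_square)
    qed
  qed (use p_pos p'_pos p_sum p_le mx' in \<open>auto intro: less_imp_le\<close>)
  then show ?thesis
    by (simp add: disp_def Wz m By z_def[symmetric] mult_ac)
qed

text \<open>Young's inequality between the mixed deviations and the tracker term. The parameter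
  \<theta> is the one for which \<open>(1 + \<theta>) * c\<^sup>2\<close> is the midpoint of
  \<open>c\<^sup>2\<close> and 1; the other factor is then the coefficient \<open>m5\<close> of
  M.\<close>

lemma wvar_step:
  fixes x y :: "'n::finite \<Rightarrow> 'a::real_inner"
  assumes w'_nonneg: "\<And>i. 0 \<le> w' i" and w'_sum: "(\<Sum>i\<in>UNIV. w' i) = 1"
    and w'A: "\<And>j. (\<Sum>i\<in>UNIV. w' i * A i j) = w j"
    and contr: "(\<Sum>i\<in>UNIV. w' i * (norm ((\<Sum>j\<in>UNIV. A i j *\<^sub>R x j) - wmean w x))\<^sup>2) \<le> c\<^sup>2 * wvar w x"
    and c: "0 < c" "c < 1"
  shows "wvar w' (\<lambda>i. (\<Sum>j\<in>UNIV. A i j *\<^sub>R x j) - \<alpha> *\<^sub>R y i) \<le>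
    (1 + c\<^sup>2) / 2 * wvar w x + (1 + c\<^sup>2) / (1 - c\<^sup>2) * \<alpha>\<^sup>2 * (\<Sum>i\<in>UNIV. (norm (y i))\<^sup>2)"
proof -
  have c2: "0 < c\<^sup>2" "c\<^sup>2 < 1" using c by (simp_all add: power_less_one_iff)
  define \<theta> where "\<theta> = (1 - c\<^sup>2) / (2 * c\<^sup>2)"
  have \<theta>: "0 < \<theta>" "(1 + \<theta>) * c\<^sup>2 = (1 + c\<^sup>2) / 2" "1 + 1 / \<theta> = (1 + c\<^sup>2) / (1 - c\<^sup>2)"
    using c2 by (simp_all add: \<theta>_def field_simps)
  define q where "q i = (\<Sum>j\<in>UNIV. A i j *\<^sub>R x j) - wmean w x" for i
  have w'_le: "w' i \<le> 1" for i
    using member_le_sum[of i UNIV w'] w'_nonneg w'_sum by simp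
  have "wmean w' (\<lambda>i. \<Sum>j\<in>UNIV. A i j *\<^sub>R x j) = wmean w x"
    unfolding wmean_def scaleR_sum_right
    by (subst sum.swap) (simp add: w'A scaleR_left.sum[symmetric])
  then have mean: "wmean w' (\<lambda>i. (\<Sum>j\<in>UNIV. A i j *\<^sub>R x j) - \<alpha> *\<^sub>R y i) = wmean w x - \<alpha> *\<^sub>R wmean w' y"
    by (simp add: wmean_def scaleR_diff_right sum_subtractf scaleR_sum_right mult.commute)
  have "wvar w' (\<lambda>i. (\<Sum>j\<in>UNIV. A i j *\<^sub>R x j) - \<alpha> *\<^sub>R y i) =
      (\<Sum>i\<in>UNIV. w' i * (norm (q i + (- \<alpha>) *\<^sub>R (y i - wmean w' y)))\<^sup>2)"
    unfolding wvar_def mean by (simp add: q_def algebra_simps)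
  also have "\<dots> \<le> (\<Sum>i\<in>UNIV. w' i * ((1 + \<theta>) * (norm (q i))\<^sup>2 + (1 + 1 / \<theta>) * (norm ((- \<alpha>) *\<^sub>R (y i - wmean w' y)))\<^sup>2))"
    by (intro sum_mono mult_left_mono norm_add_sq_le \<theta> w'_nonneg)
  also have "\<dots> = (1 + \<theta>) * (\<Sum>i\<in>UNIV. w' i * (norm (q i))\<^sup>2) + (1 + 1 / \<theta>) * (\<alpha>\<^sup>2 * wvar w' y)"
    by (simp add: wvar_def distrib_left sum.distrib sum_distrib_left power_mult_distrib mult_ac)
  also have "\<dots> \<le> (1 + \<theta>) * (c\<^sup>2 * wvar w x) + (1 + 1 / \<theta>) * (\<alpha>\<^sup>2 * (\<Sum>i\<in>UNIV. (norm (y i))\<^sup>2))"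
  proof (intro add_mono mult_left_mono)
    show "(\<Sum>i\<in>UNIV. w' i * (norm (q i))\<^sup>2) \<le> c\<^sup>2 * wvar w x" using contr by (simp add: q_def)
    have "wvar w' y \<le> (\<Sum>i\<in>UNIV. w' i * (norm (y i))\<^sup>2)" by (rule wvar_le[OF w'_sum])
    also have "\<dots> \<le> (\<Sum>i\<in>UNIV. 1 * (norm (y i))\<^sup>2)" by (intro sum_mono mult_right_mono w'_le) simp
    finally show "wvar w' y \<le> (\<Sum>i\<in>UNIV. (norm (y i))\<^sup>2)" by simp
  qed (use \<theta>(1) in auto)
  finally show ?thesis using \<theta> by (simp add: mult.assoc[symmetric])
qed

text \<open>The step is split into the deviation from the mean after mixing, the one before, and the
  tracker term. Each deviation costs 4 F variances, F converting weighted into plain sums; mixing is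
  used only as a nonexpansive map.\<close>

lemma sum_norm_step_sq_le:
  fixes x y :: "'n::finite \<Rightarrow> 'a::real_inner"
  assumes w'_sum: "(\<Sum>i\<in>UNIV. w' i) = 1" and w_nonneg: "\<And>i. 0 \<le> w i" and F: "0 \<le> F"
    and Fw: "\<And>i. 1 \<le> F * w i" and Fw': "\<And>i. 1 \<le> F * w' i"
    and contr: "(\<Sum>i\<in>UNIV. w' i * (norm ((\<Sum>j\<in>UNIV. A i j *\<^sub>R x j) - wmean w x))\<^sup>2) \<le> wvar w x"
  shows "(\<Sum>i\<in>UNIV. (norm ((\<Sum>j\<in>UNIV. A i j *\<^sub>R x j) - \<alpha> *\<^sub>R y i - x i))\<^sup>2) \<le>
    8 * F * wvar w x + 2 * \<alpha>\<^sup>2 * (\<Sum>i\<in>UNIV. (norm (y i))\<^sup>2)"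
proof -
  define q where "q i = (\<Sum>j\<in>UNIV. A i j *\<^sub>R x j) - wmean w x" for i
  have 1: "(norm ((\<Sum>j\<in>UNIV. A i j *\<^sub>R x j) - \<alpha> *\<^sub>R y i - x i))\<^sup>2 \<le>
      4 * (F * w' i * (norm (q i))\<^sup>2) + 4 * (F * w i * (norm (x i - wmean w x))\<^sup>2) + 2 * \<alpha>\<^sup>2 * (norm (y i))\<^sup>2" for i
  proof -
    have "(norm ((\<Sum>j\<in>UNIV. A i j *\<^sub>R x j) - \<alpha> *\<^sub>R y i - x i))\<^sup>2
        = (norm ((q i - (x i - wmean w x)) - \<alpha> *\<^sub>R y i))\<^sup>2" by (simp add: q_def algebra_simps)
    also have "\<dots> \<le> 2 * (norm (q i - (x i - wmean w x)))\<^sup>2 + 2 * (norm (\<alpha> *\<^sub>R y i))\<^sup>2"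
      by (rule norm_diff_sq_le_2)
    also have "\<dots> \<le> 2 * (2 * (norm (q i))\<^sup>2 + 2 * (norm (x i - wmean w x))\<^sup>2) + 2 * (norm (\<alpha> *\<^sub>R y i))\<^sup>2"
      by (intro add_right_mono mult_left_mono norm_diff_sq_le_2) simp
    finally show ?thesis
      using mult_right_mono[OF Fw'[of i], of "(norm (q i))\<^sup>2"] mult_right_mono[OF Fw[of i], of "(norm (x i - wmean w x))\<^sup>2"]
      by (simp add: power_mult_distrib)
  qed
  have "(\<Sum>i\<in>UNIV. (norm ((\<Sum>j\<in>UNIV. A i j *\<^sub>R x j) - \<alpha> *\<^sub>R y i - x i))\<^sup>2) \<le>
    (\<Sum>i\<in>UNIV. 4 * (F * w' i * (norm (q i))\<^sup>2) + 4 * (F * w i * (norm (x i - wmean w x))\<^sup>2) + 2 * \<alpha>\<^sup>2 * (norm (y i))\<^sup>2)"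
    by (rule sum_mono[OF 1])
  also have "\<dots> = 4 * F * (\<Sum>i\<in>UNIV. w' i * (norm (q i))\<^sup>2) + 4 * F * wvar w x + 2 * \<alpha>\<^sup>2 * (\<Sum>i\<in>UNIV. (norm (y i))\<^sup>2)"
    by (simp add: sum.distrib sum_distrib_left wvar_def mult_ac)
  also have "\<dots> \<le> 4 * F * wvar w x + 4 * F * wvar w x + 2 * \<alpha>\<^sup>2 * (\<Sum>i\<in>UNIV. (norm (y i))\<^sup>2)"
    using contr F by (intro add_mono mult_left_mono) (auto simp: q_def)
  finally show ?thesis by simp
qed

text \<open>The gradient step contracts without co-coercivity, because the step size is small against
  \<open>\<mu> / L\<^sup>2\<close>.\<close>

lemma perturbed_gradient_step:
  fixes r gF G Q :: "'a::real_inner"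
  assumes pos: "0 < \<mu>" "\<mu> \<le> L" "0 < \<eta>" "\<eta> \<le> \<eta>k" "\<eta>k \<le> 1" "0 < N" "0 < \<alpha>" "0 \<le> F"
    and \<alpha>: "13 * \<alpha> * N * L\<^sup>2 \<le> \<mu> * \<eta>"
    and sc: "\<mu> * (norm r)\<^sup>2 \<le> inner gF r" and lip: "norm gF \<le> L * norm r"
    and G: "(norm (G - N *\<^sub>R gF))\<^sup>2 \<le> L\<^sup>2 * N * F * D" and D: "0 \<le> D"
    and Q: "(norm Q)\<^sup>2 \<le> \<eta>k * S" and S: "0 \<le> S"
  shows "(norm (r - (\<alpha> * \<eta>k) *\<^sub>R G - \<alpha> *\<^sub>R Q))\<^sup>2 + 2 * \<alpha>\<^sup>2 * (norm Q)\<^sup>2 \<le>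
    (1 - N * \<mu> * \<eta> / 2 * \<alpha>) * (norm r)\<^sup>2 + 3 * L\<^sup>2 * F / \<mu> * \<alpha> * D + 3 / (N * \<mu> * \<eta>) * \<alpha> * S"
proof -
  have L: "0 < L" and \<eta>k: "0 < \<eta>k" using pos by linarith+
  define s where "s = \<alpha> * \<eta>k * N"
  have s: "0 < s" using pos \<eta>k by (simp add: s_def)
  define T where "T = r - s *\<^sub>R gF"
  define U where "U = (- \<alpha>) *\<^sub>R (\<eta>k *\<^sub>R (G - N *\<^sub>R gF) + Q)"
  have \<alpha>N: "13 * (\<alpha> * N * L\<^sup>2) \<le> \<mu>"
  proof -
    have "\<mu> * \<eta> \<le> \<mu> * 1" using pos by (intro mult_left_mono) auto
    then show ?thesis using \<alpha> by (simp add: mult.assoc)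
  qed
  have \<alpha>N\<mu>: "13 * (\<alpha> * N * \<mu>) \<le> 1"
  proof -
    have "\<mu>\<^sup>2 \<le> L\<^sup>2" using pos by (intro power_mono) auto
    then have "13 * (\<alpha> * N * \<mu>\<^sup>2) \<le> 13 * (\<alpha> * N * L\<^sup>2)" using pos by simp
    with \<alpha>N have "13 * (\<alpha> * N * \<mu>) * \<mu> \<le> 1 * \<mu>" by (simp add: power2_eq_square mult.assoc)
    then show ?thesis using pos by (simp only: mult_le_cancel_right_pos)
  qed
  have s\<mu>: "13 * (s * \<mu>) \<le> 1"
  proof -
    have "13 * (\<alpha> * N * \<mu>) * \<eta>k \<le> 1 * 1" using \<alpha>N\<mu> pos \<eta>k by (intro mult_mono) auto
    then show ?thesis by (simp add: s_def mult_ac)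
  qed
  have sL: "13 * (s * L\<^sup>2) \<le> \<mu>"
  proof -
    have "13 * (\<alpha> * N * L\<^sup>2) * \<eta>k \<le> \<mu> * 1" using \<alpha>N pos \<eta>k by (intro mult_mono) auto
    then show ?thesis by (simp add: s_def mult_ac)
  qed
  \<comment> \<open>The quadratic term is at most 1/13 of \<open>s * \<mu>\<close>, less than the
    tenth given up in passing from 2 to 19/10.\<close>
  have T: "(norm T)\<^sup>2 \<le> (1 - 19 / 10 * (s * \<mu>)) * (norm r)\<^sup>2"
  proof -
    have "(norm T)\<^sup>2 = (norm r)\<^sup>2 - 2 * s * inner gF r + s\<^sup>2 * (norm gF)\<^sup>2"
      unfolding T_def power2_norm_eq_inner
      by (simp add: inner_diff_left inner_diff_right inner_commute power2_eq_square)
    also have "\<dots> \<le> (norm r)\<^sup>2 - 2 * s * (\<mu> * (norm r)\<^sup>2) + s\<^sup>2 * (L * norm r)\<^sup>2"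
      using s sc lip by (intro add_mono diff_left_mono mult_left_mono power_mono) auto
    also have "\<dots> = (1 - 2 * (s * \<mu>) + s * (s * L\<^sup>2)) * (norm r)\<^sup>2"
      by (simp add: power_mult_distrib algebra_simps power2_eq_square)
    also have "\<dots> \<le> (1 - 19 / 10 * (s * \<mu>)) * (norm r)\<^sup>2"
    proof (rule mult_right_mono)
      have "s * (13 * (s * L\<^sup>2)) \<le> s * \<mu>" using sL s by (intro mult_left_mono) auto
      moreover have "0 < s * \<mu>" using s pos by simp
      ultimately show "1 - 2 * (s * \<mu>) + s * (s * L\<^sup>2) \<le> 1 - 19 / 10 * (s * \<mu>)" by linarith
    qed simp
    finally show ?thesis .
  qed
  have s\<mu>_pos: "0 < s * \<mu>" using s pos by simp
  have "r - (\<alpha> * \<eta>k) *\<^sub>R G - \<alpha> *\<^sub>R Q = T + U"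
    by (simp add: T_def U_def s_def algebra_simps)
  \<comment> \<open>Young's inequality with weight \<open>s * \<mu>\<close>. Of the decrease 19/10
    it leaves 9/10, more than the 1/2 required by the first diagonal entry of M.\<close>
  then have "(norm (r - (\<alpha> * \<eta>k) *\<^sub>R G - \<alpha> *\<^sub>R Q))\<^sup>2 \<le> (1 + s * \<mu>) * (norm T)\<^sup>2 + (1 + 1 / (s * \<mu>)) * (norm U)\<^sup>2"
    by (simp only: norm_add_sq_le[OF s\<mu>_pos])
  also have "(1 + s * \<mu>) * (norm T)\<^sup>2 \<le> (1 - N * \<mu> * \<eta> / 2 * \<alpha>) * (norm r)\<^sup>2"
  proof -
    have "(1 + s * \<mu>) * (norm T)\<^sup>2 \<le> (1 + s * \<mu>) * ((1 - 19 / 10 * (s * \<mu>)) * (norm r)\<^sup>2)"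
      using T s\<mu>_pos by (intro mult_left_mono) auto
    also have "\<dots> = ((1 + s * \<mu>) * (1 - 19 / 10 * (s * \<mu>))) * (norm r)\<^sup>2" by simp
    also have "\<dots> \<le> (1 - N * \<mu> * \<eta> / 2 * \<alpha>) * (norm r)\<^sup>2"
    proof (rule mult_right_mono)
      have "\<alpha> * N * \<mu> * \<eta> \<le> \<alpha> * N * \<mu> * \<eta>k" using pos by (intro mult_left_mono) auto
      then have "N * \<mu> * \<eta> / 2 * \<alpha> \<le> s * \<mu> / 2" by (simp add: s_def mult_ac)
      moreover have "(1 + s * \<mu>) * (1 - 19 / 10 * (s * \<mu>)) = 1 - 9 / 10 * (s * \<mu>) - 19 / 10 * (s * \<mu>)\<^sup>2"
        by (simp add: field_simps power2_eq_square)
      moreover have "0 \<le> (s * \<mu>)\<^sup>2" by simp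
      ultimately show "(1 + s * \<mu>) * (1 - 19 / 10 * (s * \<mu>)) \<le> 1 - N * \<mu> * \<eta> / 2 * \<alpha>"
        using s\<mu>_pos by linarith
    qed simp
    finally show ?thesis .
  qed
  also have "(1 + 1 / (s * \<mu>)) * (norm U)\<^sup>2 \<le>
      3 * L\<^sup>2 * F / \<mu> * \<alpha> * D + (3 / (N * \<mu>) * \<alpha> * S - 2 * \<alpha>\<^sup>2 * (norm Q)\<^sup>2)"
  proof -
    have U: "(norm U)\<^sup>2 \<le> 2 * \<alpha>\<^sup>2 * (\<eta>k * (L\<^sup>2 * N * F * D) + \<eta>k * S)"
    proof -
      have "(norm U)\<^sup>2 \<le> \<alpha>\<^sup>2 * (2 * (norm (\<eta>k *\<^sub>R (G - N *\<^sub>R gF)))\<^sup>2 + 2 * (norm Q)\<^sup>2)"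
        unfolding U_def norm_scaleR power_mult_distrib
        using norm_add_sq_le_2[of "\<eta>k *\<^sub>R (G - N *\<^sub>R gF)" Q]
        by (simp add: power_mult_distrib mult_left_mono)
      also have "\<dots> \<le> \<alpha>\<^sup>2 * (2 * (\<eta>k * (L\<^sup>2 * N * F * D)) + 2 * (\<eta>k * S))"
      proof (intro mult_left_mono add_mono Q)
        have "(norm (\<eta>k *\<^sub>R (G - N *\<^sub>R gF)))\<^sup>2 = \<eta>k * (\<eta>k * (norm (G - N *\<^sub>R gF))\<^sup>2)"
          by (simp add: power_mult_distrib power2_eq_square)
        also have "\<dots> \<le> \<eta>k * (1 * (L\<^sup>2 * N * F * D))"
          using pos \<eta>k G D by (intro mult_left_mono mult_mono) auto
        finally show "(norm (\<eta>k *\<^sub>R (G - N *\<^sub>R gF)))\<^sup>2 \<le> \<eta>k * (L\<^sup>2 * N * F * D)" by simp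
      qed simp_all
      finally show ?thesis by (simp add: algebra_simps)
    qed
    \<comment> \<open>From \<open>13 * (s * \<mu>) \<le> 1\<close>. Doubled by the splitting of
      \<open>U\<close> the constant becomes 28/13, and the rest up to the coefficient 3 covers the
      extra term in \<open>Q\<close>, which costs 2/13.\<close>
    have "1 + 1 / (s * \<mu>) \<le> 14 / 13 / (s * \<mu>)"
      using s\<mu> s\<mu>_pos by (simp add: field_simps)
    then have "(1 + 1 / (s * \<mu>)) * (norm U)\<^sup>2 \<le> 14 / 13 / (s * \<mu>) * (2 * \<alpha>\<^sup>2 * (\<eta>k * (L\<^sup>2 * N * F * D) + \<eta>k * S))"
      using U s\<mu>_pos by (intro mult_mono) auto
    also have "\<dots> = 28 / 13 * (L\<^sup>2 * F / \<mu> * \<alpha> * D) + 28 / 13 * (\<alpha> * S / (N * \<mu>))"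
      using pos \<eta>k by (simp add: s_def field_simps power2_eq_square)
    also have "\<dots> \<le> 3 * (L\<^sup>2 * F / \<mu> * \<alpha> * D) + (3 * (\<alpha> * S / (N * \<mu>)) - 2 * \<alpha>\<^sup>2 * (norm Q)\<^sup>2)"
    proof -
      have "(norm Q)\<^sup>2 \<le> 1 * S" using Q pos S mult_right_mono[of \<eta>k 1 S] by linarith
      then have "\<alpha>\<^sup>2 * (norm Q)\<^sup>2 \<le> \<alpha>\<^sup>2 * S" by (intro mult_left_mono) auto
      also have "\<alpha>\<^sup>2 * S = (\<alpha> * N * \<mu>) * (\<alpha> * S / (N * \<mu>))"
        using pos by (simp add: field_simps power2_eq_square)
      also have "\<dots> \<le> 1 / 13 * (\<alpha> * S / (N * \<mu>))"
        using \<alpha>N\<mu> pos S by (intro mult_right_mono) auto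
      finally have "\<alpha>\<^sup>2 * (norm Q)\<^sup>2 \<le> 1 / 13 * (\<alpha> * S / (N * \<mu>))" .
      moreover have "0 \<le> \<alpha> * S / (N * \<mu>)" "0 \<le> L\<^sup>2 * F / \<mu> * \<alpha> * D" using pos S D by auto
      moreover have "28 / 13 * A + 28 / 13 * B \<le> 3 * A + (3 * B - 2 * C)"
        if "C \<le> 1 / 13 * B" "0 \<le> B" "0 \<le> A" for A B C :: real
        using that by linarith
      ultimately show ?thesis by (simp only: mult.assoc[of 2])
    qed
    finally show ?thesis by simp
  qed
  also have "3 / (N * \<mu>) * \<alpha> * S \<le> 3 / (N * \<mu> * \<eta>) * \<alpha> * S"
    using pos S by (intro mult_right_mono divide_left_mono) (auto simp: mult_left_le)
  finally show ?thesis by simp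
qed

section \<open>Square-integrable and independent random vectors\<close>

context prob_space
begin

text \<open>The sigma-algebra generated by the \<open>X j\<close> with \<open>j\<close> in
  \<open>J\<close>, as a measure space so that measurability can be stated for it. The generators
  have the shape in which independence of random variables is expressed.\<close>

definition sigma_of :: "('i \<Rightarrow> 'a \<Rightarrow> 'b::topological_space) \<Rightarrow> 'i set \<Rightarrow> 'a measure" where
  "sigma_of X J = sigma (space M) (\<Union>j\<in>J. {X j -` A \<inter> space M | A. A \<in> sets borel})"

lemma space_sigma_of [simp]: "space (sigma_of X J) = space M"
  by (simp add: sigma_of_def space_measure_of_conv)

lemma sets_sigma_of: "sets (sigma_of X J) = sigma_sets (space M) (\<Union>j\<in>J. {X j -` A \<inter> space M | A. A \<in> sets borel})"
  unfolding sigma_of_def by (rule sets_measure_of) auto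

lemma measurable_sigma_of_mono:
  assumes "f \<in> measurable (sigma_of X J) N" "J \<subseteq> J'"
  shows "f \<in> measurable (sigma_of X J') N"
proof -
  have "sets (sigma_of X J) \<subseteq> sets (sigma_of X J')"
    unfolding sets_sigma_of using assms(2) by (intro sigma_sets_mono') blast
  then show ?thesis using assms(1) by (auto simp: measurable_def)
qed

lemma measurable_sigma_of_self: "j \<in> J \<Longrightarrow> X j \<in> borel_measurable (sigma_of X J)"
  unfolding measurable_def sets_sigma_of by (auto intro!: sigma_sets.Basic)

lemma measurable_sigma_of_imp:
  assumes "\<And>j. random_variable borel (X j)" "f \<in> measurable (sigma_of X J) N"
  shows "f \<in> measurable M N"
proof -
  have "sets (sigma_of X J) \<subseteq> events"
    unfolding sets_sigma_of using assms(1) by (intro sets.sigma_sets_subset) (auto intro: measurable_sets)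
  then show ?thesis using assms(2) by (auto simp: measurable_def)
qed

text \<open>Preimages under one variable are stable under intersection, so independence passes to
  the sigma-algebras of two disjoint blocks of indices, here labelled by booleans, and to whatever
  is measurable in them.\<close>

lemma indep_var_sigma_of:
  assumes ind: "indep_vars (\<lambda>_. borel) X UNIV" and disj: "J \<inter> J' = {}"
    and Z: "Z \<in> measurable (sigma_of X J) N" and Y: "Y \<in> measurable (sigma_of X J') N'"
  shows "indep_var N Z N' Y"
proof -
  let ?E = "\<lambda>i. {X i -` A \<inter> space M | A. A \<in> sets borel}"
  have rv: "\<And>i. random_variable borel (X i)" and E: "indep_sets ?E UNIV"
    using ind unfolding indep_vars_def2 by auto
  have sub: "sigma_sets (space M) {W -` A \<inter> space M | A. A \<in> sets K} \<subseteq> sets (sigma_of X I)"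
    if "W \<in> measurable (sigma_of X I) K" for W I and K :: "'d measure"
    using measurable_sets[OF that] by (intro sets.sigma_sets_subset[of _ "sigma_of X I", simplified]) auto
  have "indep_sets (\<lambda>b. sigma_sets (space M) (\<Union>i\<in>case_bool J J' b. ?E i)) UNIV"
  proof (rule indep_sets_collect_sigma)
    show "indep_sets ?E (\<Union>b\<in>UNIV. case_bool J J' b)"
      by (rule indep_sets_mono_index[OF _ E]) simp
    show "Int_stable (?E i)" for i
      unfolding Int_stable_def by (safe, rule_tac x="A \<inter> Aa" in exI) auto
    show "disjoint_family_on (case_bool J J') UNIV"
      using disj by (auto simp: disjoint_family_on_def split: bool.splits)
  qed
  then have "indep_set (sigma_sets (space M) {Z -` A \<inter> space M | A. A \<in> sets N})
      (sigma_sets (space M) {Y -` A \<inter> space M | A. A \<in> sets N'})"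
    unfolding indep_set_def
  proof (rule indep_sets_mono_sets)
    fix b :: bool
    show "case_bool (sigma_sets (space M) {Z -` A \<inter> space M | A. A \<in> sets N})
          (sigma_sets (space M) {Y -` A \<inter> space M | A. A \<in> sets N'}) b
        \<subseteq> sigma_sets (space M) (\<Union>i\<in>case_bool J J' b. ?E i)"
      using sub[OF Z] sub[OF Y] by (cases b) (simp_all add: sets_sigma_of)
  qed
  then show ?thesis
    unfolding indep_var_eq using measurable_sigma_of_imp[OF rv Z] measurable_sigma_of_imp[OF rv Y] by blast
qed

text \<open>The freezing lemma: the joint law is a product, so Fubini averages over \<open>Y\<close>
  with \<open>Z\<close> held fixed. Joint integrability is part of the claim and comes from the
  bound \<open>C\<close> on the inner absolute moments.\<close>

lemma expectation_indep_iterated: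
  fixes h :: "'b::second_countable_topology \<Rightarrow> 'b \<Rightarrow> real"
  assumes ind: "indep_var borel Z borel Y"
    and h: "case_prod h \<in> borel_measurable borel"
    and int: "\<And>z. integrable M (\<lambda>\<omega>. h z (Y \<omega>))"
    and bound: "\<And>z. expectation (\<lambda>\<omega>. \<bar>h z (Y \<omega>)\<bar>) \<le> C z"
    and C: "integrable M (\<lambda>\<omega>. C (Z \<omega>))"
  shows "integrable M (\<lambda>\<omega>. h (Z \<omega>) (Y \<omega>))"
    and "expectation (\<lambda>\<omega>. h (Z \<omega>) (Y \<omega>)) = expectation (\<lambda>\<omega>. expectation (\<lambda>\<omega>'. h (Z \<omega>) (Y \<omega>')))"
proof -
  have Z[measurable]: "random_variable borel Z" and Y[measurable]: "random_variable borel Y"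
    and D: "distr M borel Z \<Otimes>\<^sub>M distr M borel Y = distr M (borel \<Otimes>\<^sub>M borel) (\<lambda>\<omega>. (Z \<omega>, Y \<omega>))"
    using ind unfolding indep_var_distribution_eq by auto
  interpret D1: prob_space "distr M borel Z" by (rule prob_space_distr) simp
  interpret D2: prob_space "distr M borel Y" by (rule prob_space_distr) simp
  interpret P: pair_sigma_finite "distr M borel Z" "distr M borel Y" ..
  have hm[measurable]: "case_prod h \<in> borel_measurable (borel \<Otimes>\<^sub>M borel)" using h by (simp add: borel_prod)
  have hz[measurable]: "(\<lambda>y. h z y) \<in> borel_measurable borel" for z
    using measurable_compose[OF _ hm, of "\<lambda>y. (z, y)" borel] by simp
  have hY: "case_prod (\<lambda>z \<omega>. h z (Y \<omega>)) \<in> borel_measurable (borel \<Otimes>\<^sub>M M)" by measurable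
  have meas_abs: "(\<lambda>z. expectation (\<lambda>\<omega>. \<bar>h z (Y \<omega>)\<bar>)) \<in> borel_measurable borel"
    using hY by (intro borel_measurable_lebesgue_integral) measurable
  have meas: "(\<lambda>z. expectation (\<lambda>\<omega>. h z (Y \<omega>))) \<in> borel_measurable borel"
    using hY by (intro borel_measurable_lebesgue_integral) measurable
  have H: "(\<integral>y. norm (case_prod h (z, y)) \<partial>distr M borel Y) = expectation (\<lambda>\<omega>. \<bar>h z (Y \<omega>)\<bar>)" for z
    by (subst integral_distr) simp_all
  have intg: "integrable (distr M borel Z \<Otimes>\<^sub>M distr M borel Y) (case_prod h)"
  proof (rule P.Fubini_integrable)
    show "integrable (distr M borel Z) (\<lambda>z. \<integral>y. norm (case_prod h (z, y)) \<partial>distr M borel Y)"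
      unfolding H
    proof (subst integrable_distr_eq)
      show "integrable M (\<lambda>\<omega>. expectation (\<lambda>\<omega>'. \<bar>h (Z \<omega>) (Y \<omega>')\<bar>))"
      proof (rule Bochner_Integration.integrable_bound[OF C])
        show "(\<lambda>\<omega>. expectation (\<lambda>\<omega>'. \<bar>h (Z \<omega>) (Y \<omega>')\<bar>)) \<in> borel_measurable M"
          using measurable_compose[OF Z meas_abs] .
        have "0 \<le> expectation (\<lambda>\<omega>'. \<bar>h z (Y \<omega>')\<bar>)" for z by (rule integral_nonneg_AE) simp
        then have "norm (expectation (\<lambda>\<omega>'. \<bar>h z (Y \<omega>')\<bar>)) \<le> norm (C z)" for z
          using order_trans[OF bound[of z] abs_ge_self] by simp
        then show "AE \<omega> in M. norm (expectation (\<lambda>\<omega>'. \<bar>h (Z \<omega>) (Y \<omega>')\<bar>)) \<le> norm (C (Z \<omega>))"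
          by simp
      qed
    qed (use meas_abs in simp_all)
    show "AE z in distr M borel Z. integrable (distr M borel Y) (\<lambda>y. case_prod h (z, y))"
      by (intro AE_I2) (simp add: integrable_distr_eq int)
  qed simp
  then show "integrable M (\<lambda>\<omega>. h (Z \<omega>) (Y \<omega>))"
    unfolding D by (subst (asm) integrable_distr_eq) simp_all
  have "expectation (\<lambda>\<omega>. h (Z \<omega>) (Y \<omega>)) = integral\<^sup>L (distr M borel Z \<Otimes>\<^sub>M distr M borel Y) (case_prod h)"
    unfolding D by (subst integral_distr) simp_all
  also have "\<dots> = (\<integral>z. (\<integral>y. case_prod h (z, y) \<partial>distr M borel Y) \<partial>distr M borel Z)"
    by (rule P.integral_fst'[OF intg, symmetric])
  also have "\<dots> = (\<integral>z. expectation (\<lambda>\<omega>'. h z (Y \<omega>')) \<partial>distr M borel Z)"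
    by (intro Bochner_Integration.integral_cong refl) (subst integral_distr, simp_all)
  also have "\<dots> = expectation (\<lambda>\<omega>. expectation (\<lambda>\<omega>'. h (Z \<omega>) (Y \<omega>')))"
    by (subst integral_distr) (use meas in simp_all)
  finally show "expectation (\<lambda>\<omega>. h (Z \<omega>) (Y \<omega>)) = expectation (\<lambda>\<omega>. expectation (\<lambda>\<omega>'. h (Z \<omega>) (Y \<omega>')))" .
qed

text \<open>The case of interest: \<open>Z\<close> is built from the samples indexed by
  \<open>J\<close>, and the sample \<open>k\<close> outside \<open>J\<close> is fresh.\<close>

lemma expectation_indep_sigma_of:
  fixes h :: "'b::second_countable_topology \<Rightarrow> 'c::second_countable_topology \<Rightarrow> real"
  assumes ind: "indep_vars (\<lambda>_. borel) X UNIV" and k: "k \<notin> J"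
    and Z: "Z \<in> borel_measurable (sigma_of X J)"
    and h: "case_prod h \<in> borel_measurable borel"
    and int: "\<And>z. integrable M (\<lambda>\<omega>. h z (X k \<omega>))"
    and bound: "\<And>z. expectation (\<lambda>\<omega>. \<bar>h z (X k \<omega>)\<bar>) \<le> C z"
    and C: "integrable M (\<lambda>\<omega>. C (Z \<omega>))"
  shows "integrable M (\<lambda>\<omega>. h (Z \<omega>) (X k \<omega>))"
    and "expectation (\<lambda>\<omega>. h (Z \<omega>) (X k \<omega>)) = expectation (\<lambda>\<omega>. expectation (\<lambda>\<omega>'. h (Z \<omega>) (X k \<omega>')))"
proof -
  \<comment> \<open>\<open>indep_var\<close> needs two variables of the same type, so both are padded to pairs\<close>
  let ?Z = "\<lambda>\<omega>. (Z \<omega>, undefined :: 'c)" and ?Y = "\<lambda>\<omega>. (undefined :: 'b, X k \<omega>)"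
  have "?Z \<in> borel_measurable (sigma_of X J)"
    unfolding borel_prod[symmetric] using Z by measurable
  moreover have "?Y \<in> borel_measurable (sigma_of X {k})"
    unfolding borel_prod[symmetric] using measurable_sigma_of_self[of k "{k}" X] by measurable
  ultimately have ind': "indep_var borel ?Z borel ?Y"
    using k by (intro indep_var_sigma_of[OF ind, of J "{k}"]) auto
  have h': "(\<lambda>(p :: 'b \<times> 'c, q :: 'b \<times> 'c). h (fst p) (snd q)) \<in> borel_measurable borel"
  proof -
    have "(\<lambda>x :: ('b \<times> 'c) \<times> ('b \<times> 'c). (fst (fst x), snd (snd x))) \<in> borel_measurable borel"
      by (intro borel_measurable_continuous_onI continuous_intros)
    from measurable_compose[OF this h] show ?thesis by (simp add: case_prod_beta')
  qed
  show "integrable M (\<lambda>\<omega>. h (Z \<omega>) (X k \<omega>))"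
    and "expectation (\<lambda>\<omega>. h (Z \<omega>) (X k \<omega>)) = expectation (\<lambda>\<omega>. expectation (\<lambda>\<omega>'. h (Z \<omega>) (X k \<omega>')))"
    using expectation_indep_iterated[OF ind', of "\<lambda>p q. h (fst p) (snd q)" "\<lambda>p. C (fst p)"] h' int bound C
    by simp_all
qed

definition sq_integrable :: "('a \<Rightarrow> 'b::euclidean_space) \<Rightarrow> bool" where
  "sq_integrable Z \<longleftrightarrow> Z \<in> borel_measurable M \<and> integrable M (\<lambda>\<omega>. (norm (Z \<omega>))\<^sup>2)"

lemma sq_integrable_measurable: "sq_integrable Z \<Longrightarrow> Z \<in> borel_measurable M"
  by (simp add: sq_integrable_def)

lemma sq_integrable_norm_sq: "sq_integrable Z \<Longrightarrow> integrable M (\<lambda>\<omega>. (norm (Z \<omega>))\<^sup>2)"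
  by (simp add: sq_integrable_def)

lemma sq_integrable_bound:
  assumes "Z \<in> borel_measurable M" "integrable M b" "\<And>\<omega>. \<omega> \<in> space M \<Longrightarrow> (norm (Z \<omega>))\<^sup>2 \<le> b \<omega>"
  shows "sq_integrable Z"
  unfolding sq_integrable_def
proof (intro conjI assms(1))
  have [measurable]: "Z \<in> borel_measurable M" by fact
  show "integrable M (\<lambda>\<omega>. (norm (Z \<omega>))\<^sup>2)"
    using assms(3) by (intro Bochner_Integration.integrable_bound[OF assms(2)])
      (auto intro!: AE_I2 intro: order_trans[OF _ abs_ge_self])
qed

lemma sq_integrable_const: "sq_integrable (\<lambda>_. v)"
  by (simp add: sq_integrable_def)

lemma sq_integrable_add:
  assumes "sq_integrable U" "sq_integrable V"
  shows "sq_integrable (\<lambda>\<omega>. U \<omega> + V \<omega>)"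
proof (rule sq_integrable_bound)
  show "integrable M (\<lambda>\<omega>. 2 * (norm (U \<omega>))\<^sup>2 + 2 * (norm (V \<omega>))\<^sup>2)"
    using assms by (simp add: sq_integrable_def)
  have [measurable]: "U \<in> borel_measurable M" "V \<in> borel_measurable M"
    using assms by (simp_all add: sq_integrable_def)
  show "(\<lambda>\<omega>. U \<omega> + V \<omega>) \<in> borel_measurable M" by measurable
  show "(norm (U \<omega> + V \<omega>))\<^sup>2 \<le> 2 * (norm (U \<omega>))\<^sup>2 + 2 * (norm (V \<omega>))\<^sup>2" for \<omega>
    by (rule norm_add_sq_le_2)
qed

lemma sq_integrable_scaleR:
  assumes "sq_integrable U"
  shows "sq_integrable (\<lambda>\<omega>. s *\<^sub>R U \<omega>)"
  using assms by (auto simp: sq_integrable_def power_mult_distrib)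

lemma sq_integrable_diff:
  assumes "sq_integrable U" "sq_integrable V"
  shows "sq_integrable (\<lambda>\<omega>. U \<omega> - V \<omega>)"
  using sq_integrable_add[OF assms(1) sq_integrable_scaleR[OF assms(2), of "-1"]] by simp

lemma sq_integrable_sum:
  assumes "finite I" "\<And>i. i \<in> I \<Longrightarrow> sq_integrable (U i)"
  shows "sq_integrable (\<lambda>\<omega>. \<Sum>i\<in>I. U i \<omega>)"
  using assms by (induction I rule: finite_induct) (simp_all add: sq_integrable_const sq_integrable_add)

lemma sq_integrable_inner:
  assumes "sq_integrable U" "sq_integrable V"
  shows "integrable M (\<lambda>\<omega>. inner (U \<omega>) (V \<omega>))"
proof (rule Bochner_Integration.integrable_bound)
  have [measurable]: "U \<in> borel_measurable M" "V \<in> borel_measurable M"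
    using assms by (simp_all add: sq_integrable_def)
  show "integrable M (\<lambda>\<omega>. (norm (U \<omega>))\<^sup>2 + (norm (V \<omega>))\<^sup>2)"
    using assms by (simp add: sq_integrable_def)
  show "(\<lambda>\<omega>. inner (U \<omega>) (V \<omega>)) \<in> borel_measurable M" by measurable
  have "\<bar>inner u v\<bar> \<le> (norm u)\<^sup>2 + (norm v)\<^sup>2" for u v :: 'b
  proof -
    have "\<bar>inner u v\<bar> \<le> norm u * norm v" by (rule Cauchy_Schwarz_ineq2)
    also have "\<dots> \<le> (norm u)\<^sup>2 + (norm v)\<^sup>2"
    proof -
      have "0 \<le> norm u * norm v" by simp
      then show ?thesis using sum_squares_bound[of "norm u" "norm v"] by linarith
    qed
    finally show ?thesis .
  qed
  then show "AE \<omega> in M. norm (inner (U \<omega>) (V \<omega>)) \<le> norm ((norm (U \<omega>))\<^sup>2 + (norm (V \<omega>))\<^sup>2)"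
    by simp
qed

lemma sq_integrable_cong:
  assumes "sq_integrable V" "\<And>\<omega>. \<omega> \<in> space M \<Longrightarrow> U \<omega> = V \<omega>"
  shows "sq_integrable U"
proof -
  have "U \<in> borel_measurable M \<longleftrightarrow> V \<in> borel_measurable M"
    by (rule measurable_cong[OF assms(2)])
  moreover have "integrable M (\<lambda>\<omega>. (norm (U \<omega>))\<^sup>2) \<longleftrightarrow> integrable M (\<lambda>\<omega>. (norm (V \<omega>))\<^sup>2)"
    by (rule Bochner_Integration.integrable_cong) (simp_all add: assms(2))
  ultimately show ?thesis using assms(1) by (simp add: sq_integrable_def)
qed

lemma disp_integrable:
  fixes u :: "'n::finite \<Rightarrow> 'a \<Rightarrow> 'b::euclidean_space"
  assumes "\<And>i. sq_integrable (u i)"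
  shows "integrable M (\<lambda>\<omega>. disp q (\<lambda>i. u i \<omega>))"
  unfolding disp_def
  by (intro Bochner_Integration.integrable_sum integrable_mult_right sq_integrable_norm_sq sq_integrable_diff
      sq_integrable_scaleR sq_integrable_sum assms) simp

lemma disp_form_integrable:
  fixes u v :: "'n::finite \<Rightarrow> 'a \<Rightarrow> 'b::euclidean_space"
  assumes "\<And>i. sq_integrable (u i)" "\<And>i. sq_integrable (v i)"
  shows "integrable M (\<lambda>\<omega>. disp_form q (\<lambda>i. u i \<omega>) (\<lambda>i. v i \<omega>))"
  unfolding disp_form_def
  by (intro Bochner_Integration.integrable_diff Bochner_Integration.integrable_sum integrable_mult_right sq_integrable_inner
      sq_integrable_sum assms) simp_all

end

section \<open>Stochastic gradient tracking\<close>

lemma vmin_le: "vmin u \<le> u $ i" and vmax_ge: "u $ i \<le> vmax u" for u :: "real^'n::finite"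
  by (simp_all add: vmin_def vmax_def)

lemma vmin_pos:
  fixes u :: "real^'n::finite"
  assumes "\<And>i. 0 < u $ i"
  shows "0 < vmin u"
  using assms by (simp add: vmin_def)

lemma inv_min_sqrt_sq:
  fixes u :: "real^'n::finite"
  assumes "\<And>i. 0 < u $ i"
  shows "(inv_min_sqrt u)\<^sup>2 = 1 / vmin u" "0 \<le> inv_min_sqrt u"
  using vmin_pos[OF assms] by (simp_all add: inv_min_sqrt_def)

lemma one_div_le_vmin:
  fixes u :: "real^'n::finite"
  assumes "\<And>i. 0 < u $ i"
  shows "1 / u $ i \<le> 1 / vmin u"
  using vmin_pos[OF assms] vmin_le[of u i] by (intro divide_left_mono) auto

locale gradient_tracking = prob_space Pr
  for Pr :: "'w measure" +
  fixes n :: nat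
    and f :: "'n::finite \<Rightarrow> real^'p \<Rightarrow> real"
    and gradf :: "'n \<Rightarrow> real^'p \<Rightarrow> real^'p"
    and gradF :: "real^'p \<Rightarrow> real^'p"
    and xstar :: "real^'p"
    and L \<mu> \<sigma> a b \<alpha> c \<tau> \<psi> \<kappa> vphi \<eta> :: real
    and E :: "nat \<Rightarrow> ('n \<times> 'n) set"
    and A B :: "nat \<Rightarrow> real^'n^'n"
    and \<xi> :: "nat \<Rightarrow> 'n \<Rightarrow> 'w \<Rightarrow> real^'m"
    and g :: "'n \<Rightarrow> real^'p \<Rightarrow> real^'m \<Rightarrow> real^'p"
    and x y :: "nat \<Rightarrow> 'w \<Rightarrow> real^'p^'n"
    and x0 :: "real^'p^'n"
    and \<phi> \<pi> :: "nat \<Rightarrow> real^'n"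
  assumes n_def: "n = CARD('n)"
    and L_pos: "L > 0" and mu_pos: "\<mu> > 0"
    and gradf: "\<And>i z. GDERIV (f i) z :> gradf i z"
    and gradf_cont: "\<And>i. continuous_on UNIV (gradf i)"
    and gradf_lip: "\<And>i u v. norm (gradf i u - gradf i v) \<le> L * norm (u - v)"
    and gradF: "\<And>z. GDERIV (\<lambda>z. (1 / real n) * (\<Sum>i\<in>UNIV. f i z)) z :> gradF z"
    and strongly_convex: "\<And>u v. inner (gradF u - gradF v) (u - v) \<ge> \<mu> * (norm (u - v))\<^sup>2"
    and xstar: "\<And>z. z \<noteq> xstar \<Longrightarrow>
          (1 / real n) * (\<Sum>i\<in>UNIV. f i xstar) < (1 / real n) * (\<Sum>i\<in>UNIV. f i z)"
    and connected: "\<And>k. strongly_connected (net (E k))"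
    and self_loops: "\<And>k i. (i, i) \<in> E k"
    and A_pos: "\<And>k i j. (j, i) \<in> E k \<or> j = i \<Longrightarrow> A k $ i $ j > 0"
    and A_zero: "\<And>k i j. \<not> ((j, i) \<in> E k \<or> j = i) \<Longrightarrow> A k $ i $ j = 0"
    and B_pos: "\<And>k i j. (j, i) \<in> E k \<or> j = i \<Longrightarrow> B k $ i $ j > 0"
    and B_zero: "\<And>k i j. \<not> ((j, i) \<in> E k \<or> j = i) \<Longrightarrow> B k $ i $ j = 0"
    and A_stochastic: "\<And>k. A k *v 1 = 1"
    and B_stochastic: "\<And>k. 1 v* B k = 1"
    and a_pos: "a > 0" and b_pos: "b > 0"
    and A_ge: "\<And>k i j. A k $ i $ j > 0 \<Longrightarrow> A k $ i $ j \<ge> a"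
    and B_ge: "\<And>k i j. B k $ i $ j > 0 \<Longrightarrow> B k $ i $ j \<ge> b"
    and indep: "indep_vars (\<lambda>_. borel) (\<lambda>(k, i). \<xi> k i) UNIV"
    and g_meas: "\<And>i. (\<lambda>(z, s). g i z s) \<in> borel_measurable borel"
    and g_mean: "\<And>k i z. has_bochner_integral Pr (\<lambda>\<omega>. g i z (\<xi> k i \<omega>)) (gradf i z)"
    and g_var_integrable: "\<And>k i z. integrable Pr (\<lambda>\<omega>. (norm (g i z (\<xi> k i \<omega>) - gradf i z))\<^sup>2)"
    and g_var: "\<And>k i z. expectation (\<lambda>\<omega>. (norm (g i z (\<xi> k i \<omega>) - gradf i z))\<^sup>2) \<le> \<sigma>\<^sup>2"
    and x_init: "\<And>\<omega>. \<omega> \<in> space Pr \<Longrightarrow> x 0 \<omega> = x0"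
    and y_init: "\<And>i \<omega>. \<omega> \<in> space Pr \<Longrightarrow> y 0 \<omega> $ i = g i (x 0 \<omega> $ i) (\<xi> 0 i \<omega>)"
    and x_step: "\<And>k i \<omega>. \<omega> \<in> space Pr \<Longrightarrow>
          x (Suc k) \<omega> $ i = (\<Sum>j\<in>UNIV. A k $ i $ j *\<^sub>R x k \<omega> $ j) - \<alpha> *\<^sub>R y k \<omega> $ i"
    and y_step: "\<And>k i \<omega>. \<omega> \<in> space Pr \<Longrightarrow>
          y (Suc k) \<omega> $ i = (\<Sum>j\<in>UNIV. B k $ i $ j *\<^sub>R y k \<omega> $ j)
            + g i (x (Suc k) \<omega> $ i) (\<xi> (Suc k) i \<omega>) - g i (x k \<omega> $ i) (\<xi> k i \<omega>)"
    and phi_pos: "\<And>k i. \<phi> k $ i > 0"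
    and phi_sum: "\<And>k. (\<Sum>i\<in>UNIV. \<phi> k $ i) = 1"
    and phi_step: "\<And>k. \<phi> (Suc k) v* A k = \<phi> k"
    and pi_init: "\<pi> 0 = (\<chi> i. 1 / real n)"
    and pi_step: "\<And>k. \<pi> (Suc k) = B k *v \<pi> k"
    and c_range: "0 < c" "c < 1"
    and c_bound: "\<And>k. c_factor a (net (E k)) (\<phi> k) (\<phi> (Suc k)) \<le> c"
    and tau_range: "0 < \<tau>" "\<tau> < 1"
    and tau_bound: "\<And>k. tau_factor b (net (E k)) (\<pi> k) (\<pi> (Suc k)) \<le> \<tau>"
    and psi_pos: "\<psi> > 0"
    and psi_bound: "\<And>k. real n * ((inv_min_sqrt (\<pi> (Suc k)))\<^sup>2 - 1) \<le> \<psi>"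
    and kappa_gt_1: "\<kappa> > 1"
    and kappa_bound: "\<And>k. inv_min_sqrt (\<pi> k) \<le> \<kappa>"
    and vphi_gt_1: "vphi > 1"
    and vphi_bound: "\<And>k. inv_min_sqrt (\<phi> k) \<le> vphi"
    and eta_range: "0 < \<eta>" "\<eta> < 1"
    and eta_bound: "\<And>k. \<eta> \<le> inner (\<phi> (Suc k)) (\<pi> k)"
    and psi_le: "\<psi> \<le> real n * (\<kappa>\<^sup>2 - 1)"
    and alpha_pos: "\<alpha> > 0"
    and alpha_le: "\<alpha> \<le> Min
          {2 / (real n * \<eta> * (L + \<mu>)),
           \<mu> * \<eta> * (1 - c\<^sup>2) * (1 - \<tau>\<^sup>2) /
             (4 * L * vphi * sqrt ((real n * \<mu>\<^sup>2 * \<eta>\<^sup>2 + 24 * L\<^sup>2 * vphi\<^sup>2) * (\<eta> + 16 * \<kappa>\<^sup>2))),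
           \<mu> * \<eta> * (1 - \<tau>\<^sup>2) /
             (\<kappa> * L * sqrt (2 * real n * \<mu>\<^sup>2 * \<eta>\<^sup>2 * (real n + 4)
                + 6 * L\<^sup>2 * vphi\<^sup>2 * (real n * \<eta> + 32)))}"
begin

section \<open>Consequences for the weights, the constants and the gradients\<close>

lemma n_le_one_div_vmin:
  fixes u :: "real^'n"
  assumes pos: "\<And>i. 0 < u $ i" and sum: "(\<Sum>i\<in>UNIV. u $ i) = 1"
  shows "real n \<le> 1 / vmin u"
proof -
  have "real n * vmin u = (\<Sum>i\<in>(UNIV :: 'n set). vmin u)" by (simp add: n_def)
  also have "\<dots> \<le> 1" unfolding sum[symmetric] by (intro sum_mono vmin_le)
  finally show ?thesis using vmin_pos[OF pos] by (simp add: field_simps)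
qed

text \<open>For a single agent the edge utility is 0, the quotient inside \<open>c_factor\<close> is
  a division by 0 with value 0, and the factor would be 1, against \<open>c < 1\<close>.\<close>

lemma n_ge_2: "2 \<le> n"
proof (rule ccontr)
  assume "\<not> 2 \<le> n"
  moreover have "0 < CARD('n)" by simp
  ultimately have "CARD('n) = 1" using n_def by linarith
  with max_edge_utility_net_singleton[OF connected, of 0] self_loops
  have "max_edge_utility (net (E 0)) = 0" by blast
  then have "c_factor a (net (E 0)) (\<phi> 0) (\<phi> (Suc 0)) = 1" by (simp add: c_factor_def)
  then show False using c_bound[of 0] c_range by simp
qed

lemma A_nonneg: "0 \<le> A k $ i $ j"
  using A_pos[of j i k] A_zero[of j i k] by (cases "(j, i) \<in> E k \<or> j = i") auto

lemma B_nonneg: "0 \<le> B k $ i $ j"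
  using B_pos[of j i k] B_zero[of j i k] by (cases "(j, i) \<in> E k \<or> j = i") auto

lemma A_row: "(\<Sum>j\<in>UNIV. A k $ i $ j) = 1"
  using arg_cong[OF A_stochastic[of k], of "\<lambda>v. v $ i"] by (simp add: matrix_vector_mult_def)

lemma B_col: "(\<Sum>i\<in>UNIV. B k $ i $ j) = 1"
  using arg_cong[OF B_stochastic[of k], of "\<lambda>v. v $ j"] by (simp add: vector_matrix_mult_def)

lemma phi_A: "(\<Sum>i\<in>UNIV. \<phi> (Suc k) $ i * A k $ i $ j) = \<phi> k $ j"
  using arg_cong[OF phi_step[of k], of "\<lambda>v. v $ j"] by (simp add: vector_matrix_mult_def)

lemma pi_Suc: "\<pi> (Suc k) $ i = (\<Sum>j\<in>UNIV. B k $ i $ j * \<pi> k $ j)"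
  using pi_step[of k] by (simp add: matrix_vector_mult_def)

lemma pi_pos: "0 < \<pi> k $ i"
proof (induction k arbitrary: i)
  case 0
  show ?case using n_ge_2 by (simp add: pi_init)
next
  case (Suc k)
  show ?case
    unfolding pi_Suc
    by (rule sum_pos2[of _ i])
      (simp_all add: B_nonneg B_pos Suc.IH less_imp_le[OF Suc.IH] mult_nonneg_nonneg)
qed

lemma pi_sum: "(\<Sum>i\<in>UNIV. \<pi> k $ i) = 1"
proof (induction k)
  case 0
  show ?case using n_ge_2 by (simp add: pi_init n_def)
next
  case (Suc k)
  have "(\<Sum>i\<in>UNIV. \<pi> (Suc k) $ i) = (\<Sum>j\<in>UNIV. (\<Sum>i\<in>UNIV. B k $ i $ j) * \<pi> k $ j)"
    unfolding pi_Suc sum_distrib_right by (rule sum.swap)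
  then show ?case using Suc by (simp add: B_col)
qed

lemma phi_le_1: "\<phi> k $ i \<le> 1"
  using member_le_sum[of i UNIV "\<lambda>i. \<phi> k $ i"] phi_pos phi_sum[of k] by (simp add: less_imp_le)

lemma inv_pi_le: "1 / \<pi> k $ i \<le> \<kappa>\<^sup>2"
proof -
  have "1 / \<pi> k $ i \<le> (inv_min_sqrt (\<pi> k))\<^sup>2"
    using one_div_le_vmin[of "\<pi> k" i] pi_pos by (simp add: inv_min_sqrt_sq)
  also have "\<dots> \<le> \<kappa>\<^sup>2" using kappa_bound inv_min_sqrt_sq(2)[of "\<pi> k"] pi_pos by (intro power_mono) auto
  finally show ?thesis .
qed

lemma inv_phi_le: "1 / \<phi> k $ i \<le> vphi\<^sup>2"
proof -
  have "1 / \<phi> k $ i \<le> (inv_min_sqrt (\<phi> k))\<^sup>2"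
    using one_div_le_vmin[of "\<phi> k" i] phi_pos by (simp add: inv_min_sqrt_sq)
  also have "\<dots> \<le> vphi\<^sup>2" using vphi_bound inv_min_sqrt_sq(2)[of "\<phi> k"] phi_pos by (intro power_mono) auto
  finally show ?thesis .
qed

lemma kappa_ge: "real n \<le> \<kappa>\<^sup>2"
proof -
  have "real n \<le> (inv_min_sqrt (\<pi> 0))\<^sup>2"
    using n_le_one_div_vmin[OF pi_pos pi_sum] pi_pos by (simp add: inv_min_sqrt_sq)
  also have "\<dots> \<le> \<kappa>\<^sup>2" using kappa_bound inv_min_sqrt_sq(2)[of "\<pi> 0"] pi_pos by (intro power_mono) auto
  finally show ?thesis .
qed

lemma vphi_ge: "real n \<le> vphi\<^sup>2"
proof -
  have "real n \<le> (inv_min_sqrt (\<phi> 0))\<^sup>2"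
    using n_le_one_div_vmin[OF phi_pos phi_sum] phi_pos by (simp add: inv_min_sqrt_sq)
  also have "\<dots> \<le> vphi\<^sup>2" using vphi_bound inv_min_sqrt_sq(2)[of "\<phi> 0"] phi_pos by (intro power_mono) auto
  finally show ?thesis .
qed

text \<open>\<open>psi_bound\<close> speaks of the indices from 1 on. Index 0 is covered because the
  uniform vector has the largest possible minimum among stochastic vectors.\<close>

lemma psi_ge: "real n * (1 / vmin (\<pi> k) - 1) \<le> \<psi>"
proof (cases k)
  case (Suc k')
  then show ?thesis using psi_bound[of k'] inv_min_sqrt_sq(1)[OF pi_pos, of k] by simp
next
  case 0
  have "vmin (\<pi> 0) = 1 / real n" by (simp add: vmin_def pi_init)
  then have "1 / vmin (\<pi> 0) = real n" by simp
  also have "\<dots> \<le> 1 / vmin (\<pi> (Suc 0))" by (rule n_le_one_div_vmin[OF pi_pos pi_sum])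
  finally have "real n * (1 / vmin (\<pi> 0) - 1) \<le> real n * (1 / vmin (\<pi> (Suc 0)) - 1)"
    by (intro mult_left_mono) auto
  also have "\<dots> \<le> \<psi>" using psi_bound[of 0] inv_min_sqrt_sq(1)[OF pi_pos, of "Suc 0"] by simp
  finally show ?thesis using 0 by simp
qed

lemma inv_pi_minus_1_le: "real n * (1 / \<pi> k $ i - 1) \<le> \<psi>"
  using one_div_le_vmin[of "\<pi> k" i] pi_pos psi_ge[of k]
    mult_left_mono[of "1 / \<pi> k $ i - 1" "1 / vmin (\<pi> k) - 1" "real n"] by simp

lemma n_le_psi: "real n \<le> \<psi>"
proof -
  have "real n * 1 \<le> real n * (1 / vmin (\<pi> 0) - 1)"
    using n_le_one_div_vmin[OF pi_pos pi_sum, of 0] n_ge_2 by (intro mult_left_mono) auto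
  also have "\<dots> \<le> \<psi>" by (rule psi_ge)
  finally show ?thesis by simp
qed

text \<open>For at least two agents \<open>\<kappa>\<^sub>k\<^sup>2 \<le> 2 (\<kappa>\<^sub>k\<^sup>2 - 1)\<close>, which turns bounds by \<open>\<kappa>\<close> into bounds by \<open>\<psi>\<close>.\<close>

lemma n_inv_pi_le_psi: "real n * (1 / \<pi> k $ i) \<le> 2 * \<psi>"
  using inv_pi_minus_1_le[of k i] n_le_psi by (simp add: right_diff_distrib)

lemma inv_pi_le_psi: "1 / \<pi> k $ i \<le> \<psi>"
proof -
  have "0 \<le> 1 / \<pi> k $ i" using pi_pos[of k i] by simp
  then have "2 * (1 / \<pi> k $ i) \<le> real n * (1 / \<pi> k $ i)" using n_ge_2 by (intro mult_right_mono) auto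
  then show ?thesis using n_inv_pi_le_psi[of k i] by linarith
qed

text \<open>The noise of the summed trackers has variance \<open>n \<sigma>\<^sup>2\<close>, whereas only \<open>2 \<sigma>\<^sup>2\<close> is available in
  the second and third rows of \<open>b\<close>. The difference is absorbed by the dispersion of the trackers,
  whose limiting bound is at least \<open>8 n \<psi> \<sigma>\<^sup>2\<close> and which enters only with the factor \<open>max \<pi>\<^sub>k < 1\<close>.\<close>

lemma vmax_pi_noise:
  assumes "8 * real n * \<psi> * \<sigma>\<^sup>2 \<le> s"
  shows "vmax (\<pi> k) * (real n * \<sigma>\<^sup>2) \<le> (1 - vmax (\<pi> k)) * s"
    and "vmax (\<pi> k) \<le> 1"
proof -
  define v where "v = vmin (\<pi> k)"
  have v: "0 < v" unfolding v_def by (rule vmin_pos[OF pi_pos])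
  have "vmax (\<pi> k) \<in> range (\<lambda>i. \<pi> k $ i)" unfolding vmax_def by (intro Max_in) auto
  then obtain i where i: "vmax (\<pi> k) = \<pi> k $ i" by auto
  \<comment> \<open>Besides the largest entry there are n - 1 others, each at least the minimum
    \<open>v\<close>; this is the gap below 1.\<close>
  have "(\<Sum>j\<in>UNIV. \<pi> k $ j) = \<pi> k $ i + (\<Sum>j\<in>UNIV - {i}. \<pi> k $ j)"
    by (rule sum.remove) auto
  moreover have "(\<Sum>j\<in>UNIV - {i}. v) \<le> (\<Sum>j\<in>UNIV - {i}. \<pi> k $ j)"
    unfolding v_def by (intro sum_mono vmin_le)
  moreover have "(\<Sum>j\<in>UNIV - {i}. v) = (real n - 1) * v"
    using n_ge_2 by (simp add: n_def card_Diff_singleton of_nat_diff)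
  ultimately have gap: "(real n - 1) * v \<le> 1 - vmax (\<pi> k)" using pi_sum[of k] i by linarith
  have "0 \<le> (real n - 1) * v" using n_ge_2 v by simp
  then show le1: "vmax (\<pi> k) \<le> 1" using gap by linarith
  have nv: "real n * v \<le> 1"
    using n_le_one_div_vmin[OF pi_pos pi_sum, of k] v by (simp add: v_def field_simps)
  have "2 * v \<le> real n * v" using n_ge_2 v by (intro mult_right_mono) auto
  then have v2: "1 \<le> 2 - 2 * v" using nv by linarith
  have "1 * 1 \<le> (real n - 1) * (8 * (real n * (1 - v)))"
  proof (rule mult_mono)
    have "2 * 1 \<le> real n * (2 - 2 * v)" using n_ge_2 v2 by (intro mult_mono) auto
    also have "\<dots> = 2 * (real n * (1 - v))" by (simp add: algebra_simps)
    finally show "1 \<le> 8 * (real n * (1 - v))" by simp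
  qed (use n_ge_2 in auto)
  \<comment> \<open>The minimum may be tiny, but it cancels: the gap is proportional to
    \<open>v\<close>, and the bound that \<psi> dominates grows like \<open>1 / v\<close>.\<close>
  also have "\<dots> = (real n - 1) * v * (8 * (real n * (1 / v - 1)))" using v by (simp add: field_simps)
  also have "\<dots> \<le> (1 - vmax (\<pi> k)) * (8 * \<psi>)"
    using gap psi_ge[of k] le1 n_ge_2 v2 v
    by (intro mult_mono mult_left_mono) (auto simp: v_def field_simps)
  finally have "1 \<le> (1 - vmax (\<pi> k)) * (8 * \<psi>)" by simp
  then have "1 * (real n * \<sigma>\<^sup>2) \<le> (1 - vmax (\<pi> k)) * (8 * \<psi>) * (real n * \<sigma>\<^sup>2)"
    by (intro mult_right_mono) auto
  also have "\<dots> = (1 - vmax (\<pi> k)) * (8 * real n * \<psi> * \<sigma>\<^sup>2)" by simp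
  also have "\<dots> \<le> (1 - vmax (\<pi> k)) * s" using assms le1 by (intro mult_left_mono) auto
  finally have "real n * \<sigma>\<^sup>2 \<le> (1 - vmax (\<pi> k)) * s" by simp
  moreover have "vmax (\<pi> k) * (real n * \<sigma>\<^sup>2) \<le> 1 * (real n * \<sigma>\<^sup>2)" using le1 by (intro mult_right_mono) auto
  ultimately show "vmax (\<pi> k) * (real n * \<sigma>\<^sup>2) \<le> (1 - vmax (\<pi> k)) * s" by linarith
qed

lemma gradF_eq: "real n *\<^sub>R gradF z = (\<Sum>i\<in>UNIV. gradf i z)"
proof -
  have "((\<lambda>z. (1 / real n) * (\<Sum>i\<in>UNIV. f i z)) has_derivative
      (\<lambda>h. (1 / real n) * (\<Sum>i\<in>UNIV. inner h (gradf i z)))) (at z)"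
    using gradf unfolding gderiv_def by (intro has_derivative_mult_right has_derivative_sum) auto
  then have "(\<lambda>h. inner h (gradF z)) = (\<lambda>h. (1 / real n) * (\<Sum>i\<in>UNIV. inner h (gradf i z)))"
    using gradF[of z] unfolding gderiv_def by (rule has_derivative_unique[rotated])
  then have "inner h (gradF z) = inner h ((1 / real n) *\<^sub>R (\<Sum>i\<in>UNIV. gradf i z))" for h
    by (simp add: inner_sum_right fun_eq_iff)
  then have "gradF z = (1 / real n) *\<^sub>R (\<Sum>i\<in>UNIV. gradf i z)"
    using vector_eq_ldot by blast
  then show ?thesis using n_ge_2 by simp
qed

lemma gradF_xstar: "gradF xstar = 0"
proof -
  have "(\<lambda>h. inner h (gradF xstar)) = (\<lambda>h. 0)"
  proof (rule differential_zero_maxmin)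
    show "((\<lambda>z. (1 / real n) * (\<Sum>i\<in>UNIV. f i z)) has_derivative (\<lambda>h. inner h (gradF xstar))) (at xstar)"
      using gradF unfolding gderiv_def .
    have "(1 / real n) * (\<Sum>i\<in>UNIV. f i xstar) \<le> (1 / real n) * (\<Sum>i\<in>UNIV. f i z)" for z
      using xstar[of z] by (cases "z = xstar") auto
    then show "(\<forall>z\<in>UNIV. (1 / real n) * (\<Sum>i\<in>UNIV. f i z) \<le> (1 / real n) * (\<Sum>i\<in>UNIV. f i xstar)) \<or>
        (\<forall>z\<in>UNIV. (1 / real n) * (\<Sum>i\<in>UNIV. f i xstar) \<le> (1 / real n) * (\<Sum>i\<in>UNIV. f i z))"
      by blast
  qed auto
  then have "inner (gradF xstar) (gradF xstar) = 0" by meson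
  then show ?thesis by simp
qed

lemma gradF_lip: "norm (gradF u - gradF v) \<le> L * norm (u - v)"
proof -
  have "real n * norm (gradF u - gradF v) = norm (real n *\<^sub>R gradF u - real n *\<^sub>R gradF v)"
    by (simp add: scaleR_diff_right[symmetric])
  also have "\<dots> = norm (\<Sum>i\<in>UNIV. gradf i u - gradf i v)"
    by (simp add: gradF_eq sum_subtractf)
  also have "\<dots> \<le> (\<Sum>i\<in>UNIV. norm (gradf i u - gradf i v))" by (rule norm_sum)
  also have "\<dots> \<le> (\<Sum>i\<in>(UNIV :: 'n set). L * norm (u - v))" by (intro sum_mono gradf_lip)
  also have "\<dots> = real n * (L * norm (u - v))" by (simp add: n_def)
  finally show ?thesis using n_ge_2 by simp
qed

lemma mu_le_L: "\<mu> \<le> L"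
proof -
  \<comment> \<open>A nonzero vector for comparing strong convexity with the Lipschitz bound; the
    coordinate type is nonempty, so the all-ones vector is one.\<close>
  define u :: "real^'p" where "u = 1"
  have "u $ i \<noteq> 0" for i by (simp add: u_def)
  then have u: "0 < norm u" by (metis zero_index zero_less_norm_iff)
  have "\<mu> * (norm u)\<^sup>2 \<le> inner (gradF u - gradF 0) u" using strongly_convex[of u 0] by simp
  also have "\<dots> \<le> norm (gradF u - gradF 0) * norm u" by (rule norm_cauchy_schwarz)
  also have "\<dots> \<le> L * norm u * norm u" using gradF_lip[of u 0] by (intro mult_right_mono) auto
  finally have "\<mu> * (norm u)\<^sup>2 \<le> L * (norm u)\<^sup>2" by (simp add: power2_eq_square)
  then show ?thesis using u by simp
qed

sublocale step_size n L \<mu> \<eta> \<kappa> vphi \<psi> c \<tau> \<alpha>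
  using n_ge_2 L_pos mu_pos mu_le_L eta_range kappa_gt_1 vphi_gt_1 kappa_ge vphi_ge c_range tau_range
    psi_pos psi_le alpha_pos alpha_le
  by unfold_locales simp_all

text \<open>Here \<open>W\<close> is \<open>A k\<close>, with weights \<open>\<phi> (Suc k)\<close>
  after and \<open>\<phi> k\<close> before mixing. Self-loop and arc each contribute a factor
  \<open>a\<close>, which gives the numerator in \<open>c_factor\<close>.\<close>

lemma A_contraction:
  fixes u :: "'n \<Rightarrow> real^'p"
  shows "(\<Sum>i\<in>UNIV. \<phi> (Suc k) $ i * (norm ((\<Sum>j\<in>UNIV. A k $ i $ j *\<^sub>R u j) - wmean (\<lambda>i. \<phi> k $ i) u))\<^sup>2)
    \<le> c\<^sup>2 * wvar (\<lambda>i. \<phi> k $ i) u"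
proof -
  define q where "q = 1 - vmin (\<phi> (Suc k)) * a\<^sup>2 /
    ((vmax (\<phi> k))\<^sup>2 * real (diam (net (E k))) * real (max_edge_utility (net (E k))))"
  have "(\<Sum>i\<in>UNIV. \<phi> (Suc k) $ i * (norm ((\<Sum>j\<in>UNIV. A k $ i $ j *\<^sub>R u j) - wmean (\<lambda>i. \<phi> k $ i) u))\<^sup>2)
    \<le> q * wvar (\<lambda>i. \<phi> k $ i) u"
    unfolding wmean_def wvar_def q_def
  proof (rule weighted_consensus_contraction[OF connected])
    have vm: "0 < vmin (\<phi> (Suc k))" by (rule vmin_pos[OF phi_pos])
    then show "0 \<le> vmin (\<phi> (Suc k)) * a\<^sup>2" by simp
    show "vmin (\<phi> (Suc k)) * a\<^sup>2 \<le> \<phi> (Suc k) $ i * A k $ i $ i * A k $ i $ j" if "(j, i) \<in> E k" for i j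
    proof -
      have "vmin (\<phi> (Suc k)) * (a * a) \<le> \<phi> (Suc k) $ i * (A k $ i $ i * A k $ i $ j)"
        using that A_ge A_pos vmin_le[of "\<phi> (Suc k)"] a_pos vm phi_pos[of "Suc k" i] A_nonneg
        by (intro mult_mono mult_nonneg_nonneg) (auto intro: less_imp_le)
      then show ?thesis by (simp add: power2_eq_square mult.assoc)
    qed
  qed (use A_nonneg A_row phi_A phi_sum phi_pos vmax_ge in \<open>auto intro: less_imp_le\<close>)
  also have "\<dots> \<le> c\<^sup>2 * wvar (\<lambda>i. \<phi> k $ i) u"
  proof (rule mult_right_mono)
    have "sqrt q \<le> c" using c_bound[of k] by (simp add: c_factor_def q_def)
    then show "q \<le> c\<^sup>2" using sqrt_le_D by blast
    show "0 \<le> wvar (\<lambda>i. \<phi> k $ i) u" by (intro wvar_nonneg less_imp_le[OF phi_pos])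
  qed
  finally show ?thesis .
qed

lemma B_contraction:
  fixes u :: "'n \<Rightarrow> real^'p"
  shows "disp (\<lambda>i. \<pi> (Suc k) $ i) (\<lambda>i. \<Sum>j\<in>UNIV. B k $ i $ j *\<^sub>R u j) \<le> \<tau>\<^sup>2 * disp (\<lambda>i. \<pi> k $ i) u"
proof -
  define q where "q = 1 - (vmin (\<pi> k))\<^sup>2 * b\<^sup>2 /
    ((vmax (\<pi> k))\<^sup>2 * vmax (\<pi> (Suc k)) * real (diam (net (E k))) * real (max_edge_utility (net (E k))))"
  have "disp (\<lambda>i. \<pi> (Suc k) $ i) (\<lambda>i. \<Sum>j\<in>UNIV. B k $ i $ j *\<^sub>R u j) \<le> q * disp (\<lambda>i. \<pi> k $ i) u"
    unfolding q_def
  proof (rule disp_contraction[OF connected, where mn = "vmin (\<pi> k)"])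
    show "0 \<le> vmin (\<pi> k)" by (rule less_imp_le[OF vmin_pos[OF pi_pos]])
    show "b \<le> B k $ i $ i" for i using B_ge B_pos by blast
    show "b \<le> B k $ i $ j" if "(j, i) \<in> E k" for i j using B_ge B_pos that by blast
  qed (simp_all only: B_nonneg B_col pi_Suc[symmetric] pi_pos pi_sum vmin_le vmax_ge less_imp_le[OF b_pos])
  also have "\<dots> \<le> \<tau>\<^sup>2 * disp (\<lambda>i. \<pi> k $ i) u"
  proof (rule mult_right_mono)
    have "sqrt q \<le> \<tau>" using tau_bound[of k] by (simp add: tau_factor_def q_def)
    then show "q \<le> \<tau>\<^sup>2" using sqrt_le_D by blast
    show "0 \<le> disp (\<lambda>i. \<pi> k $ i) u" by (intro disp_nonneg less_imp_le[OF pi_pos])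
  qed
  finally show ?thesis .
qed


section \<open>The filtration of the samples and the noise of the oracle\<close>

abbreviation X :: "nat \<times> 'n \<Rightarrow> 'w \<Rightarrow> real^'m" where "X \<equiv> \<lambda>(k, i). \<xi> k i"

abbreviation past :: "nat \<Rightarrow> (nat \<times> 'n) set" where "past k \<equiv> {m. fst m < k}"

abbreviation \<F> :: "nat \<Rightarrow> 'w measure" where "\<F> k \<equiv> sigma_of X (past k)"

definition grad :: "nat \<Rightarrow> 'n \<Rightarrow> 'w \<Rightarrow> real^'p" where
  "grad k i \<omega> = gradf i (x k \<omega> $ i)"

definition noise :: "nat \<Rightarrow> 'n \<Rightarrow> 'w \<Rightarrow> real^'p" where
  "noise k i \<omega> = g i (x k \<omega> $ i) (\<xi> k i \<omega>) - grad k i \<omega>"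

lemma X_rv: "random_variable borel (X j)"
  using indep unfolding indep_vars_def2 by blast

lemma F_mono: "h \<in> measurable (\<F> k) N \<Longrightarrow> k \<le> l \<Longrightarrow> h \<in> measurable (\<F> l) N"
  by (erule measurable_sigma_of_mono) auto

lemma F_imp: "h \<in> measurable (\<F> k) N \<Longrightarrow> h \<in> measurable Pr N"
  by (rule measurable_sigma_of_imp[OF X_rv])

lemma gradf_meas: "gradf i \<in> borel_measurable borel"
  by (intro borel_measurable_continuous_onI gradf_cont)

lemma oracle_meas:
  assumes "Z \<in> borel_measurable N" "Y \<in> borel_measurable N"
  shows "(\<lambda>\<omega>. g i (Z \<omega>) (Y \<omega>)) \<in> borel_measurable N"
proof -
  have "(\<lambda>\<omega>. (Z \<omega>, Y \<omega>)) \<in> borel_measurable N"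
    unfolding borel_prod[symmetric] using assms by measurable
  from measurable_compose[OF this g_meas[of i]] show ?thesis by simp
qed

lemma sample_meas: "(k, i) \<in> J \<Longrightarrow> \<xi> k i \<in> borel_measurable (sigma_of X J)"
  using measurable_sigma_of_self[of "(k, i)" J X] by simp

text \<open>The offset is essential: \<open>x k\<close> uses the samples of the rounds before
  \<open>k\<close> only, whereas \<open>y k\<close> already contains those of round
  \<open>k\<close>.\<close>

lemma iterates_meas: "(\<lambda>\<omega>. x k \<omega> $ i) \<in> borel_measurable (\<F> k) \<and> (\<lambda>\<omega>. y k \<omega> $ i) \<in> borel_measurable (\<F> (Suc k))"
proof (induction k arbitrary: i)
  case 0
  have x: "(\<lambda>\<omega>. x 0 \<omega> $ i) \<in> borel_measurable (\<F> l)" for i l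
    by (subst measurable_cong[where g = "\<lambda>_. x0 $ i"]) (simp_all add: x_init)
  have "(\<lambda>\<omega>. g i (x 0 \<omega> $ i) (\<xi> 0 i \<omega>)) \<in> borel_measurable (\<F> (Suc 0))"
    by (rule oracle_meas[OF x sample_meas]) simp
  then have "(\<lambda>\<omega>. y 0 \<omega> $ i) \<in> borel_measurable (\<F> (Suc 0))"
    by (subst measurable_cong[where g = "\<lambda>\<omega>. g i (x 0 \<omega> $ i) (\<xi> 0 i \<omega>)"]) (simp_all add: y_init)
  with x show ?case by blast
next
  case (Suc k)
  have x[measurable]: "(\<lambda>\<omega>. x k \<omega> $ j) \<in> borel_measurable (\<F> (Suc k))" for j
    by (rule F_mono[OF conjunct1[OF Suc.IH]]) simp
  have y[measurable]: "(\<lambda>\<omega>. y k \<omega> $ j) \<in> borel_measurable (\<F> (Suc k))" for j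
    using Suc by simp
  have "(\<lambda>\<omega>. (\<Sum>j\<in>UNIV. A k $ i $ j *\<^sub>R x k \<omega> $ j) - \<alpha> *\<^sub>R y k \<omega> $ i) \<in> borel_measurable (\<F> (Suc k))" for i
    by measurable
  then have x': "(\<lambda>\<omega>. x (Suc k) \<omega> $ i) \<in> borel_measurable (\<F> (Suc k))" for i
    by (subst measurable_cong[where g = "\<lambda>\<omega>. (\<Sum>j\<in>UNIV. A k $ i $ j *\<^sub>R x k \<omega> $ j) - \<alpha> *\<^sub>R y k \<omega> $ i"])
      (simp_all add: x_step)
  have g[measurable]: "(\<lambda>\<omega>. g i (x k \<omega> $ i) (\<xi> k i \<omega>)) \<in> borel_measurable (\<F> (Suc (Suc k)))"
    by (rule oracle_meas[OF F_mono[OF x] sample_meas]) simp_all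
  have g'[measurable]: "(\<lambda>\<omega>. g i (x (Suc k) \<omega> $ i) (\<xi> (Suc k) i \<omega>)) \<in> borel_measurable (\<F> (Suc (Suc k)))"
    by (rule oracle_meas[OF F_mono[OF x'] sample_meas]) simp_all
  have y2[measurable]: "(\<lambda>\<omega>. y k \<omega> $ j) \<in> borel_measurable (\<F> (Suc (Suc k)))" for j
    by (rule F_mono[OF y]) simp
  have "(\<lambda>\<omega>. (\<Sum>j\<in>UNIV. B k $ i $ j *\<^sub>R y k \<omega> $ j) + g i (x (Suc k) \<omega> $ i) (\<xi> (Suc k) i \<omega>)
      - g i (x k \<omega> $ i) (\<xi> k i \<omega>)) \<in> borel_measurable (\<F> (Suc (Suc k)))"
    by measurable
  then have "(\<lambda>\<omega>. y (Suc k) \<omega> $ i) \<in> borel_measurable (\<F> (Suc (Suc k)))"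
    by (subst measurable_cong[where g = "\<lambda>\<omega>. (\<Sum>j\<in>UNIV. B k $ i $ j *\<^sub>R y k \<omega> $ j)
        + g i (x (Suc k) \<omega> $ i) (\<xi> (Suc k) i \<omega>) - g i (x k \<omega> $ i) (\<xi> k i \<omega>)"]) (simp_all add: y_step)
  with x' show ?case by blast
qed

lemma x_meas: "(\<lambda>\<omega>. x k \<omega> $ i) \<in> borel_measurable (\<F> k)"
  and y_meas: "(\<lambda>\<omega>. y k \<omega> $ i) \<in> borel_measurable (\<F> (Suc k))"
  using iterates_meas by blast+

lemma grad_meas: "grad k i \<in> borel_measurable (\<F> k)"
  unfolding grad_def using measurable_compose[OF x_meas gradf_meas] .

text \<open>Index sets other than the past are allowed, since comparing two agents of the same round
  conditions on all samples but one.\<close>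

lemma noise_meas:
  assumes "past k \<subseteq> J" "(k, i) \<in> J"
  shows "noise k i \<in> borel_measurable (sigma_of X J)"
  unfolding noise_def
  using oracle_meas[OF measurable_sigma_of_mono[OF x_meas assms(1)] sample_meas[OF assms(2)]]
    measurable_sigma_of_mono[OF grad_meas assms(1)]
  by (rule borel_measurable_diff)

lemma noise_meas_F: "k < l \<Longrightarrow> noise k i \<in> borel_measurable (\<F> l)"
  by (rule noise_meas) auto

lemma noise_meas_Pr: "noise k i \<in> borel_measurable Pr"
  by (rule F_imp[OF noise_meas_F]) auto

lemma oracle_noise_meas: "(\<lambda>(z, s). g i z s - gradf i z) \<in> borel_measurable borel"
proof -
  have "(\<lambda>p. g i (fst p) (snd p)) \<in> borel_measurable borel" using g_meas[of i] by (simp add: case_prod_beta')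
  moreover have "(\<lambda>p :: (real^'p) \<times> (real^'m). gradf i (fst p)) \<in> borel_measurable borel"
    by (intro borel_measurable_continuous_onI continuous_on_compose2[OF gradf_cont] continuous_intros) auto
  ultimately show ?thesis by (simp add: case_prod_beta')
qed

text \<open>The sample of round \<open>k\<close> is independent of \<open>x k\<close>, so the
  variance bound, uniform over fixed points, holds at the random point as well.\<close>

lemma noise_sq:
  shows "sq_integrable (noise k i)" and "expectation (\<lambda>\<omega>. (norm (noise k i \<omega>))\<^sup>2) \<le> \<sigma>\<^sup>2"
proof -
  define h where "h z s = (norm (g i z s - gradf i z))\<^sup>2" for z s
  have h: "case_prod h \<in> borel_measurable borel"
    using oracle_noise_meas[of i] unfolding h_def case_prod_beta' by measurable
  have Xk: "X (k, i) = \<xi> k i" by simp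
  have nn: "\<bar>h z s\<bar> = h z s" for z s by (simp add: h_def)
  have hn: "h (x k \<omega> $ i) (\<xi> k i \<omega>) = (norm (noise k i \<omega>))\<^sup>2" for \<omega>
    by (simp add: h_def noise_def grad_def)
  note * = expectation_indep_sigma_of[OF indep _ x_meas h, of "(k, i)" k "\<lambda>_. \<sigma>\<^sup>2" i, unfolded Xk]
  have int: "integrable Pr (\<lambda>\<omega>. h z (\<xi> k i \<omega>))" for z unfolding h_def by (rule g_var_integrable)
  have bd: "expectation (\<lambda>\<omega>. \<bar>h z (\<xi> k i \<omega>)\<bar>) \<le> \<sigma>\<^sup>2" for z unfolding nn unfolding h_def by (rule g_var)
  have "integrable Pr (\<lambda>\<omega>. h (x k \<omega> $ i) (\<xi> k i \<omega>))"
    by (rule *(1)) (simp_all add: int bd)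
  then show "sq_integrable (noise k i)"
    by (simp add: sq_integrable_def noise_meas_Pr hn)
  have "expectation (\<lambda>\<omega>. h (x k \<omega> $ i) (\<xi> k i \<omega>)) =
      expectation (\<lambda>\<omega>. expectation (\<lambda>\<omega>'. h (x k \<omega> $ i) (\<xi> k i \<omega>')))"
    by (rule *(2)) (simp_all add: int bd)
  also have "\<dots> \<le> expectation (\<lambda>\<omega>. \<sigma>\<^sup>2)"
    by (rule integral_mono') (use bd in \<open>auto simp: nn\<close>)
  finally show "expectation (\<lambda>\<omega>. (norm (noise k i \<omega>))\<^sup>2) \<le> \<sigma>\<^sup>2" by (simp add: hn prob_space)
qed

text \<open>With \<open>W\<close> and \<open>x k\<close> frozen together, averaging over the one
  sample outside \<open>J\<close> leaves the mean of the oracle error at a fixed point, which is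
  0.\<close>

lemma noise_orthogonal:
  assumes J: "past k \<subseteq> J" "(k, i) \<notin> J"
    and W: "W \<in> borel_measurable (sigma_of X J)" "sq_integrable W"
  shows "expectation (\<lambda>\<omega>. inner (W \<omega>) (noise k i \<omega>)) = 0"
proof -
  define h where "h p s = inner (fst p) (g i (snd p) s - gradf i (snd p))" for p :: "(real^'p) \<times> (real^'p)" and s
  have Xk: "X (k, i) = \<xi> k i" by simp
  have h: "case_prod h \<in> borel_measurable borel"
  proof -
    have "(\<lambda>q :: ((real^'p) \<times> (real^'p)) \<times> (real^'m). (snd (fst q), snd q)) \<in> borel_measurable borel"
      by (intro borel_measurable_continuous_onI continuous_intros)
    from measurable_compose[OF this oracle_noise_meas[of i]]
    have "(\<lambda>q :: ((real^'p) \<times> (real^'p)) \<times> (real^'m). g i (snd (fst q)) (snd q) - gradf i (snd (fst q))) \<in> borel_measurable borel"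
      by (simp add: case_prod_beta')
    moreover have "(\<lambda>q :: ((real^'p) \<times> (real^'p)) \<times> (real^'m). fst (fst q)) \<in> borel_measurable borel"
      by (intro borel_measurable_continuous_onI continuous_intros)
    ultimately show ?thesis unfolding h_def case_prod_beta' by measurable
  qed
  have Z: "(\<lambda>\<omega>. (W \<omega>, x k \<omega> $ i)) \<in> borel_measurable (sigma_of X J)"
    unfolding borel_prod[symmetric] using W(1) measurable_sigma_of_mono[OF x_meas J(1)] by measurable
  have int_g: "integrable Pr (\<lambda>\<omega>. g i z (\<xi> k i \<omega>) - gradf i z)" for z
    using g_mean[of i z k] by (auto simp: has_bochner_integral_iff)
  have mean_g: "expectation (\<lambda>\<omega>. g i z (\<xi> k i \<omega>) - gradf i z) = 0" for z
    using g_mean[of i z k] by (simp add: has_bochner_integral_iff prob_space)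
  have int: "integrable Pr (\<lambda>\<omega>. h p (\<xi> k i \<omega>))" for p
    unfolding h_def using int_g by (intro integrable_inner_right) auto
  have h0: "expectation (\<lambda>\<omega>. h p (\<xi> k i \<omega>)) = 0" for p
    unfolding h_def using int_g mean_g by simp
  have bd: "expectation (\<lambda>\<omega>. \<bar>h p (\<xi> k i \<omega>)\<bar>) \<le> (norm (fst p))\<^sup>2 + \<sigma>\<^sup>2" for p
  proof -
    have "expectation (\<lambda>\<omega>. \<bar>h p (\<xi> k i \<omega>)\<bar>) \<le>
        expectation (\<lambda>\<omega>. (norm (fst p))\<^sup>2 + (norm (g i (snd p) (\<xi> k i \<omega>) - gradf i (snd p)))\<^sup>2)"
    proof (rule integral_mono)
      show "integrable Pr (\<lambda>\<omega>. \<bar>h p (\<xi> k i \<omega>)\<bar>)" using int by simp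
      show "integrable Pr (\<lambda>\<omega>. (norm (fst p))\<^sup>2 + (norm (g i (snd p) (\<xi> k i \<omega>) - gradf i (snd p)))\<^sup>2)"
        using g_var_integrable by simp
      have "\<bar>inner u v\<bar> \<le> (norm u)\<^sup>2 + (norm v)\<^sup>2" for u v :: "real^'p"
      proof -
        have "0 \<le> norm u * norm v" by simp
        then show ?thesis
          using Cauchy_Schwarz_ineq2[of u v] sum_squares_bound[of "norm u" "norm v"] by linarith
      qed
      then show "\<bar>h p (\<xi> k i \<omega>)\<bar> \<le> (norm (fst p))\<^sup>2 + (norm (g i (snd p) (\<xi> k i \<omega>) - gradf i (snd p)))\<^sup>2" for \<omega>
        unfolding h_def .
    qed
    also have "\<dots> \<le> (norm (fst p))\<^sup>2 + \<sigma>\<^sup>2"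
      using g_var_integrable g_var by (simp add: prob_space)
    finally show ?thesis .
  qed
  have "expectation (\<lambda>\<omega>. h (W \<omega>, x k \<omega> $ i) (\<xi> k i \<omega>)) =
      expectation (\<lambda>\<omega>. expectation (\<lambda>\<omega>'. h (W \<omega>, x k \<omega> $ i) (\<xi> k i \<omega>')))"
    by (rule expectation_indep_sigma_of(2)[OF indep J(2) Z h, where C = "\<lambda>p. (norm (fst p))\<^sup>2 + \<sigma>\<^sup>2", unfolded Xk])
      (use int bd W(2) in \<open>auto simp: sq_integrable_def\<close>)
  then show ?thesis by (simp only: h0) (simp add: h_def noise_def grad_def)
qed

lemma noise_uncorrelated:
  assumes "W \<in> borel_measurable (\<F> k)" "sq_integrable W"
  shows "expectation (\<lambda>\<omega>. inner (W \<omega>) (noise k i \<omega>)) = 0"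
  by (rule noise_orthogonal[OF _ _ assms]) auto

text \<open>Take for \<open>J\<close> all samples except that of agent \<open>j\<close> in round
  \<open>k\<close>: the noise of agent \<open>i\<close> is measurable there.\<close>

lemma noise_agents_uncorrelated:
  assumes "i \<noteq> j"
  shows "expectation (\<lambda>\<omega>. inner (noise k i \<omega>) (noise k j \<omega>)) = 0"
  by (rule noise_orthogonal[OF _ _ noise_meas noise_sq(1), of k "UNIV - {(k, j)}"]) (use assms in auto)

lemma sq_integrable_gradf:
  assumes "sq_integrable Z"
  shows "sq_integrable (\<lambda>\<omega>. gradf i (Z \<omega>))"
proof (rule sq_integrable_bound)
  show "(\<lambda>\<omega>. gradf i (Z \<omega>)) \<in> borel_measurable Pr"
    using measurable_compose[OF sq_integrable_measurable[OF assms] gradf_meas] .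
  show "integrable Pr (\<lambda>\<omega>. 2 * (norm (gradf i 0))\<^sup>2 + 2 * (L\<^sup>2 * (norm (Z \<omega>))\<^sup>2))"
    using sq_integrable_norm_sq[OF assms] by simp
  fix \<omega>
  have "(norm (gradf i 0 + (gradf i (Z \<omega>) - gradf i 0)))\<^sup>2
      \<le> 2 * (norm (gradf i 0))\<^sup>2 + 2 * (norm (gradf i (Z \<omega>) - gradf i 0))\<^sup>2"
    by (rule norm_add_sq_le_2)
  moreover have "(norm (gradf i (Z \<omega>) - gradf i 0))\<^sup>2 \<le> (L * norm (Z \<omega>))\<^sup>2"
    using gradf_lip[of i "Z \<omega>" 0] by (intro power_mono) auto
  ultimately show "(norm (gradf i (Z \<omega>)))\<^sup>2 \<le> 2 * (norm (gradf i 0))\<^sup>2 + 2 * (L\<^sup>2 * (norm (Z \<omega>))\<^sup>2)"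
    by (simp add: power_mult_distrib)
qed

lemma y_init': "\<omega> \<in> space Pr \<Longrightarrow> y 0 \<omega> $ i = grad 0 i \<omega> + noise 0 i \<omega>"
  by (simp add: y_init noise_def)

lemma y_step': "\<omega> \<in> space Pr \<Longrightarrow> y (Suc k) \<omega> $ i = (\<Sum>j\<in>UNIV. B k $ i $ j *\<^sub>R y k \<omega> $ j)
    + (grad (Suc k) i \<omega> - grad k i \<omega>) - noise k i \<omega> + noise (Suc k) i \<omega>"
  by (simp add: y_step noise_def)

lemma iterates_sq: "sq_integrable (\<lambda>\<omega>. x k \<omega> $ i) \<and> sq_integrable (\<lambda>\<omega>. y k \<omega> $ i)"
proof (induction k arbitrary: i)
  case 0
  have x: "sq_integrable (\<lambda>\<omega>. x 0 \<omega> $ i)" for i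
    by (rule sq_integrable_cong[OF sq_integrable_const[of "x0 $ i"]]) (simp add: x_init)
  have "sq_integrable (\<lambda>\<omega>. y 0 \<omega> $ i)"
    by (rule sq_integrable_cong[OF sq_integrable_add[OF sq_integrable_gradf[OF x] noise_sq(1)]])
      (simp add: y_init' grad_def)
  with x show ?case by blast
next
  case (Suc k)
  have x: "sq_integrable (\<lambda>\<omega>. x (Suc k) \<omega> $ i)" for i
    by (rule sq_integrable_cong[OF sq_integrable_diff[OF
          sq_integrable_sum[of UNIV "\<lambda>j \<omega>. A k $ i $ j *\<^sub>R x k \<omega> $ j"] sq_integrable_scaleR]])
      (use Suc in \<open>simp_all add: x_step sq_integrable_scaleR\<close>)
  have By: "sq_integrable (\<lambda>\<omega>. \<Sum>j\<in>UNIV. B k $ i $ j *\<^sub>R y k \<omega> $ j)"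
    using Suc by (intro sq_integrable_sum sq_integrable_scaleR) auto
  have G: "sq_integrable (\<lambda>\<omega>. grad (Suc k) i \<omega> - grad k i \<omega>)"
    unfolding grad_def using Suc x by (intro sq_integrable_diff sq_integrable_gradf) auto
  have "sq_integrable (\<lambda>\<omega>. y (Suc k) \<omega> $ i)"
    by (rule sq_integrable_cong[OF sq_integrable_add[OF sq_integrable_diff[OF
          sq_integrable_add[OF By G] noise_sq(1)] noise_sq(1)]]) (simp add: y_step')
  with x show ?case by blast
qed

lemma x_sq: "sq_integrable (\<lambda>\<omega>. x k \<omega> $ i)" and y_sq: "sq_integrable (\<lambda>\<omega>. y k \<omega> $ i)"
  using iterates_sq by blast+

lemma grad_sq: "sq_integrable (grad k i)"
  unfolding grad_def by (rule sq_integrable_gradf[OF x_sq])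

text \<open>The tracking invariant: columns of \<open>B k\<close> sum to one, so mixing preserves
  the sum of the trackers, and the added differences of oracle values telescope.\<close>

lemma sum_y: "\<omega> \<in> space Pr \<Longrightarrow> (\<Sum>i\<in>UNIV. y k \<omega> $ i) = (\<Sum>i\<in>UNIV. grad k i \<omega> + noise k i \<omega>)"
proof (induction k)
  case 0
  then show ?case by (simp add: y_init')
next
  case (Suc k)
  have "(\<Sum>i\<in>UNIV. \<Sum>j\<in>UNIV. B k $ i $ j *\<^sub>R y k \<omega> $ j) = (\<Sum>j\<in>UNIV. y k \<omega> $ j)"
    by (subst sum.swap) (simp add: scaleR_left.sum[symmetric] B_col)
  with Suc show ?case
    by (simp add: y_step' sum.distrib sum_subtractf)
qed

lemma expectation_noise_sum_sq: "expectation (\<lambda>\<omega>. (norm (\<Sum>i\<in>UNIV. noise k i \<omega>))\<^sup>2) =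
    (\<Sum>i\<in>UNIV. expectation (\<lambda>\<omega>. (norm (noise k i \<omega>))\<^sup>2))"
proof -
  have int: "integrable Pr (\<lambda>\<omega>. inner (noise k i \<omega>) (noise k j \<omega>))" for i j
    by (intro sq_integrable_inner noise_sq)
  have "expectation (\<lambda>\<omega>. (norm (\<Sum>i\<in>UNIV. noise k i \<omega>))\<^sup>2) =
      expectation (\<lambda>\<omega>. \<Sum>i\<in>UNIV. \<Sum>j\<in>UNIV. inner (noise k j \<omega>) (noise k i \<omega>))"
    by (simp add: power2_norm_eq_inner inner_sum_left inner_sum_right)
  also have "\<dots> = (\<Sum>i\<in>UNIV. \<Sum>j\<in>UNIV. expectation (\<lambda>\<omega>. inner (noise k j \<omega>) (noise k i \<omega>)))"
    using int by simp
  also have "\<dots> = (\<Sum>i\<in>UNIV. \<Sum>j\<in>UNIV. if j = i then expectation (\<lambda>\<omega>. (norm (noise k i \<omega>))\<^sup>2) else 0)"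
    by (intro sum.cong refl) (auto simp: noise_agents_uncorrelated power2_norm_eq_inner)
  finally show ?thesis by simp
qed

lemma expectation_sum_noise_sq_le: "(\<Sum>i\<in>UNIV. expectation (\<lambda>\<omega>. (norm (noise k i \<omega>))\<^sup>2)) \<le> real n * \<sigma>\<^sup>2"
proof -
  have "(\<Sum>i\<in>UNIV. expectation (\<lambda>\<omega>. (norm (noise k i \<omega>))\<^sup>2)) \<le> (\<Sum>i\<in>(UNIV :: 'n set). \<sigma>\<^sup>2)"
    by (intro sum_mono noise_sq)
  then show ?thesis by (simp add: n_def)
qed

section \<open>The three errors and the size of the trackers\<close>

definition xhat :: "nat \<Rightarrow> 'w \<Rightarrow> real^'p" where
  "xhat k \<omega> = wmean (\<lambda>i. \<phi> k $ i) (\<lambda>i. x k \<omega> $ i)"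

definition opt_err :: "nat \<Rightarrow> 'w \<Rightarrow> real" where
  "opt_err k \<omega> = (norm (xhat k \<omega> - xstar))\<^sup>2"

definition cons_err :: "nat \<Rightarrow> 'w \<Rightarrow> real" where
  "cons_err k \<omega> = wvar (\<lambda>i. \<phi> k $ i) (\<lambda>i. x k \<omega> $ i)"

definition track_err :: "nat \<Rightarrow> 'w \<Rightarrow> real" where
  "track_err k \<omega> = disp (\<lambda>i. \<pi> k $ i) (\<lambda>i. y k \<omega> $ i)"

definition y_sq_sum :: "nat \<Rightarrow> 'w \<Rightarrow> real" where
  "y_sq_sum k \<omega> = (\<Sum>i\<in>UNIV. (norm (y k \<omega> $ i))\<^sup>2)"

abbreviation gsum :: "nat \<Rightarrow> 'w \<Rightarrow> real^'p" where "gsum k \<omega> \<equiv> \<Sum>i\<in>UNIV. grad k i \<omega>"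
abbreviation nsum :: "nat \<Rightarrow> 'w \<Rightarrow> real^'p" where "nsum k \<omega> \<equiv> \<Sum>i\<in>UNIV. noise k i \<omega>"

lemma xhat_meas: "xhat k \<in> borel_measurable (\<F> k)"
  unfolding xhat_def wmean_def by (intro borel_measurable_sum borel_measurable_scaleR borel_measurable_const x_meas)

lemma xhat_sq: "sq_integrable (xhat k)"
  unfolding xhat_def wmean_def by (intro sq_integrable_sum sq_integrable_scaleR x_sq) simp

lemma gsum_sq: "sq_integrable (gsum k)"
  by (intro sq_integrable_sum grad_sq) simp

lemma nsum_sq: "sq_integrable (nsum k)"
  by (intro sq_integrable_sum noise_sq) simp

lemma opt_err_integrable: "integrable Pr (opt_err k)"
  unfolding opt_err_def by (intro sq_integrable_norm_sq sq_integrable_diff xhat_sq sq_integrable_const)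

lemma cons_err_integrable: "integrable Pr (cons_err k)"
proof -
  have "integrable Pr (\<lambda>\<omega>. (norm (x k \<omega> $ i - xhat k \<omega>))\<^sup>2)" for i
    by (intro sq_integrable_norm_sq sq_integrable_diff x_sq xhat_sq)
  then show ?thesis unfolding cons_err_def wvar_def xhat_def[symmetric] by simp
qed

lemma track_err_integrable: "integrable Pr (track_err k)"
  unfolding track_err_def by (rule disp_integrable[OF y_sq])

lemma y_sq_sum_integrable: "integrable Pr (y_sq_sum k)"
  unfolding y_sq_sum_def by (intro Bochner_Integration.integrable_sum sq_integrable_norm_sq y_sq)

lemma cons_err_nonneg: "0 \<le> cons_err k \<omega>"
  unfolding cons_err_def by (intro wvar_nonneg less_imp_le[OF phi_pos])

lemma track_err_nonneg: "0 \<le> track_err k \<omega>"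
  unfolding track_err_def by (intro disp_nonneg less_imp_le[OF pi_pos])

lemma one_le_vphi_phi: "1 \<le> vphi\<^sup>2 * \<phi> k $ i"
  using inv_phi_le[of k i] phi_pos[of k i] by (simp add: field_simps)

lemma sum_dist_sq_le: "(\<Sum>i\<in>UNIV. (norm (x k \<omega> $ i - z))\<^sup>2) \<le> vphi\<^sup>2 * (cons_err k \<omega> + (norm (xhat k \<omega> - z))\<^sup>2)"
proof -
  have "(\<Sum>i\<in>UNIV. (norm (x k \<omega> $ i - z))\<^sup>2) \<le> (\<Sum>i\<in>UNIV. vphi\<^sup>2 * \<phi> k $ i * (norm (x k \<omega> $ i - z))\<^sup>2)"
    by (intro sum_mono) (use mult_right_mono[OF one_le_vphi_phi] in fastforce)
  also have "\<dots> = vphi\<^sup>2 * (cons_err k \<omega> + (norm (xhat k \<omega> - z))\<^sup>2)"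
    using wvar_decomp[OF phi_sum, of k "\<lambda>i. x k \<omega> $ i" z]
    by (simp add: cons_err_def xhat_def mult.assoc sum_distrib_left[symmetric])
  finally show ?thesis .
qed

text \<open>One estimate for two reference points: at \<open>xstar\<close> the full gradient
  vanishes and the summed gradients themselves are bounded; at \<open>xhat k \<omega>\<close> only
  the consensus error remains.\<close>

lemma gsum_diff_sq_le: "(norm (gsum k \<omega> - real n *\<^sub>R gradF z))\<^sup>2 \<le>
    L\<^sup>2 * real n * vphi\<^sup>2 * (cons_err k \<omega> + (norm (xhat k \<omega> - z))\<^sup>2)"
proof -
  have "(norm (gsum k \<omega> - real n *\<^sub>R gradF z))\<^sup>2 = (norm (\<Sum>i\<in>UNIV. grad k i \<omega> - gradf i z))\<^sup>2"
    by (simp add: gradF_eq sum_subtractf)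
  also have "\<dots> \<le> real n * (\<Sum>i\<in>UNIV. (norm (grad k i \<omega> - gradf i z))\<^sup>2)"
    unfolding n_def by (rule norm_sum_sq_le)
  also have "\<dots> \<le> real n * (\<Sum>i\<in>UNIV. L\<^sup>2 * (norm (x k \<omega> $ i - z))\<^sup>2)"
    unfolding power_mult_distrib[symmetric] grad_def
    by (intro mult_left_mono sum_mono power_mono gradf_lip) auto
  also have "\<dots> = real n * L\<^sup>2 * (\<Sum>i\<in>UNIV. (norm (x k \<omega> $ i - z))\<^sup>2)"
    by (simp add: sum_distrib_left mult.assoc)
  also have "\<dots> \<le> real n * L\<^sup>2 * (vphi\<^sup>2 * (cons_err k \<omega> + (norm (xhat k \<omega> - z))\<^sup>2))"
    by (intro mult_left_mono sum_dist_sq_le) simp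
  finally show ?thesis by (simp add: mult_ac)
qed

lemma expectation_inner_nsum:
  assumes "W \<in> borel_measurable (\<F> k)" "sq_integrable W"
  shows "expectation (\<lambda>\<omega>. inner (W \<omega>) (nsum k \<omega>)) = 0"
proof -
  have "integrable Pr (\<lambda>\<omega>. inner (W \<omega>) (noise k i \<omega>))" for i
    by (intro sq_integrable_inner assms noise_sq)
  then show ?thesis
    by (simp add: inner_sum_right noise_uncorrelated[OF assms])
qed

lemma expectation_nsum_sq_le: "expectation (\<lambda>\<omega>. (norm (nsum k \<omega>))\<^sup>2) \<le> real n * \<sigma>\<^sup>2"
  unfolding expectation_noise_sum_sq by (rule expectation_sum_noise_sq_le)

lemma gsum_meas: "gsum k \<in> borel_measurable (\<F> k)"
  by (intro borel_measurable_sum grad_meas)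

text \<open>Formulated for upper bounds of the expected errors, because the one for the dispersion
  must be large enough to absorb the noise: with p the largest entry of \<open>\<pi> k\<close>, p
  times (\<open>u2\<close> plus the noise) is at most \<open>u2\<close>. The summand
  \<open>2 * \<sigma>\<^sup>2\<close> and the factor 2 before the last term are slack that matches
  the entries of b and M.\<close>

lemma expectation_y_sq_sum_le:
  assumes "expectation (opt_err k) \<le> u0" "expectation (cons_err k) \<le> u1" "expectation (track_err k) \<le> u2"
    and u2: "8 * real n * \<psi> * \<sigma>\<^sup>2 \<le> u2"
  shows "expectation (y_sq_sum k) \<le> u2 + 2 * \<sigma>\<^sup>2 + 2 * real n * L\<^sup>2 * vphi\<^sup>2 * (u0 + u1)"
proof -
  define p where "p = vmax (\<pi> k)"
  define C where "C = L\<^sup>2 * real n * vphi\<^sup>2"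
  have p: "0 \<le> p" "p \<le> 1"
    using less_imp_le[OF less_le_trans[OF pi_pos vmax_ge]] vmax_pi_noise(2)[OF u2] by (auto simp: p_def)
  have C: "0 \<le> C" by (simp add: C_def)
  have int: "integrable Pr (\<lambda>\<omega>. (norm (nsum k \<omega>))\<^sup>2)" "integrable Pr (\<lambda>\<omega>. inner (gsum k \<omega>) (nsum k \<omega>))"
    by (intro sq_integrable_norm_sq sq_integrable_inner gsum_sq nsum_sq)+
  note ints = int opt_err_integrable cons_err_integrable track_err_integrable
  have pw: "y_sq_sum k \<omega> \<le> p * (track_err k \<omega> + (C * (cons_err k \<omega> + opt_err k \<omega>)
      + 2 * inner (gsum k \<omega>) (nsum k \<omega>) + (norm (nsum k \<omega>))\<^sup>2))" if "\<omega> \<in> space Pr" for \<omega>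
  proof -
    have "(norm (\<Sum>i\<in>UNIV. y k \<omega> $ i))\<^sup>2 =
        (norm (gsum k \<omega>))\<^sup>2 + 2 * inner (gsum k \<omega>) (nsum k \<omega>) + (norm (nsum k \<omega>))\<^sup>2"
      unfolding sum_y[OF that] sum.distrib power2_norm_eq_inner
      by (simp only: inner_add_left inner_add_right inner_commute[of "nsum k \<omega>" "gsum k \<omega>"])
    moreover have "(norm (gsum k \<omega>))\<^sup>2 \<le> C * (cons_err k \<omega> + opt_err k \<omega>)"
      using gsum_diff_sq_le[of k \<omega> xstar] by (simp add: gradF_xstar C_def opt_err_def)
    moreover have "y_sq_sum k \<omega> \<le> p * (track_err k \<omega> + (norm (\<Sum>i\<in>UNIV. y k \<omega> $ i))\<^sup>2)"
      unfolding y_sq_sum_def track_err_def p_def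
      by (rule sum_norm_sq_le_disp[OF pi_pos pi_sum vmax_ge])
    ultimately show ?thesis
      using mult_left_mono[OF _ p(1)] by (smt (verit, best) order_trans)
  qed
  have "expectation (y_sq_sum k) \<le> expectation (\<lambda>\<omega>. p * (track_err k \<omega> + (C * (cons_err k \<omega> + opt_err k \<omega>)
      + 2 * inner (gsum k \<omega>) (nsum k \<omega>) + (norm (nsum k \<omega>))\<^sup>2)))"
    by (intro integral_mono y_sq_sum_integrable pw) (use ints in simp_all)
  also have "\<dots> = p * (expectation (track_err k) + (C * (expectation (cons_err k) + expectation (opt_err k))
      + expectation (\<lambda>\<omega>. (norm (nsum k \<omega>))\<^sup>2)))"
    using ints expectation_inner_nsum[OF gsum_meas gsum_sq, of k] by simp
  also have "\<dots> \<le> p * (u2 + (C * (u1 + u0) + real n * \<sigma>\<^sup>2))"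
    using assms p C expectation_nsum_sq_le by (intro mult_left_mono add_mono) auto
  finally have *: "expectation (y_sq_sum k) \<le> p * (u2 + (C * (u1 + u0) + real n * \<sigma>\<^sup>2))" .
  define Z where "Z = C * (u1 + u0)"
  have "0 \<le> expectation (cons_err k)" "0 \<le> expectation (opt_err k)"
    by (intro integral_nonneg_AE AE_I2 cons_err_nonneg, simp add: opt_err_def)
  then have Z: "0 \<le> Z" unfolding Z_def using assms C by (intro mult_nonneg_nonneg) auto
  have "p * (u2 + (Z + real n * \<sigma>\<^sup>2)) = p * u2 + p * Z + p * (real n * \<sigma>\<^sup>2)"
    by (simp add: distrib_left)
  moreover have "p * Z \<le> 1 * Z" using p Z by (intro mult_right_mono)
  moreover have "p * (real n * \<sigma>\<^sup>2) \<le> (1 - p) * u2" unfolding p_def by (rule vmax_pi_noise(1)[OF u2])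
  moreover have "(1 - p) * u2 = u2 - p * u2" by (simp add: left_diff_distrib)
  moreover have "0 \<le> \<sigma>\<^sup>2" by simp
  ultimately have "expectation (y_sq_sum k) \<le> u2 + 2 * \<sigma>\<^sup>2 + 2 * Z"
    using * Z unfolding Z_def[symmetric] by linarith
  then show ?thesis by (simp add: Z_def C_def mult_ac add.commute)
qed

section \<open>One step of the consensus error and of the distance to the minimizer\<close>

lemma cons_err_step:
  assumes "\<omega> \<in> space Pr"
  shows "cons_err (Suc k) \<omega> \<le> (1 + c\<^sup>2) / 2 * cons_err k \<omega> + (1 + c\<^sup>2) / (1 - c\<^sup>2) * \<alpha>\<^sup>2 * y_sq_sum k \<omega>"
  unfolding cons_err_def y_sq_sum_def x_step[OF assms]
  by (rule wvar_step[OF less_imp_le[OF phi_pos] phi_sum phi_A A_contraction c_range])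

lemma expectation_cons_err_step: "expectation (cons_err (Suc k)) \<le>
    (1 + c\<^sup>2) / 2 * expectation (cons_err k) + (1 + c\<^sup>2) / (1 - c\<^sup>2) * \<alpha>\<^sup>2 * expectation (y_sq_sum k)"
proof -
  have "expectation (cons_err (Suc k)) \<le>
      expectation (\<lambda>\<omega>. (1 + c\<^sup>2) / 2 * cons_err k \<omega> + (1 + c\<^sup>2) / (1 - c\<^sup>2) * \<alpha>\<^sup>2 * y_sq_sum k \<omega>)"
    by (intro integral_mono cons_err_integrable cons_err_step Bochner_Integration.integrable_add
        integrable_mult_right y_sq_sum_integrable)
  also have "\<dots> = (1 + c\<^sup>2) / 2 * expectation (cons_err k) + (1 + c\<^sup>2) / (1 - c\<^sup>2) * \<alpha>\<^sup>2 * expectation (y_sq_sum k)"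
    by (subst Bochner_Integration.integral_add)
      (intro integrable_mult_right cons_err_integrable y_sq_sum_integrable | simp)+
  finally show ?thesis .
qed

lemma xhat_step:
  assumes "\<omega> \<in> space Pr"
  shows "xhat (Suc k) \<omega> = xhat k \<omega> - \<alpha> *\<^sub>R (\<Sum>i\<in>UNIV. \<phi> (Suc k) $ i *\<^sub>R y k \<omega> $ i)"
proof -
  have "(\<Sum>i\<in>UNIV. \<phi> (Suc k) $ i *\<^sub>R (\<Sum>j\<in>UNIV. A k $ i $ j *\<^sub>R x k \<omega> $ j)) = xhat k \<omega>"
    unfolding xhat_def wmean_def scaleR_sum_right
    by (subst sum.swap) (simp add: phi_A scaleR_left.sum[symmetric])
  then show ?thesis
    unfolding xhat_def[of "Suc k"] wmean_def x_step[OF assms]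
    by (simp add: scaleR_diff_right sum_subtractf scaleR_sum_right mult.commute)
qed

text \<open>The averaged tracker is \<open>\<eta>k\<close> times the sum of the trackers plus a
  remainder controlled by the dispersion. The noiseless part of the step depends on earlier samples,
  so its product with the noise is kept and later averages to 0. The remainder contains the current
  noise; its product with the noise is estimated, at the price of the extra term on the left of
  \<open>perturbed_gradient_step\<close>.\<close>

lemma opt_err_step:
  fixes k
  defines "\<eta>k \<equiv> inner (\<phi> (Suc k)) (\<pi> k)"
  assumes \<omega>: "\<omega> \<in> space Pr"
  shows "opt_err (Suc k) \<omega> \<le> (1 - real n * \<mu> * \<eta> / 2 * \<alpha>) * opt_err k \<omega>
      + 3 * L\<^sup>2 * vphi\<^sup>2 / \<mu> * \<alpha> * cons_err k \<omega> + 3 / (real n * \<mu> * \<eta>) * \<alpha> * track_err k \<omega>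
      + 3 / 2 * \<alpha>\<^sup>2 * (norm (nsum k \<omega>))\<^sup>2
      - 2 * \<alpha> * \<eta>k * inner (xhat k \<omega> - xstar - (\<alpha> * \<eta>k) *\<^sub>R gsum k \<omega>) (nsum k \<omega>)"
proof -
  define r where "r = xhat k \<omega> - xstar"
  define N where "N = nsum k \<omega>"
  define G where "G = gsum k \<omega>"
  define Q where "Q = (\<Sum>i\<in>UNIV. \<phi> (Suc k) $ i *\<^sub>R y k \<omega> $ i) - \<eta>k *\<^sub>R (G + N)"
  have \<eta>k_sum: "\<eta>k = (\<Sum>i\<in>UNIV. \<phi> (Suc k) $ i * \<pi> k $ i)"
    by (simp add: \<eta>k_def inner_vec_def)
  have \<eta>k_le: "\<eta>k \<le> 1"
  proof -
    have "\<eta>k \<le> (\<Sum>i\<in>UNIV. 1 * \<pi> k $ i)"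
      unfolding \<eta>k_sum by (intro sum_mono mult_right_mono phi_le_1 less_imp_le[OF pi_pos])
    then show ?thesis by (simp add: pi_sum)
  qed
  have \<eta>k: "\<eta> \<le> \<eta>k" unfolding \<eta>k_def by (rule eta_bound)
  have sumy: "(\<Sum>i\<in>UNIV. y k \<omega> $ i) = G + N"
    by (simp add: sum_y[OF \<omega>] sum.distrib G_def N_def)
  \<comment> \<open>The products of the two weights add up to \<open>\<eta>k\<close>, which is the
    total mass in the Cauchy-Schwarz inequality that follows.\<close>
  have "Q = (\<Sum>i\<in>UNIV. (\<phi> (Suc k) $ i * \<pi> k $ i) *\<^sub>R ((1 / \<pi> k $ i) *\<^sub>R y k \<omega> $ i - (G + N)))"
  proof -
    have "\<pi> k $ i \<noteq> 0" for i using pi_pos[of k i] by simp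
    then show ?thesis
      by (simp add: Q_def \<eta>k_sum scaleR_diff_right sum_subtractf scaleR_left.sum)
  qed
  then have "(norm Q)\<^sup>2 \<le> \<eta>k * (\<Sum>i\<in>UNIV. (\<phi> (Suc k) $ i * \<pi> k $ i) *
      (norm ((1 / \<pi> k $ i) *\<^sub>R y k \<omega> $ i - (G + N)))\<^sup>2)"
    unfolding \<eta>k_sum using norm_weighted_sum_sq_le[of "\<lambda>i. \<phi> (Suc k) $ i * \<pi> k $ i"]
    by (simp add: less_imp_le[OF phi_pos] less_imp_le[OF pi_pos])
  also have "\<dots> \<le> \<eta>k * track_err k \<omega>"
    unfolding track_err_def disp_def sumy
  proof (intro mult_left_mono sum_mono mult_right_mono)
    show "\<phi> (Suc k) $ i * \<pi> k $ i \<le> \<pi> k $ i" for i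
      using phi_le_1[of "Suc k" i] pi_pos[of k i] phi_pos[of "Suc k" i] by (simp add: mult_left_le_one_le)
    show "0 \<le> \<eta>k" using \<eta>k eta_range by linarith
  qed simp
  finally have Q: "(norm Q)\<^sup>2 \<le> \<eta>k * track_err k \<omega>" .
  have step: "(norm (r - (\<alpha> * \<eta>k) *\<^sub>R G - \<alpha> *\<^sub>R Q))\<^sup>2 + 2 * \<alpha>\<^sup>2 * (norm Q)\<^sup>2 \<le>
      (1 - real n * \<mu> * \<eta> / 2 * \<alpha>) * (norm r)\<^sup>2 + 3 * L\<^sup>2 * vphi\<^sup>2 / \<mu> * \<alpha> * cons_err k \<omega>
      + 3 / (real n * \<mu> * \<eta>) * \<alpha> * track_err k \<omega>"
  proof (rule perturbed_gradient_step[where gF = "gradF (xhat k \<omega>)"])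
    show "\<mu> * (norm r)\<^sup>2 \<le> inner (gradF (xhat k \<omega>)) r"
      using strongly_convex[of "xhat k \<omega>" xstar] by (simp add: gradF_xstar r_def)
    show "norm (gradF (xhat k \<omega>)) \<le> L * norm r"
      using gradF_lip[of "xhat k \<omega>" xstar] by (simp add: gradF_xstar r_def)
    show "(norm (G - real n *\<^sub>R gradF (xhat k \<omega>)))\<^sup>2 \<le> L\<^sup>2 * real n * vphi\<^sup>2 * cons_err k \<omega>"
      using gsum_diff_sq_le[of k \<omega> "xhat k \<omega>"] by (simp add: G_def)
  qed (use mu_pos mu_le_L eta_range \<eta>k \<eta>k_le n_ge_2 alpha_pos alpha_n_L_le Q cons_err_nonneg
        track_err_nonneg in simp_all)
  define T where "T = r - (\<alpha> * \<eta>k) *\<^sub>R G"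
  \<comment> \<open>The product costs half a squared noise and the noise itself one more, as
    \<open>\<eta>k\<close> is at most 1; together these are the 3/2 of the first entry of
    \<open>b_vec\<close>.\<close>
  have young: "2 * \<eta>k * inner Q N + \<eta>k\<^sup>2 * (norm N)\<^sup>2 \<le> 2 * (norm Q)\<^sup>2 + 3 / 2 * (norm N)\<^sup>2"
  proof -
    have "0 \<le> (norm (2 *\<^sub>R Q - \<eta>k *\<^sub>R N))\<^sup>2" by simp
    also have "\<dots> = 4 * (norm Q)\<^sup>2 - 4 * \<eta>k * inner Q N + \<eta>k\<^sup>2 * (norm N)\<^sup>2"
      unfolding power2_norm_eq_inner
      by (simp add: inner_diff_left inner_diff_right inner_commute power2_eq_square)
    finally have "4 * \<eta>k * inner Q N \<le> 4 * (norm Q)\<^sup>2 + \<eta>k\<^sup>2 * (norm N)\<^sup>2" by simp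
    moreover have "\<eta>k\<^sup>2 * (norm N)\<^sup>2 \<le> 1 * (norm N)\<^sup>2"
      using \<eta>k_le \<eta>k eta_range by (intro mult_right_mono power_le_one) auto
    ultimately show ?thesis by linarith
  qed
  have "xhat (Suc k) \<omega> - xstar = (T - \<alpha> *\<^sub>R Q) - (\<alpha> * \<eta>k) *\<^sub>R N"
    unfolding xhat_step[OF \<omega>] T_def Q_def r_def by (simp add: algebra_simps)
  then have "opt_err (Suc k) \<omega> = (norm ((T - \<alpha> *\<^sub>R Q) - (\<alpha> * \<eta>k) *\<^sub>R N))\<^sup>2"
    by (simp only: opt_err_def)
  also have "\<dots> = (norm (T - \<alpha> *\<^sub>R Q))\<^sup>2 - 2 * inner (T - \<alpha> *\<^sub>R Q) ((\<alpha> * \<eta>k) *\<^sub>R N)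
      + (norm ((\<alpha> * \<eta>k) *\<^sub>R N))\<^sup>2"
    unfolding power2_norm_eq_inner
    by (simp only: inner_diff_left[of _ "(\<alpha> * \<eta>k) *\<^sub>R N"] inner_diff_right[of _ "T - \<alpha> *\<^sub>R Q"]
        inner_commute[of "(\<alpha> * \<eta>k) *\<^sub>R N" "T - \<alpha> *\<^sub>R Q"])
  also have "\<dots> = (norm (T - \<alpha> *\<^sub>R Q))\<^sup>2 - 2 * (\<alpha> * \<eta>k) * inner T N
      + \<alpha>\<^sup>2 * (2 * \<eta>k * inner Q N + \<eta>k\<^sup>2 * (norm N)\<^sup>2)"
    by (simp add: inner_diff_left power_mult_distrib power2_eq_square[of \<alpha>] algebra_simps)
  also have "\<dots> \<le> (norm (T - \<alpha> *\<^sub>R Q))\<^sup>2 - 2 * (\<alpha> * \<eta>k) * inner T N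
      + \<alpha>\<^sup>2 * (2 * (norm Q)\<^sup>2 + 3 / 2 * (norm N)\<^sup>2)"
    using young by (intro add_left_mono mult_left_mono) auto
  also have "\<dots> = ((norm (T - \<alpha> *\<^sub>R Q))\<^sup>2 + 2 * \<alpha>\<^sup>2 * (norm Q)\<^sup>2) + 3 / 2 * \<alpha>\<^sup>2 * (norm N)\<^sup>2
      - 2 * \<alpha> * \<eta>k * inner T N"
    by (simp add: algebra_simps)
  finally show ?thesis
    using step unfolding T_def r_def N_def G_def opt_err_def by linarith
qed

lemma expectation_opt_err_step: "expectation (opt_err (Suc k)) \<le>
    (1 - real n * \<mu> * \<eta> / 2 * \<alpha>) * expectation (opt_err k)
    + 3 * L\<^sup>2 * vphi\<^sup>2 / \<mu> * \<alpha> * expectation (cons_err k)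
    + 3 / (real n * \<mu> * \<eta>) * \<alpha> * expectation (track_err k) + 3 / 2 * \<alpha>\<^sup>2 * (real n * \<sigma>\<^sup>2)"
proof -
  define \<eta>k where "\<eta>k = inner (\<phi> (Suc k)) (\<pi> k)"
  define T where "T \<omega> = xhat k \<omega> - xstar - (\<alpha> * \<eta>k) *\<^sub>R gsum k \<omega>" for \<omega>
  define m where "m = (1 - real n * \<mu> * \<eta> / 2 * \<alpha>)"
  define m' where "m' = 3 * L\<^sup>2 * vphi\<^sup>2 / \<mu> * \<alpha>"
  define m'' where "m'' = 3 / (real n * \<mu> * \<eta>) * \<alpha>"
  have T: "T \<in> borel_measurable (\<F> k)" "sq_integrable T"
    unfolding T_def
    by (intro borel_measurable_diff borel_measurable_scaleR borel_measurable_const xhat_meas gsum_meas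
        sq_integrable_diff sq_integrable_scaleR sq_integrable_const xhat_sq gsum_sq)+
  have ints: "integrable Pr (\<lambda>\<omega>. (norm (nsum k \<omega>))\<^sup>2)" "integrable Pr (\<lambda>\<omega>. inner (T \<omega>) (nsum k \<omega>))"
    "integrable Pr (opt_err k)" "integrable Pr (cons_err k)" "integrable Pr (track_err k)"
    by (intro sq_integrable_norm_sq sq_integrable_inner nsum_sq T opt_err_integrable cons_err_integrable
        track_err_integrable)+
  have "expectation (opt_err (Suc k)) \<le> expectation (\<lambda>\<omega>. m * opt_err k \<omega> + m' * cons_err k \<omega>
      + m'' * track_err k \<omega> + 3 / 2 * \<alpha>\<^sup>2 * (norm (nsum k \<omega>))\<^sup>2 - 2 * \<alpha> * \<eta>k * inner (T \<omega>) (nsum k \<omega>))"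
    using opt_err_step[of _ k] unfolding m_def m'_def m''_def T_def \<eta>k_def
    by (intro integral_mono opt_err_integrable) (use ints in \<open>simp_all add: T_def \<eta>k_def\<close>)
  also have "\<dots> = m * expectation (opt_err k) + m' * expectation (cons_err k)
      + m'' * expectation (track_err k) + 3 / 2 * \<alpha>\<^sup>2 * expectation (\<lambda>\<omega>. (norm (nsum k \<omega>))\<^sup>2)"
    using ints expectation_inner_nsum[OF T] by simp
  also have "\<dots> \<le> m * expectation (opt_err k) + m' * expectation (cons_err k)
      + m'' * expectation (track_err k) + 3 / 2 * \<alpha>\<^sup>2 * (real n * \<sigma>\<^sup>2)"
    using expectation_nsum_sq_le by (intro add_left_mono mult_left_mono) auto
  finally show ?thesis by (simp only: m_def m'_def m''_def)
qed

section \<open>One step of the dispersion of the trackers\<close>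

lemma expectation_inner_noise_combination:
  "expectation (\<lambda>\<omega>. inner (\<Sum>j\<in>UNIV. w j *\<^sub>R noise k j \<omega>) (noise k i \<omega>)) =
    w i * expectation (\<lambda>\<omega>. (norm (noise k i \<omega>))\<^sup>2)"
proof -
  have int: "integrable Pr (\<lambda>\<omega>. inner (noise k j \<omega>) (noise k i \<omega>))" for j
    by (intro sq_integrable_inner noise_sq)
  have "expectation (\<lambda>\<omega>. inner (\<Sum>j\<in>UNIV. w j *\<^sub>R noise k j \<omega>) (noise k i \<omega>)) =
      (\<Sum>j\<in>UNIV. w j * expectation (\<lambda>\<omega>. inner (noise k j \<omega>) (noise k i \<omega>)))"
    using int by (simp add: inner_sum_left)
  also have "\<dots> = (\<Sum>j\<in>UNIV. if j = i then w i * expectation (\<lambda>\<omega>. (norm (noise k i \<omega>))\<^sup>2) else 0)"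
    by (intro sum.cong refl) (auto simp: noise_agents_uncorrelated power2_norm_eq_inner)
  finally show ?thesis by simp
qed

lemma expectation_disp_form_noise:
  fixes W :: "'n \<Rightarrow> 'w \<Rightarrow> real^'p"
  assumes "\<And>i. W i \<in> borel_measurable (\<F> k)" "\<And>i. sq_integrable (W i)"
  shows "expectation (\<lambda>\<omega>. disp_form q (\<lambda>i. W i \<omega>) (\<lambda>i. noise k i \<omega>)) = 0"
proof -
  have W: "(\<lambda>\<omega>. \<Sum>i\<in>UNIV. W i \<omega>) \<in> borel_measurable (\<F> k)" "sq_integrable (\<lambda>\<omega>. \<Sum>i\<in>UNIV. W i \<omega>)"
    using assms by (intro borel_measurable_sum sq_integrable_sum; simp)+
  have int: "integrable Pr (\<lambda>\<omega>. 1 / q i * inner (W i \<omega>) (noise k i \<omega>))" for i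
    by (intro integrable_mult_right sq_integrable_inner assms noise_sq)
  have int': "integrable Pr (\<lambda>\<omega>. inner (\<Sum>i\<in>UNIV. W i \<omega>) (nsum k \<omega>))"
    by (intro sq_integrable_inner W nsum_sq)
  have "expectation (\<lambda>\<omega>. disp_form q (\<lambda>i. W i \<omega>) (\<lambda>i. noise k i \<omega>)) =
      (\<Sum>i\<in>UNIV. expectation (\<lambda>\<omega>. 1 / q i * inner (W i \<omega>) (noise k i \<omega>)))
      - expectation (\<lambda>\<omega>. inner (\<Sum>i\<in>UNIV. W i \<omega>) (nsum k \<omega>))"
    unfolding disp_form_def
    by (subst Bochner_Integration.integral_diff)
      (intro Bochner_Integration.integrable_sum int int' | simp only: Bochner_Integration.integral_sum[OF int])+
  also have "\<dots> = 0"
    using expectation_inner_nsum[OF W] noise_uncorrelated[OF assms] by simp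
  finally show ?thesis .
qed

text \<open>Noises of different agents are orthogonal, so the squared sum in the dispersion
  subtracts one full variance per agent. The weights become \<open>1 / \<pi> l $ i - 1\<close>, each
  at most \<open>\<psi> / n\<close>.\<close>

lemma expectation_disp_noise_le:
  "expectation (\<lambda>\<omega>. disp (\<lambda>i. \<pi> l $ i) (\<lambda>i. noise k i \<omega>)) \<le> \<psi> * \<sigma>\<^sup>2"
proof -
  define v where "v i = expectation (\<lambda>\<omega>. (norm (noise k i \<omega>))\<^sup>2)" for i
  have v: "0 \<le> v i" "v i \<le> \<sigma>\<^sup>2" for i
    unfolding v_def by (rule integral_nonneg_AE, simp) (rule noise_sq)
  have int: "integrable Pr (\<lambda>\<omega>. 1 / \<pi> l $ i * (norm (noise k i \<omega>))\<^sup>2)" for i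
    by (intro integrable_mult_right sq_integrable_norm_sq noise_sq)
  have int': "integrable Pr (\<lambda>\<omega>. (norm (nsum k \<omega>))\<^sup>2)" by (intro sq_integrable_norm_sq nsum_sq)
  have "disp (\<lambda>i. \<pi> l $ i) (\<lambda>i. noise k i \<omega>) =
      (\<Sum>i\<in>UNIV. 1 / \<pi> l $ i * (norm (noise k i \<omega>))\<^sup>2) - (norm (nsum k \<omega>))\<^sup>2" for \<omega>
    unfolding sum_norm_sq_div_weight[OF pi_pos pi_sum] by simp
  then have "expectation (\<lambda>\<omega>. disp (\<lambda>i. \<pi> l $ i) (\<lambda>i. noise k i \<omega>)) =
      (\<Sum>i\<in>UNIV. expectation (\<lambda>\<omega>. 1 / \<pi> l $ i * (norm (noise k i \<omega>))\<^sup>2)) - (\<Sum>i\<in>UNIV. v i)"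
    unfolding v_def expectation_noise_sum_sq[symmetric]
    by (simp only:) (subst Bochner_Integration.integral_diff,
      (intro Bochner_Integration.integrable_sum int int' | simp only: Bochner_Integration.integral_sum[OF int])+)
  also have "\<dots> = (\<Sum>i\<in>UNIV. (1 / \<pi> l $ i - 1) * v i)"
    by (simp add: v_def left_diff_distrib sum_subtractf)
  also have "\<dots> \<le> (\<Sum>i\<in>(UNIV :: 'n set). \<psi> / real n * \<sigma>\<^sup>2)"
  proof (intro sum_mono mult_mono v)
    show "1 / \<pi> l $ i - 1 \<le> \<psi> / real n" for i
      using inv_pi_minus_1_le[of l i] n_ge_2 by (simp add: pos_le_divide_eq mult.commute)
    show "0 \<le> \<psi> / real n" using psi_pos by simp
  qed
  also have "\<dots> = \<psi> * \<sigma>\<^sup>2" using n_ge_2 by (simp add: n_def)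
  finally show ?thesis .
qed

text \<open>The noise of round k enters the next trackers twice, mixed by \<open>B k\<close> and
  subtracted with the old oracle value. In the product of the two only the diagonal of
  \<open>B k\<close> survives, and it is nonnegative; the negative part is the variance of the
  summed noise. The form occurs with coefficient -2, so a lower bound is needed.\<close>

lemma expectation_disp_form_mixed_noise_ge:
  "- (real n * \<sigma>\<^sup>2) \<le> expectation (\<lambda>\<omega>. disp_form (\<lambda>i. \<pi> l $ i)
    (\<lambda>i. \<Sum>j\<in>UNIV. B k $ i $ j *\<^sub>R noise k j \<omega>) (\<lambda>i. noise k i \<omega>))"
proof -
  define v where "v i = expectation (\<lambda>\<omega>. (norm (noise k i \<omega>))\<^sup>2)" for i
  have v: "0 \<le> v i" for i
    unfolding v_def by (rule integral_nonneg_AE) simp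
  have sum_B: "(\<Sum>i\<in>UNIV. \<Sum>j\<in>UNIV. B k $ i $ j *\<^sub>R noise k j \<omega>) = nsum k \<omega>" for \<omega>
    by (subst sum.swap) (simp add: scaleR_left.sum[symmetric] B_col)
  have int: "integrable Pr (\<lambda>\<omega>. 1 / \<pi> l $ i *
      inner (\<Sum>j\<in>UNIV. B k $ i $ j *\<^sub>R noise k j \<omega>) (noise k i \<omega>))" for i
    by (intro integrable_mult_right sq_integrable_inner sq_integrable_sum sq_integrable_scaleR noise_sq) simp
  have int': "integrable Pr (\<lambda>\<omega>. inner (nsum k \<omega>) (nsum k \<omega>))" by (intro sq_integrable_inner nsum_sq)
  have "expectation (\<lambda>\<omega>. disp_form (\<lambda>i. \<pi> l $ i)
      (\<lambda>i. \<Sum>j\<in>UNIV. B k $ i $ j *\<^sub>R noise k j \<omega>) (\<lambda>i. noise k i \<omega>)) =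
    (\<Sum>i\<in>UNIV. expectation (\<lambda>\<omega>. 1 / \<pi> l $ i *
      inner (\<Sum>j\<in>UNIV. B k $ i $ j *\<^sub>R noise k j \<omega>) (noise k i \<omega>)))
    - expectation (\<lambda>\<omega>. inner (nsum k \<omega>) (nsum k \<omega>))"
    unfolding disp_form_def sum_B
    by (subst Bochner_Integration.integral_diff)
      (intro Bochner_Integration.integrable_sum int int' | simp only: Bochner_Integration.integral_sum[OF int])+
  also have "expectation (\<lambda>\<omega>. inner (nsum k \<omega>) (nsum k \<omega>)) = (\<Sum>i\<in>UNIV. v i)"
    using expectation_noise_sum_sq[of k] by (simp only: v_def power2_norm_eq_inner)
  also have "(\<Sum>i\<in>UNIV. expectation (\<lambda>\<omega>. 1 / \<pi> l $ i *
      inner (\<Sum>j\<in>UNIV. B k $ i $ j *\<^sub>R noise k j \<omega>) (noise k i \<omega>))) =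
    (\<Sum>i\<in>UNIV. 1 / \<pi> l $ i * (B k $ i $ i * v i))"
    by (simp only: integral_mult_right_zero expectation_inner_noise_combination v_def)
  finally have eq: "expectation (\<lambda>\<omega>. disp_form (\<lambda>i. \<pi> l $ i)
      (\<lambda>i. \<Sum>j\<in>UNIV. B k $ i $ j *\<^sub>R noise k j \<omega>) (\<lambda>i. noise k i \<omega>)) =
    (\<Sum>i\<in>UNIV. 1 / \<pi> l $ i * (B k $ i $ i * v i)) - (\<Sum>i\<in>UNIV. v i)" .
  have "0 \<le> (\<Sum>i\<in>UNIV. 1 / \<pi> l $ i * (B k $ i $ i * v i))"
    by (intro sum_nonneg mult_nonneg_nonneg B_nonneg v) (simp add: less_imp_le[OF pi_pos])
  moreover have "(\<Sum>i\<in>UNIV. v i) \<le> real n * \<sigma>\<^sup>2"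
    unfolding v_def by (rule expectation_sum_noise_sq_le)
  ultimately show ?thesis unfolding eq by linarith
qed

text \<open>\<open>y_pred\<close> and the following \<open>x_pred\<close> are the trackers of round
  k and the next iterates with the noise of round k removed. They are determined by the earlier
  samples, hence orthogonal to that noise, and \<open>x_pred\<close> differs from the true next
  iterate by \<alpha> times the noise only.\<close>

definition y_pred :: "nat \<Rightarrow> 'n \<Rightarrow> 'w \<Rightarrow> real^'p" where
  "y_pred k i \<omega> = y k \<omega> $ i - noise k i \<omega>"

definition x_pred :: "nat \<Rightarrow> 'n \<Rightarrow> 'w \<Rightarrow> real^'p" where
  "x_pred k i \<omega> = (\<Sum>j\<in>UNIV. A k $ i $ j *\<^sub>R x k \<omega> $ j) - \<alpha> *\<^sub>R y_pred k i \<omega>"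

lemma y_pred_sq: "sq_integrable (y_pred k i)"
  unfolding y_pred_def by (intro sq_integrable_diff y_sq noise_sq)

lemma y_pred_meas: "y_pred k i \<in> borel_measurable (\<F> k)"
proof (cases k)
  case 0
  have "y_pred 0 i \<in> borel_measurable (\<F> 0) \<longleftrightarrow> grad 0 i \<in> borel_measurable (\<F> 0)"
    by (rule measurable_cong) (simp add: y_pred_def y_init')
  then show ?thesis unfolding 0 using grad_meas by blast
next
  case (Suc l)
  have "y_pred (Suc l) i \<in> borel_measurable (\<F> (Suc l)) \<longleftrightarrow>
      (\<lambda>\<omega>. (\<Sum>j\<in>UNIV. B l $ i $ j *\<^sub>R y l \<omega> $ j) + (grad (Suc l) i \<omega> - grad l i \<omega>) - noise l i \<omega>)
        \<in> borel_measurable (\<F> (Suc l))"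
    by (rule measurable_cong) (simp add: y_pred_def y_step')
  moreover have "grad l i \<in> borel_measurable (\<F> (Suc l))" by (rule F_mono[OF grad_meas]) simp
  moreover have "noise l i \<in> borel_measurable (\<F> (Suc l))" by (rule noise_meas_F) simp
  ultimately show ?thesis
    using Suc y_meas grad_meas by (simp add: borel_measurable_diff borel_measurable_add)
qed

lemma x_pred_sq: "sq_integrable (x_pred k i)"
  unfolding x_pred_def
  by (intro sq_integrable_diff sq_integrable_sum sq_integrable_scaleR x_sq y_pred_sq) simp

lemma x_pred_meas: "x_pred k i \<in> borel_measurable (\<F> k)"
  unfolding x_pred_def
  by (intro borel_measurable_diff borel_measurable_sum borel_measurable_scaleR borel_measurable_const
      x_meas y_pred_meas)

lemma x_step_pred: "\<omega> \<in> space Pr \<Longrightarrow> x (Suc k) \<omega> $ i = x_pred k i \<omega> - \<alpha> *\<^sub>R noise k i \<omega>"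
  by (simp add: x_step x_pred_def y_pred_def algebra_simps)

lemma sum_grad_diff_sq_le:
  assumes "\<omega> \<in> space Pr"
  shows "(\<Sum>i\<in>UNIV. (norm (grad (Suc k) i \<omega> - grad k i \<omega>))\<^sup>2) \<le>
    L\<^sup>2 * (8 * vphi\<^sup>2 * cons_err k \<omega> + 2 * \<alpha>\<^sup>2 * y_sq_sum k \<omega>)"
proof -
  have contr: "(\<Sum>i\<in>UNIV. \<phi> (Suc k) $ i *
      (norm ((\<Sum>j\<in>UNIV. A k $ i $ j *\<^sub>R x k \<omega> $ j) - wmean (\<lambda>i. \<phi> k $ i) (\<lambda>i. x k \<omega> $ i)))\<^sup>2)
      \<le> wvar (\<lambda>i. \<phi> k $ i) (\<lambda>i. x k \<omega> $ i)"
    using A_contraction[of k "\<lambda>i. x k \<omega> $ i"] c_sq cons_err_nonneg[of k \<omega>]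
      mult_right_mono[of "c\<^sup>2" 1 "wvar (\<lambda>i. \<phi> k $ i) (\<lambda>i. x k \<omega> $ i)"]
    unfolding cons_err_def by linarith
  have "(\<Sum>i\<in>UNIV. (norm (grad (Suc k) i \<omega> - grad k i \<omega>))\<^sup>2) \<le>
      (\<Sum>i\<in>UNIV. L\<^sup>2 * (norm (x (Suc k) \<omega> $ i - x k \<omega> $ i))\<^sup>2)"
    unfolding power_mult_distrib[symmetric] grad_def
    by (intro sum_mono power_mono gradf_lip) auto
  also have "\<dots> = L\<^sup>2 * (\<Sum>i\<in>UNIV. (norm (x (Suc k) \<omega> $ i - x k \<omega> $ i))\<^sup>2)"
    by (simp add: sum_distrib_left)
  also have "\<dots> \<le> L\<^sup>2 * (8 * vphi\<^sup>2 * cons_err k \<omega> + 2 * \<alpha>\<^sup>2 * y_sq_sum k \<omega>)"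
    unfolding x_step[OF assms] cons_err_def y_sq_sum_def
    by (intro mult_left_mono sum_norm_step_sq_le[OF phi_sum less_imp_le[OF phi_pos] _
          one_le_vphi_phi one_le_vphi_phi contr]) simp_all
  finally show ?thesis .
qed

text \<open>The new noise and the part of the old noise that multiplies
  past quantities are kept as the forms \<open>disp_form\<close>, whose expectations vanish.\<close>

lemma track_err_step:
  fixes k
  defines "p' \<equiv> \<lambda>i. \<pi> (Suc k) $ i"
  assumes \<omega>: "\<omega> \<in> space Pr"
  shows "track_err (Suc k) \<omega> \<le> (1 + \<tau>\<^sup>2) / 2 * track_err k \<omega>
      + 4 * vphi\<^sup>2 * \<nu> * cons_err k \<omega> + \<nu> * \<alpha>\<^sup>2 * y_sq_sum k \<omega>
      + disp p' (\<lambda>i. noise k i \<omega>) + disp p' (\<lambda>i. noise (Suc k) i \<omega>)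
      + 4 * L * \<alpha> * (\<psi> / real n) * (\<Sum>i\<in>UNIV. (norm (noise k i \<omega>))\<^sup>2)
      - 2 * disp_form p' (\<lambda>i. (\<Sum>j\<in>UNIV. B k $ i $ j *\<^sub>R y_pred k j \<omega>) + (gradf i (x_pred k i \<omega>) - grad k i \<omega>))
          (\<lambda>i. noise k i \<omega>)
      - 2 * disp_form p' (\<lambda>i. \<Sum>j\<in>UNIV. B k $ i $ j *\<^sub>R noise k j \<omega>) (\<lambda>i. noise k i \<omega>)
      + 2 * disp_form p' (\<lambda>i. (\<Sum>j\<in>UNIV. B k $ i $ j *\<^sub>R y k \<omega> $ j) + (grad (Suc k) i \<omega> - grad k i \<omega>) - noise k i \<omega>)
          (\<lambda>i. noise (Suc k) i \<omega>)"
proof -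
  have p'_pos: "0 < p' i" and p'_sum: "(\<Sum>i\<in>UNIV. p' i) = 1" for i
    unfolding p'_def by (rule pi_pos, rule pi_sum)
  note disp_simps = disp_add[OF p'_pos p'_sum] disp_diff[OF p'_pos p'_sum]
  define e e' where "e i = noise k i \<omega>" and "e' i = noise (Suc k) i \<omega>" for i
  define By BP Be where "By i = (\<Sum>j\<in>UNIV. B k $ i $ j *\<^sub>R y k \<omega> $ j)"
    and "BP i = (\<Sum>j\<in>UNIV. B k $ i $ j *\<^sub>R y_pred k j \<omega>)"
    and "Be i = (\<Sum>j\<in>UNIV. B k $ i $ j *\<^sub>R e j)" for i
  \<comment> \<open>\<open>D1\<close> is the part of the gradient change that is known before round
    k; \<open>D2\<close> is the response of the gradients to the noise in the step and has norm at
    most \<open>L * \<alpha>\<close> times the noise.\<close>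
  define D D1 D2 where "D i = grad (Suc k) i \<omega> - grad k i \<omega>"
    and "D1 i = gradf i (x_pred k i \<omega>) - grad k i \<omega>"
    and "D2 i = grad (Suc k) i \<omega> - gradf i (x_pred k i \<omega>)" for i
  have split: "By i = BP i + Be i" "D i = D1 i + D2 i" for i
    by (simp_all add: By_def BP_def Be_def D_def D1_def D2_def y_pred_def e_def scaleR_diff_right sum_subtractf)
  have "track_err (Suc k) \<omega> = disp p' (\<lambda>i. (By i + D i - e i) + e' i)"
    unfolding track_err_def p'_def y_step'[OF \<omega>] By_def D_def e_def e'_def ..
  also have "\<dots> = disp p' (\<lambda>i. By i + D i - e i) + 2 * disp_form p' (\<lambda>i. By i + D i - e i) e' + disp p' e'"
    by (rule disp_simps)
  also have "disp p' (\<lambda>i. By i + D i - e i) =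
      disp p' (\<lambda>i. By i + D i) - 2 * disp_form p' (\<lambda>i. By i + D i) e + disp p' e"
    by (rule disp_simps)
  also have "disp_form p' (\<lambda>i. By i + D i) e =
      disp_form p' (\<lambda>i. BP i + D1 i) e + disp_form p' Be e + disp_form p' D2 e"
    unfolding split disp_form_add_left by simp
  also have "disp p' (\<lambda>i. By i + D i) = disp p' By + 2 * disp_form p' By D + disp p' D"
    by (rule disp_simps)
  finally have eq: "track_err (Suc k) \<omega> = disp p' By + 2 * disp_form p' By D + disp p' D
      - 2 * (disp_form p' (\<lambda>i. BP i + D1 i) e + disp_form p' Be e + disp_form p' D2 e) + disp p' e
      + 2 * disp_form p' (\<lambda>i. By i + D i - e i) e' + disp p' e'" .
  have main: "disp p' By + 2 * disp_form p' By D + disp p' D \<le> (1 + \<tau>\<^sup>2) / 2 * track_err k \<omega>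
      + 4 * vphi\<^sup>2 * \<nu> * cons_err k \<omega> + \<nu> * \<alpha>\<^sup>2 * y_sq_sum k \<omega>"
  proof -
    \<comment> \<open>Chosen so that \<open>(1 + \<theta>) * \<tau>\<^sup>2\<close> is the midpoint
      of \<open>\<tau>\<^sup>2\<close> and 1, the first summand of the last diagonal entry of
      M.\<close>
    define \<theta> where "\<theta> = (1 - \<tau>\<^sup>2) / (2 * \<tau>\<^sup>2)"
    have \<theta>: "0 < \<theta>" "(1 + \<theta>) * \<tau>\<^sup>2 = (1 + \<tau>\<^sup>2) / 2" "1 / \<theta> = 2 * \<tau>\<^sup>2 / (1 - \<tau>\<^sup>2)"
      using tau_sq by (simp_all add: \<theta>_def field_simps)
    have "2 * disp_form p' By D \<le> \<theta> * disp p' By + 1 / \<theta> * disp p' D"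
      using disp_form_young[OF p'_pos p'_sum \<theta>(1), of By D] by simp
    then have "disp p' By + 2 * disp_form p' By D + disp p' D \<le>
        (1 + \<theta>) * disp p' By + (disp p' D + 2 * \<tau>\<^sup>2 / (1 - \<tau>\<^sup>2) * disp p' D)"
      unfolding \<theta>(3) by (simp add: distrib_right)
    \<comment> \<open>The two copies of the dispersion of \<open>D\<close> are bounded differently,
      one through \<psi> and one through \<open>\<kappa>\<^sup>2\<close>; this reproduces the two
      summands of \<nu>.\<close>
    also have "\<dots> \<le> (1 + \<theta>) * (\<tau>\<^sup>2 * track_err k \<omega>)
        + (\<psi> * (\<Sum>i\<in>UNIV. (norm (D i))\<^sup>2) + 2 * \<tau>\<^sup>2 / (1 - \<tau>\<^sup>2) * (\<kappa>\<^sup>2 * (\<Sum>i\<in>UNIV. (norm (D i))\<^sup>2)))"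
    proof (intro add_mono mult_left_mono)
      show "disp p' By \<le> \<tau>\<^sup>2 * track_err k \<omega>"
        unfolding p'_def By_def track_err_def by (rule B_contraction)
      show "disp p' D \<le> \<psi> * (\<Sum>i\<in>UNIV. (norm (D i))\<^sup>2)"
        by (rule disp_le_sum_norm_sq[OF p'_pos p'_sum]) (simp only: p'_def inv_pi_le_psi)
      show "disp p' D \<le> \<kappa>\<^sup>2 * (\<Sum>i\<in>UNIV. (norm (D i))\<^sup>2)"
        by (rule disp_le_sum_norm_sq[OF p'_pos p'_sum]) (simp only: p'_def inv_pi_le)
      show "0 \<le> 2 * \<tau>\<^sup>2 / (1 - \<tau>\<^sup>2)" using tau_sq by simp
    qed (use \<theta> in simp)
    also have "\<dots> = (1 + \<tau>\<^sup>2) / 2 * track_err k \<omega>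
        + (\<psi> + 2 * \<tau>\<^sup>2 / (1 - \<tau>\<^sup>2) * \<kappa>\<^sup>2) * (\<Sum>i\<in>UNIV. (norm (D i))\<^sup>2)"
      unfolding \<theta>(2)[symmetric] by (simp add: distrib_right mult.assoc)
    also have "\<dots> \<le> (1 + \<tau>\<^sup>2) / 2 * track_err k \<omega> + (\<psi> + 2 * \<tau>\<^sup>2 / (1 - \<tau>\<^sup>2) * \<kappa>\<^sup>2) *
        (L\<^sup>2 * (8 * vphi\<^sup>2 * cons_err k \<omega> + 2 * \<alpha>\<^sup>2 * y_sq_sum k \<omega>))"
      unfolding D_def using sum_grad_diff_sq_le[OF \<omega>, of k] psi_pos tau_sq
      by (intro add_left_mono mult_left_mono) auto
    also have "(\<psi> + 2 * \<tau>\<^sup>2 / (1 - \<tau>\<^sup>2) * \<kappa>\<^sup>2) * (L\<^sup>2 * (8 * vphi\<^sup>2 * cons_err k \<omega> + 2 * \<alpha>\<^sup>2 * y_sq_sum k \<omega>)) =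
        \<nu> * (4 * vphi\<^sup>2 * cons_err k \<omega> + \<alpha>\<^sup>2 * y_sq_sum k \<omega>)"
    proof -
      have "(\<psi> + 2 * \<tau>\<^sup>2 / (1 - \<tau>\<^sup>2) * \<kappa>\<^sup>2) * L\<^sup>2 = \<nu> / 2"
        by (simp add: nu_const_def algebra_simps)
      moreover have "8 * vphi\<^sup>2 * cons_err k \<omega> + 2 * \<alpha>\<^sup>2 * y_sq_sum k \<omega> =
          2 * (4 * vphi\<^sup>2 * cons_err k \<omega> + \<alpha>\<^sup>2 * y_sq_sum k \<omega>)" by simp
      ultimately have "(\<psi> + 2 * \<tau>\<^sup>2 / (1 - \<tau>\<^sup>2) * \<kappa>\<^sup>2) * L\<^sup>2 * (8 * vphi\<^sup>2 * cons_err k \<omega> + 2 * \<alpha>\<^sup>2 * y_sq_sum k \<omega>) =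
          \<nu> / 2 * (2 * (4 * vphi\<^sup>2 * cons_err k \<omega> + \<alpha>\<^sup>2 * y_sq_sum k \<omega>))" by (simp only:)
      then show ?thesis by (simp only: mult.assoc)
    qed
    finally show ?thesis by (simp add: distrib_left mult_ac)
  qed
  \<comment> \<open>Young's inequality with parameter \<open>L * \<alpha>\<close> makes both
    resulting terms equal, each \<open>2 * L * \<alpha> * \<psi> / n\<close> times the squared
    noise, so the bound is linear in \<alpha>.\<close>
  have D2: "- 2 * disp_form p' D2 e \<le> 4 * L * \<alpha> * (\<psi> / real n) * (\<Sum>i\<in>UNIV. (norm (e i))\<^sup>2)"
  proof -
    define s where "s = (\<Sum>i\<in>UNIV. (norm (e i))\<^sup>2)"
    have q: "1 / p' i \<le> 2 * (\<psi> / real n)" for i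
      using n_inv_pi_le_psi[of "Suc k" i] n_ge_2 by (simp add: p'_def pos_le_divide_eq mult.commute)
    have La: "0 < L * \<alpha>" using L_pos alpha_pos by simp
    have "(norm (D2 i))\<^sup>2 \<le> (L * norm (x (Suc k) \<omega> $ i - x_pred k i \<omega>))\<^sup>2" for i
      unfolding D2_def grad_def by (intro power_mono gradf_lip) simp
    also have "\<dots> i = (L * \<alpha>)\<^sup>2 * (norm (e i))\<^sup>2" for i
      using alpha_pos by (simp add: x_step_pred[OF \<omega>] e_def power_mult_distrib)
    finally have D2e: "(\<Sum>i\<in>UNIV. (norm (D2 i))\<^sup>2) \<le> (L * \<alpha>)\<^sup>2 * s"
      unfolding s_def sum_distrib_left by (rule sum_mono)
    have "disp p' D2 \<le> 2 * (\<psi> / real n) * (\<Sum>i\<in>UNIV. (norm (D2 i))\<^sup>2)"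
      by (rule disp_le_sum_norm_sq[OF p'_pos p'_sum q])
    also have "\<dots> \<le> 2 * (\<psi> / real n) * ((L * \<alpha>)\<^sup>2 * s)"
      using D2e psi_pos by (intro mult_left_mono) auto
    finally have "disp p' D2 / (L * \<alpha>) \<le> 2 * (\<psi> / real n) * (L * \<alpha> * s)"
      using La by (simp add: pos_divide_le_eq power2_eq_square mult_ac)
    moreover have "L * \<alpha> * disp p' e \<le> L * \<alpha> * (2 * (\<psi> / real n) * s)"
      unfolding s_def using La by (intro mult_left_mono disp_le_sum_norm_sq[OF p'_pos p'_sum q]) simp
    moreover have "2 * \<bar>disp_form p' D2 e\<bar> \<le> L * \<alpha> * disp p' e + disp p' D2 / (L * \<alpha>)"
      using disp_form_young[OF p'_pos p'_sum La, of e D2] by (simp add: disp_form_commute)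
    ultimately have "- 2 * disp_form p' D2 e \<le> L * \<alpha> * (2 * (\<psi> / real n) * s) + 2 * (\<psi> / real n) * (L * \<alpha> * s)"
      by linarith
    then show ?thesis by (simp add: s_def mult_ac)
  qed
  show ?thesis
    using main D2 unfolding eq distrib_left e_def[symmetric] e'_def[symmetric] By_def[symmetric] BP_def[symmetric]
      Be_def[symmetric] D_def[symmetric] D1_def[symmetric]
    by linarith
qed

text \<open>The noise of two rounds contributes \<open>\<psi> * \<sigma>\<^sup>2\<close> each and
  the mixed product twice \<open>n * \<sigma>\<^sup>2\<close>, hence at most another
  \<open>2 * \<psi> * \<sigma>\<^sup>2\<close>. For n at least 2 the resulting constants fit into
  the first two coefficients in the last row of \<open>b_vec\<close>.\<close>

lemma expectation_track_err_step: "expectation (track_err (Suc k)) \<le>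
    (1 + \<tau>\<^sup>2) / 2 * expectation (track_err k) + 4 * vphi\<^sup>2 * \<nu> * expectation (cons_err k)
    + \<nu> * \<alpha>\<^sup>2 * expectation (y_sq_sum k) + (4 * real n * \<psi> * \<sigma>\<^sup>2 + 2 * L * real n * \<psi> * \<sigma>\<^sup>2 * \<alpha>)"
proof -
  define p' where "p' = (\<lambda>i. \<pi> (Suc k) $ i)"
  define F1 where "F1 \<omega> = disp_form p' (\<lambda>i. (\<Sum>j\<in>UNIV. B k $ i $ j *\<^sub>R y_pred k j \<omega>)
      + (gradf i (x_pred k i \<omega>) - grad k i \<omega>)) (\<lambda>i. noise k i \<omega>)" for \<omega>
  define F2 where "F2 \<omega> = disp_form p' (\<lambda>i. \<Sum>j\<in>UNIV. B k $ i $ j *\<^sub>R noise k j \<omega>) (\<lambda>i. noise k i \<omega>)" for \<omega>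
  define F3 where "F3 \<omega> = disp_form p' (\<lambda>i. (\<Sum>j\<in>UNIV. B k $ i $ j *\<^sub>R y k \<omega> $ j)
      + (grad (Suc k) i \<omega> - grad k i \<omega>) - noise k i \<omega>) (\<lambda>i. noise (Suc k) i \<omega>)" for \<omega>
  define N1 where "N1 \<omega> = disp p' (\<lambda>i. noise k i \<omega>)" for \<omega>
  define N2 where "N2 \<omega> = disp p' (\<lambda>i. noise (Suc k) i \<omega>)" for \<omega>
  define N3 where "N3 \<omega> = (\<Sum>i\<in>UNIV. (norm (noise k i \<omega>))\<^sup>2)" for \<omega>
  define m where "m = (1 + \<tau>\<^sup>2) / 2"
  define m' where "m' = 4 * vphi\<^sup>2 * \<nu>"
  define m'' where "m'' = \<nu> * \<alpha>\<^sup>2"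
  define q where "q = 4 * L * \<alpha> * (\<psi> / real n)"
  have F1_meas: "(\<lambda>\<omega>. (\<Sum>j\<in>UNIV. B k $ i $ j *\<^sub>R y_pred k j \<omega>) + (gradf i (x_pred k i \<omega>) - grad k i \<omega>))
      \<in> borel_measurable (\<F> k)" for i
    by (intro borel_measurable_add borel_measurable_diff borel_measurable_sum borel_measurable_scaleR
        borel_measurable_const y_pred_meas grad_meas measurable_compose[OF x_pred_meas gradf_meas])
  have F1_sq: "sq_integrable (\<lambda>\<omega>. (\<Sum>j\<in>UNIV. B k $ i $ j *\<^sub>R y_pred k j \<omega>) + (gradf i (x_pred k i \<omega>) - grad k i \<omega>))" for i
    by (intro sq_integrable_add sq_integrable_diff sq_integrable_sum sq_integrable_scaleR y_pred_sq grad_sq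
        sq_integrable_gradf x_pred_sq) simp
  have F2_sq: "sq_integrable (\<lambda>\<omega>. \<Sum>j\<in>UNIV. B k $ i $ j *\<^sub>R noise k j \<omega>)" for i
    by (intro sq_integrable_sum sq_integrable_scaleR noise_sq) simp
  have F3_meas: "(\<lambda>\<omega>. (\<Sum>j\<in>UNIV. B k $ i $ j *\<^sub>R y k \<omega> $ j) + (grad (Suc k) i \<omega> - grad k i \<omega>) - noise k i \<omega>)
      \<in> borel_measurable (\<F> (Suc k))" for i
    by (intro borel_measurable_add borel_measurable_diff borel_measurable_sum borel_measurable_scaleR
        borel_measurable_const y_meas grad_meas F_mono[OF grad_meas] noise_meas_F) simp_all
  have F3_sq: "sq_integrable (\<lambda>\<omega>. (\<Sum>j\<in>UNIV. B k $ i $ j *\<^sub>R y k \<omega> $ j) + (grad (Suc k) i \<omega> - grad k i \<omega>) - noise k i \<omega>)" for i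
    by (intro sq_integrable_add sq_integrable_diff sq_integrable_sum sq_integrable_scaleR y_sq grad_sq noise_sq) simp
  have ints: "integrable Pr F1" "integrable Pr F2" "integrable Pr F3" "integrable Pr N1" "integrable Pr N2"
    "integrable Pr N3" "integrable Pr (track_err k)" "integrable Pr (cons_err k)" "integrable Pr (y_sq_sum k)"
    unfolding F1_def F2_def F3_def N1_def N2_def N3_def
    by (intro disp_form_integrable F1_sq F2_sq F3_sq noise_sq disp_integrable track_err_integrable
        cons_err_integrable y_sq_sum_integrable Bochner_Integration.integrable_sum sq_integrable_norm_sq)+
  have "expectation (track_err (Suc k)) \<le> expectation (\<lambda>\<omega>. m * track_err k \<omega> + m' * cons_err k \<omega>
      + m'' * y_sq_sum k \<omega> + N1 \<omega> + N2 \<omega> + q * N3 \<omega> - 2 * F1 \<omega> - 2 * F2 \<omega> + 2 * F3 \<omega>)"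
  proof (rule integral_mono[OF track_err_integrable])
    show "track_err (Suc k) \<omega> \<le> m * track_err k \<omega> + m' * cons_err k \<omega>
        + m'' * y_sq_sum k \<omega> + N1 \<omega> + N2 \<omega> + q * N3 \<omega> - 2 * F1 \<omega> - 2 * F2 \<omega> + 2 * F3 \<omega>" if "\<omega> \<in> space Pr" for \<omega>
      using track_err_step[OF that, of k]
      unfolding m_def m'_def m''_def q_def p'_def F1_def F2_def F3_def N1_def N2_def N3_def .
  qed (use ints in simp)
  also have "\<dots> = m * expectation (track_err k) + m' * expectation (cons_err k) + m'' * expectation (y_sq_sum k)
      + expectation N1 + expectation N2 + q * expectation N3 - 2 * expectation F1 - 2 * expectation F2 + 2 * expectation F3"
    using ints by simp
  also have "\<dots> \<le> m * expectation (track_err k) + m' * expectation (cons_err k) + m'' * expectation (y_sq_sum k)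
      + (4 * real n * \<psi> * \<sigma>\<^sup>2 + 2 * L * real n * \<psi> * \<sigma>\<^sup>2 * \<alpha>)"
  proof -
    have "expectation N1 \<le> \<psi> * \<sigma>\<^sup>2" "expectation N2 \<le> \<psi> * \<sigma>\<^sup>2"
      unfolding N1_def N2_def p'_def by (rule expectation_disp_noise_le)+
    moreover have "expectation F1 = 0" "expectation F3 = 0"
      unfolding F1_def F3_def
      by (rule expectation_disp_form_noise[OF F1_meas F1_sq], rule expectation_disp_form_noise[OF F3_meas F3_sq])
    moreover have "- (real n * \<sigma>\<^sup>2) \<le> expectation F2"
      unfolding F2_def p'_def by (rule expectation_disp_form_mixed_noise_ge)
    moreover have "real n * \<sigma>\<^sup>2 \<le> \<psi> * \<sigma>\<^sup>2" using n_le_psi by (intro mult_right_mono) auto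
    moreover have "q * expectation N3 \<le> 2 * L * real n * \<psi> * \<sigma>\<^sup>2 * \<alpha>"
    proof -
      have "expectation N3 = (\<Sum>i\<in>UNIV. expectation (\<lambda>\<omega>. (norm (noise k i \<omega>))\<^sup>2))"
        unfolding N3_def by (rule Bochner_Integration.integral_sum) (intro sq_integrable_norm_sq noise_sq)
      also have "\<dots> \<le> real n * \<sigma>\<^sup>2" by (rule expectation_sum_noise_sq_le)
      finally have "q * expectation N3 \<le> q * (real n * \<sigma>\<^sup>2)"
        using L_pos alpha_pos psi_pos by (intro mult_left_mono) (simp_all add: q_def)
      also have "\<dots> = 2 * (2 * L * \<psi> * \<sigma>\<^sup>2 * \<alpha>)" using n_ge_2 by (simp add: q_def)
      also have "\<dots> \<le> real n * (2 * L * \<psi> * \<sigma>\<^sup>2 * \<alpha>)"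
        using n_ge_2 L_pos alpha_pos psi_pos by (intro mult_right_mono) auto
      finally show ?thesis by (simp add: mult_ac)
    qed
    moreover have "4 * (\<psi> * \<sigma>\<^sup>2) \<le> 4 * real n * \<psi> * \<sigma>\<^sup>2"
    proof -
      have "1 * (\<psi> * \<sigma>\<^sup>2) \<le> real n * (\<psi> * \<sigma>\<^sup>2)" using n_ge_2 psi_pos by (intro mult_right_mono) auto
      then show ?thesis by simp
    qed
    ultimately show ?thesis by linarith
  qed
  finally show ?thesis by (simp only: m_def m'_def m''_def)
qed

section \<open>The linear recursion and its limit\<close>

definition err :: "nat \<Rightarrow> nat \<Rightarrow> 'w \<Rightarrow> real" where
  "err k j \<omega> = sq_errors (\<phi> k) (\<pi> k) xstar (x k \<omega>) (y k \<omega>) ! j"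

definition V :: "nat \<Rightarrow> nat \<Rightarrow> real" where
  "V k j = expectation (err k j)"

lemma err_eq: "err k 0 = opt_err k" "err k 1 = cons_err k" "err k 2 = track_err k"
proof -
  show "err k 0 = opt_err k"
    by (simp add: fun_eq_iff err_def sq_errors_def opt_err_def xhat_def wavg_def wmean_def)
  have "(wnorm w u)\<^sup>2 = (\<Sum>i\<in>UNIV. w $ i * (norm (u $ i))\<^sup>2)" if "\<And>i. 0 < w $ i" for w :: "real^'n" and u :: "real^'p^'n"
    unfolding wnorm_def by (intro real_sqrt_pow2 sum_nonneg mult_nonneg_nonneg) (simp_all add: less_imp_le[OF that])
  then show "err k 1 = cons_err k"
    by (simp add: fun_eq_iff err_def sq_errors_def cons_err_def wvar_def wavg_def wmean_def phi_pos)
  have "(S_disp u w)\<^sup>2 = disp (\<lambda>i. w $ i) (\<lambda>i. u $ i)" if "\<And>i. 0 < w $ i" for w :: "real^'n" and u :: "real^'p^'n"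
    unfolding S_disp_def disp_def by (intro real_sqrt_pow2 sum_nonneg mult_nonneg_nonneg) (simp_all add: less_imp_le[OF that])
  then show "err k 2 = track_err k"
    by (simp add: fun_eq_iff err_def sq_errors_def track_err_def pi_pos)
qed

lemma V_eq: "V k 0 = expectation (opt_err k)" "V k 1 = expectation (cons_err k)" "V k 2 = expectation (track_err k)"
  by (simp_all only: V_def err_eq)

lemma err_integrable: "j < 3 \<Longrightarrow> integrable Pr (err k j)"
  by (erule less_3_cases)
    (simp_all only: err_eq opt_err_integrable cons_err_integrable track_err_integrable)

abbreviation bv :: "real Matrix.vec" where "bv \<equiv> b_vec n L \<kappa> \<psi> c \<tau> \<sigma> \<alpha>"

text \<open>Positive entries of M make the right-hand side monotone in \<open>U\<close>, so the
  recursion may be evaluated at any vector above \<open>V k\<close> whose last component is large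
  enough for the noise.\<close>

lemma V_step:
  assumes U: "\<And>j. j < 3 \<Longrightarrow> V k j \<le> U j" and U2: "8 * real n * \<psi> * \<sigma>\<^sup>2 \<le> U 2" and i: "i < 3"
  shows "V (Suc k) i \<le> (\<Sum>j<3. M $$ (i, j) * U j) + bv $v i"
proof -
  have U': "V k 0 \<le> U 0" "V k 1 \<le> U 1" "V k 2 \<le> U 2" using U by simp_all
  note Y = expectation_y_sq_sum_le[OF U'[unfolded V_eq] U2]
  have "V (Suc k) 0 \<le> (\<Sum>j<3. M $$ (0, j) * U j) + bv $v 0"
  proof -
    have "V (Suc k) 0 \<le> M $$ (0, 0) * V k 0 + M $$ (0, 1) * V k 1 + M $$ (0, 2) * V k 2 + bv $v 0"
      unfolding V_eq M_mat_index b_vec_index using expectation_opt_err_step[of k] by (simp add: mult_ac)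
    also have "\<dots> \<le> M $$ (0, 0) * U 0 + M $$ (0, 1) * U 1 + M $$ (0, 2) * U 2 + bv $v 0"
      using U' by (intro add_mono mult_left_mono order_refl less_imp_le[OF M_pos]) simp_all
    finally show ?thesis by (simp only: sum_lessThan_3)
  qed
  moreover have "V (Suc k) 1 \<le> (\<Sum>j<3. M $$ (1, j) * U j) + bv $v 1"
  proof -
    have m5: "0 \<le> (1 + c\<^sup>2) / (1 - c\<^sup>2) * \<alpha>\<^sup>2" using c_sq by simp
    have "V (Suc k) 1 \<le> (1 + c\<^sup>2) / 2 * V k 1 + (1 + c\<^sup>2) / (1 - c\<^sup>2) * \<alpha>\<^sup>2 * expectation (y_sq_sum k)"
      unfolding V_eq by (rule expectation_cons_err_step)
    also have "\<dots> \<le> (1 + c\<^sup>2) / 2 * U 1 + (1 + c\<^sup>2) / (1 - c\<^sup>2) * \<alpha>\<^sup>2 *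
        (U 2 + 2 * \<sigma>\<^sup>2 + 2 * real n * L\<^sup>2 * vphi\<^sup>2 * (U 0 + U 1))"
      using U' Y m5 by (intro add_mono mult_left_mono) simp_all
    also have "\<dots> = (\<Sum>j<3. M $$ (1, j) * U j) + bv $v 1"
      unfolding sum_lessThan_3 M_mat_index b_vec_index by (simp add: algebra_simps)
    finally show ?thesis .
  qed
  moreover have "V (Suc k) 2 \<le> (\<Sum>j<3. M $$ (2, j) * U j) + bv $v 2"
  proof -
    have m8: "0 \<le> \<nu> * \<alpha>\<^sup>2" using nu_pos by simp
    have "V (Suc k) 2 \<le> (1 + \<tau>\<^sup>2) / 2 * V k 2 + 4 * vphi\<^sup>2 * \<nu> * V k 1 + \<nu> * \<alpha>\<^sup>2 * expectation (y_sq_sum k)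
        + (4 * real n * \<psi> * \<sigma>\<^sup>2 + 2 * L * real n * \<psi> * \<sigma>\<^sup>2 * \<alpha>)"
      unfolding V_eq by (rule expectation_track_err_step)
    also have "\<dots> \<le> (1 + \<tau>\<^sup>2) / 2 * U 2 + 4 * vphi\<^sup>2 * \<nu> * U 1 + \<nu> * \<alpha>\<^sup>2 *
        (U 2 + 2 * \<sigma>\<^sup>2 + 2 * real n * L\<^sup>2 * vphi\<^sup>2 * (U 0 + U 1))
        + (4 * real n * \<psi> * \<sigma>\<^sup>2 + 2 * L * real n * \<psi> * \<sigma>\<^sup>2 * \<alpha>)"
      by (rule add_right_mono, intro add_mono mult_left_mono) (use U' Y m8 nu_pos in simp_all)
    also have "\<dots> = (\<Sum>j<3. M $$ (2, j) * U j) + bv $v 2"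
      unfolding sum_lessThan_3 M_mat_index b_vec_index by (simp add: algebra_simps)
    finally show ?thesis .
  qed
  ultimately show ?thesis by (rule_tac less_3_cases[OF i]; simp only:)
qed

lemma linear_convergence:
  defines "w \<equiv> the (mat_inverse (1\<^sub>m 3 - M)) *\<^sub>v bv"
    and "\<rho> \<equiv> spectral_radius (map_mat complex_of_real M)"
  obtains v C where "w \<in> carrier_vec 3" "\<And>j. j < 3 \<Longrightarrow> 0 \<le> w $v j" "0 < \<rho>" "\<rho> < 1"
    "\<And>k j. j < 3 \<Longrightarrow> max 0 (V k j - w $v j) \<le> C * \<rho> ^ k * v j"
proof -
  obtain z :: "nat \<Rightarrow> real" where z: "\<And>i. i < 3 \<Longrightarrow> 0 < z i" "\<And>i. i < 3 \<Longrightarrow> (\<Sum>j<3. M $$ (i, j) * z j) < z i"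
    by (rule M_supersolution, rule that)
  obtain r v where rv: "0 < r" "\<And>i. i < 3 \<Longrightarrow> 0 < v i"
      "\<And>i. i < 3 \<Longrightarrow> (\<Sum>j<3. M $$ (i, j) * v j) = r * v i"
    by (rule perron_vector_exists_mat3[of M], rule M_pos, assumption+, rule that)
  have nonneg: "0 \<le> M $$ (i, j)" if "i < 3" "j < 3" for i j
    using M_pos[OF that] by simp
  have \<rho>: "\<rho> = r"
    unfolding \<rho>_def by (rule spectral_radius_eq_perron[OF M_mat_carrier _ nonneg rv]) simp_all
  have r1: "r < 1"
    by (rule perron_value_less_1[OF M_mat_carrier _ nonneg z rv(2,3)]) simp_all
  have w: "w \<in> carrier_vec 3" "\<And>i. i < 3 \<Longrightarrow> w $v i = (\<Sum>j<3. M $$ (i, j) * w $v j) + bv $v i"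
    unfolding w_def
    by (rule mat_inverse_solves[OF M_mat_carrier _ nonneg z b_vec_carrier]; simp; fail)+
  have b0: "0 \<le> bv $v i" if "i < 3" for i
    using c_sq L_pos psi_pos alpha_pos nu_pos
    by (rule_tac less_3_cases[OF that]; simp only: b_vec_index; simp)
  \<comment> \<open>The negative of w satisfies -w = M (-w) - b \<le> M (-w), so the maximum
    principle applies to it.\<close>
  have w0: "0 \<le> w $v i" if "i < 3" for i
  proof -
    have "- w $v i \<le> 0"
    proof (rule sub_fixed_point_nonpos[OF M_mat_carrier _ nonneg z, of "\<lambda>i. - w $v i"])
      show "- w $v i \<le> (\<Sum>j<3. M $$ (i, j) * - w $v j)" if "i < 3" for i
        using w(2)[OF that] b0[OF that] by (simp add: sum_negf)
    qed (use that in simp_all)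
    then show ?thesis by simp
  qed
  \<comment> \<open>Half of the component is returned by the last diagonal entry of M, so the
    component is at least twice the last entry of b.\<close>
  have w2: "8 * real n * \<psi> * \<sigma>\<^sup>2 \<le> w $v 2"
  proof -
    have "0 \<le> M $$ (2, 0) * w $v 0" "0 \<le> M $$ (2, 1) * w $v 1"
      using nonneg w0 by (intro mult_nonneg_nonneg; simp)+
    moreover have "1 / 2 \<le> M $$ (2, 2)"
      unfolding M_mat_index using nu_pos by (simp add: add_divide_distrib)
    then have "1 / 2 * w $v 2 \<le> M $$ (2, 2) * w $v 2"
      using w0[of 2] by (intro mult_right_mono) simp_all
    moreover have "4 * real n * \<psi> * \<sigma>\<^sup>2 \<le> bv $v 2"
      using L_pos psi_pos alpha_pos nu_pos by (simp add: b_vec_index)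
    moreover have "w $v 2 = M $$ (2, 0) * w $v 0 + M $$ (2, 1) * w $v 1 + M $$ (2, 2) * w $v 2 + bv $v 2"
      using w(2)[of 2] by (simp add: sum_lessThan_3)
    ultimately show ?thesis by linarith
  qed
  define e where "e k j = max 0 (V k j - w $v j)" for k j
  \<comment> \<open>A multiple of the Perron vector that dominates the initial excess; the sum over
    the components stands in for their maximum.\<close>
  define C where "C = (\<Sum>j<3. e 0 j / v j)"
  have e_step: "e (Suc k) i \<le> (\<Sum>j<3. M $$ (i, j) * e k j)" if "i < 3" for k i
  proof -
    \<comment> \<open>The vector \<open>w + e k\<close> is the componentwise maximum of
      \<open>w\<close> and \<open>V k\<close>; it inherits the size of the last component from
      \<open>w\<close>.\<close>
    have "V (Suc k) i \<le> (\<Sum>j<3. M $$ (i, j) * (w $v j + e k j)) + bv $v i"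
      using w2 by (intro V_step that) (simp_all add: e_def)
    also have "\<dots> = w $v i + (\<Sum>j<3. M $$ (i, j) * e k j)"
      using w(2)[OF that] by (simp add: distrib_left sum.distrib)
    finally have "V (Suc k) i - w $v i \<le> (\<Sum>j<3. M $$ (i, j) * e k j)" by simp
    moreover have "0 \<le> (\<Sum>j<3. M $$ (i, j) * e k j)"
      using that nonneg by (intro sum_nonneg mult_nonneg_nonneg) (simp_all add: e_def)
    ultimately show ?thesis by (simp add: e_def[of "Suc k"])
  qed
  have bound: "e k i \<le> C * r ^ k * v i" if "i < 3" for k i
    using that
  proof (induction k arbitrary: i)
    case 0
    have "e 0 i / v i \<le> C"
      unfolding C_def using 0 rv(2) by (intro member_le_sum) (auto simp: e_def less_imp_le)
    then show ?case using rv(2)[OF 0] by (simp add: pos_divide_le_eq)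
  next
    case (Suc k)
    have "e (Suc k) i \<le> (\<Sum>j<3. M $$ (i, j) * e k j)" by (rule e_step[OF Suc.prems])
    also have "\<dots> \<le> (\<Sum>j<3. M $$ (i, j) * (C * r ^ k * v j))"
      using Suc nonneg by (intro sum_mono mult_left_mono) simp_all
    also have "\<dots> = C * r ^ k * (\<Sum>j<3. M $$ (i, j) * v j)"
      by (simp add: sum_distrib_left mult_ac)
    also have "\<dots> = C * r ^ Suc k * v i" by (simp add: rv(3)[OF Suc.prems])
    finally show ?case .
  qed
  show thesis
    by (rule that[of C v]) (use w w0 rv r1 bound in \<open>simp_all only: \<rho> e_def\<close>)
qed

end

text \<open>The rate is stated for the positive part of the excess over the limiting bound: the
  errors may stay strictly below that bound, so the distance to it need not tend to 0.\<close>

theorem theorem1: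
  fixes n :: nat
    and f :: "'n::finite \<Rightarrow> real^'p \<Rightarrow> real"
    and gradf :: "'n \<Rightarrow> real^'p \<Rightarrow> real^'p"
    and gradF :: "real^'p \<Rightarrow> real^'p"
    and xstar :: "real^'p"
    and L \<mu> \<sigma> a b \<alpha> c \<tau> \<psi> \<kappa> vphi \<eta> :: real
    and E :: "nat \<Rightarrow> ('n \<times> 'n) set"
    and A B :: "nat \<Rightarrow> real^'n^'n"
    and Pr :: "'w measure"
    and \<xi> :: "nat \<Rightarrow> 'n \<Rightarrow> 'w \<Rightarrow> real^'m"
    and g :: "'n \<Rightarrow> real^'p \<Rightarrow> real^'m \<Rightarrow> real^'p"
    and x y :: "nat \<Rightarrow> 'w \<Rightarrow> real^'p^'n"
    and x0 :: "real^'p^'n"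
    and \<phi> \<pi> :: "nat \<Rightarrow> real^'n"
  assumes n_def: "n = CARD('n)"
    \<comment> \<open>costs\<close>
    and L_pos: "L > 0" and mu_pos: "\<mu> > 0"
    and gradf: "\<And>i z. GDERIV (f i) z :> gradf i z"
    and gradf_cont: "\<And>i. continuous_on UNIV (gradf i)"
    and gradf_lip: "\<And>i u v. norm (gradf i u - gradf i v) \<le> L * norm (u - v)"
    and gradF: "\<And>z. GDERIV (\<lambda>z. (1 / real n) * (\<Sum>i\<in>UNIV. f i z)) z :> gradF z"
    and strongly_convex: "\<And>u v. inner (gradF u - gradF v) (u - v) \<ge> \<mu> * (norm (u - v))\<^sup>2"
    and xstar: "\<And>z. z \<noteq> xstar \<Longrightarrow>
          (1 / real n) * (\<Sum>i\<in>UNIV. f i xstar) < (1 / real n) * (\<Sum>i\<in>UNIV. f i z)"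
    \<comment> \<open>graphs\<close>
    and connected: "\<And>k. strongly_connected (net (E k))"
    and self_loops: "\<And>k i. (i, i) \<in> E k"
    \<comment> \<open>weights\<close>
    and A_pos: "\<And>k i j. (j, i) \<in> E k \<or> j = i \<Longrightarrow> A k $ i $ j > 0"
    and A_zero: "\<And>k i j. \<not> ((j, i) \<in> E k \<or> j = i) \<Longrightarrow> A k $ i $ j = 0"
    and B_pos: "\<And>k i j. (j, i) \<in> E k \<or> j = i \<Longrightarrow> B k $ i $ j > 0"
    and B_zero: "\<And>k i j. \<not> ((j, i) \<in> E k \<or> j = i) \<Longrightarrow> B k $ i $ j = 0"
    and A_stochastic: "\<And>k. A k *v 1 = 1"
    and B_stochastic: "\<And>k. 1 v* B k = 1"
    and a_pos: "a > 0" and b_pos: "b > 0"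
    and A_ge: "\<And>k i j. A k $ i $ j > 0 \<Longrightarrow> A k $ i $ j \<ge> a"
    and B_ge: "\<And>k i j. B k $ i $ j > 0 \<Longrightarrow> B k $ i $ j \<ge> b"
    \<comment> \<open>stochastic oracle\<close>
    and prob: "prob_space Pr"
    and indep: "prob_space.indep_vars Pr (\<lambda>_. borel) (\<lambda>(k, i). \<xi> k i) UNIV"
    and g_meas: "\<And>i. (\<lambda>(z, s). g i z s) \<in> borel_measurable borel"
    and g_mean: "\<And>k i z. has_bochner_integral Pr (\<lambda>\<omega>. g i z (\<xi> k i \<omega>)) (gradf i z)"
    and sigma_pos: "\<sigma> > 0"
    and g_var_integrable: "\<And>k i z. integrable Pr (\<lambda>\<omega>. (norm (g i z (\<xi> k i \<omega>) - gradf i z))\<^sup>2)"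
    and g_var: "\<And>k i z. prob_space.expectation Pr
          (\<lambda>\<omega>. (norm (g i z (\<xi> k i \<omega>) - gradf i z))\<^sup>2) \<le> \<sigma>\<^sup>2"
    \<comment> \<open>algorithm\<close>
    and x_init: "\<And>\<omega>. \<omega> \<in> space Pr \<Longrightarrow> x 0 \<omega> = x0"
    and y_init: "\<And>i \<omega>. \<omega> \<in> space Pr \<Longrightarrow> y 0 \<omega> $ i = g i (x 0 \<omega> $ i) (\<xi> 0 i \<omega>)"
    and x_step: "\<And>k i \<omega>. \<omega> \<in> space Pr \<Longrightarrow>
          x (Suc k) \<omega> $ i = (\<Sum>j\<in>UNIV. A k $ i $ j *\<^sub>R x k \<omega> $ j) - \<alpha> *\<^sub>R y k \<omega> $ i"
    and y_step: "\<And>k i \<omega>. \<omega> \<in> space Pr \<Longrightarrow>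
          y (Suc k) \<omega> $ i = (\<Sum>j\<in>UNIV. B k $ i $ j *\<^sub>R y k \<omega> $ j)
            + g i (x (Suc k) \<omega> $ i) (\<xi> (Suc k) i \<omega>) - g i (x k \<omega> $ i) (\<xi> k i \<omega>)"
    \<comment> \<open>weight sequences\<close>
    and phi_pos: "\<And>k i. \<phi> k $ i > 0"
    and phi_sum: "\<And>k. (\<Sum>i\<in>UNIV. \<phi> k $ i) = 1"
    and phi_step: "\<And>k. \<phi> (Suc k) v* A k = \<phi> k"
    and pi_init: "\<pi> 0 = (\<chi> i. 1 / real n)"
    and pi_step: "\<And>k. \<pi> (Suc k) = B k *v \<pi> k"
    \<comment> \<open>uniform bounds\<close>
    and c_range: "0 < c" "c < 1"
    and c_bound: "\<And>k. c_factor a (net (E k)) (\<phi> k) (\<phi> (Suc k)) \<le> c"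
    and tau_range: "0 < \<tau>" "\<tau> < 1"
    and tau_bound: "\<And>k. tau_factor b (net (E k)) (\<pi> k) (\<pi> (Suc k)) \<le> \<tau>"
    and psi_pos: "\<psi> > 0"
    and psi_bound: "\<And>k. real n * ((inv_min_sqrt (\<pi> (Suc k)))\<^sup>2 - 1) \<le> \<psi>"
    and kappa_gt_1: "\<kappa> > 1"
    and kappa_bound: "\<And>k. inv_min_sqrt (\<pi> k) \<le> \<kappa>"
    and vphi_gt_1: "vphi > 1"
    and vphi_bound: "\<And>k. inv_min_sqrt (\<phi> k) \<le> vphi"
    and eta_range: "0 < \<eta>" "\<eta> < 1"
    and eta_bound: "\<And>k. \<eta> \<le> inner (\<phi> (Suc k)) (\<pi> k)"
    \<comment> \<open>the bound \<open>\<psi>\<close> on \<open>n (\<kappa>\<^sub>k\<^sub>+\<^sub>1\<^sup>2 - 1)\<close> is no coarser than the one that \<open>\<kappa>\<close> gives\<close>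
    and psi_le: "\<psi> \<le> real n * (\<kappa>\<^sup>2 - 1)"
    \<comment> \<open>step-size\<close>
    and alpha_pos: "\<alpha> > 0"
    and alpha_le: "\<alpha> \<le> Min
          {2 / (real n * \<eta> * (L + \<mu>)),
           \<mu> * \<eta> * (1 - c\<^sup>2) * (1 - \<tau>\<^sup>2) /
             (4 * L * vphi * sqrt ((real n * \<mu>\<^sup>2 * \<eta>\<^sup>2 + 24 * L\<^sup>2 * vphi\<^sup>2) * (\<eta> + 16 * \<kappa>\<^sup>2))),
           \<mu> * \<eta> * (1 - \<tau>\<^sup>2) /
             (\<kappa> * L * sqrt (2 * real n * \<mu>\<^sup>2 * \<eta>\<^sup>2 * (real n + 4)
                + 6 * L\<^sup>2 * vphi\<^sup>2 * (real n * \<eta> + 32)))}"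
  shows
    "let M = M_mat n L \<mu> \<eta> \<kappa> vphi \<psi> c \<tau> \<alpha>;
         \<rho> = spectral_radius (map_mat complex_of_real M);
         w = the (mat_inverse (1\<^sub>m 3 - M)) *\<^sub>v b_vec n L \<kappa> \<psi> c \<tau> \<sigma> \<alpha>;
         err = (\<lambda>k j \<omega>. sq_errors (\<phi> k) (\<pi> k) xstar (x k \<omega>) (y k \<omega>) ! j);
         V = (\<lambda>k. Matrix.vec 3 (\<lambda>j. prob_space.expectation Pr (err k j)))
     in \<rho> < 1 \<and> 0\<^sub>v 3 \<le> w \<and>
        (\<forall>k. \<forall>j<3. integrable Pr (err k j)) \<and>
        (\<forall>j<3. limsup (\<lambda>k. ereal (vec_index (V k) j)) \<le> ereal (vec_index w j)) \<and>
        (\<forall>j<3. (\<lambda>k. max 0 (vec_index (V k) j - vec_index w j)) \<in> O(\<lambda>k. \<rho> ^ k))"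
proof -
  interpret gradient_tracking Pr n f gradf gradF xstar L \<mu> \<sigma> a b \<alpha> c \<tau> \<psi> \<kappa> vphi \<eta> E A B \<xi> g x y x0 \<phi> \<pi>
    by (intro gradient_tracking.intro gradient_tracking_axioms.intro; fact)
  let ?M = "M_mat n L \<mu> \<eta> \<kappa> vphi \<psi> c \<tau> \<alpha>"
  let ?w = "the (mat_inverse (1\<^sub>m 3 - ?M)) *\<^sub>v b_vec n L \<kappa> \<psi> c \<tau> \<sigma> \<alpha>"
  let ?\<rho> = "spectral_radius (map_mat complex_of_real ?M)"
  obtain v C where w: "?w \<in> carrier_vec 3" "\<And>j. j < 3 \<Longrightarrow> 0 \<le> ?w $v j" and \<rho>: "0 < ?\<rho>" "?\<rho> < 1"
    and bound: "\<And>k j. j < 3 \<Longrightarrow> max 0 (V k j - ?w $v j) \<le> C * ?\<rho> ^ k * v j"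
    by (rule linear_convergence, rule that)
  have "0\<^sub>v 3 \<le> u" if "u \<in> carrier_vec 3" "\<And>j. j < 3 \<Longrightarrow> 0 \<le> u $v j" for u :: "real Matrix.vec"
    using that by (simp add: less_eq_vec_def)
  then have "0\<^sub>v 3 \<le> ?w" using w by blast
  moreover have "limsup (\<lambda>k. ereal (V k j)) \<le> ereal (?w $v j)" if "j < 3" for j
  proof -
    have le: "ereal (V k j) \<le> ereal (?w $v j + C * ?\<rho> ^ k * v j)" for k
      using bound[OF that, of k] by simp
    have "(\<lambda>k. ?w $v j + C * ?\<rho> ^ k * v j) \<longlonglongrightarrow> ?w $v j + C * 0 * v j"
      using \<rho> by (intro tendsto_intros LIMSEQ_realpow_zero) auto
    then have "(\<lambda>k. ereal (?w $v j + C * ?\<rho> ^ k * v j)) \<longlonglongrightarrow> ereal (?w $v j)" by simp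
    then have "limsup (\<lambda>k. ereal (?w $v j + C * ?\<rho> ^ k * v j)) = ereal (?w $v j)"
      by (rule lim_imp_Limsup[OF sequentially_bot])
    moreover have "limsup (\<lambda>k. ereal (V k j)) \<le> limsup (\<lambda>k. ereal (?w $v j + C * ?\<rho> ^ k * v j))"
      by (intro Limsup_mono always_eventually allI le)
    ultimately show ?thesis by simp
  qed
  moreover have "(\<lambda>k. max 0 (V k j - ?w $v j)) \<in> O(\<lambda>k. ?\<rho> ^ k)" if "j < 3" for j
  proof (rule bigoI[of _ "\<bar>C * v j\<bar>"], intro always_eventually allI)
    fix k
    have "max 0 (V k j - ?w $v j) \<le> C * v j * ?\<rho> ^ k" using bound[OF that, of k] by (simp add: mult_ac)
    also have "\<dots> \<le> \<bar>C * v j\<bar> * ?\<rho> ^ k" using \<rho> by (intro mult_right_mono) auto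
    finally show "norm (max 0 (V k j - ?w $v j)) \<le> \<bar>C * v j\<bar> * norm (?\<rho> ^ k)"
      using \<rho> by simp
  qed
  ultimately show ?thesis
    using \<rho>(2) err_integrable unfolding Let_def by (simp add: V_def err_def[abs_def])
qed

end
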